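(* Let $G(t_1,\dots,t_n)$ be the Bloch--Okounkov $n$-point function $$G(t_1,\dots,t_n)=\eta(q)\,\mathrm{tr}|_{\mathcal{F}_0}\, o(X(\psi,t_1x_1)X(\psi^*,x_1))\cdots o(X(\psi,t_nx_n)X(\psi^*,x_n))\,q^{\bar L(0)} ,$$ with $G=1$ when there are no arguments. Below, $(\dots,\hat t_{i_1},\dots,\hat t_{i_s},\dots)$ denotes the list of those $t_j$, $2\le j\le n$, with $j\notin\{i_1,\dots,i_s\}$. (a) Formally, $$G(t_1,\dots,t_n)+q^{-1/2}\Big(\prod_{i=1}^n t_i\Big)G\Big(\frac{t_1}{q},t_2,\dots,t_n\Big)=\delta_{1/2}(t_1)G(t_2,\dots,t_n)$$ $$+\sum_{s=1}^{n-1}\ \sum_{1<i_1<\dots<i_s\le n}\Big(-G(t_1t_{i_1}\cdots t_{i_s},\dots,\hat t_{i_1},\dots,\hat t_{i_s},\dots)+\delta_{1/2}(t_1t_{i_1}\cdots t_{i_s})\,G(\dots,\hat t_{i_1},\dots,\hat t_{i_s},\dots)\Big).$$ (b) Formally, $$\prod_{\substack{0\le s\le n-1\\ 1<i_1<\dots<i_s\le n}}(1-q\,t_1t_{i_1}\cdots t_{i_s})\Big(G(qt_1,t_2,\dots,t_n)+q^{1/2}\prod_{i=1}^n t_i\sum_{s=0}^{n-1}\ \sum_{1<i_1<\dots<i_s\le n}(-1)^sG(t_1t_{i_1}\cdots t_{i_s},\dots,\hat t_{i_1},\dots,\hat t_{i_s},\dots)\Big)=0.$$ (c) Let $|q|<1$.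 Then $G(t_1,\dots,t_n)$ converges inside the open subset $$\{(t_1,\dots,t_n)\in\mathbb{C}^n: |t_i|>1,\ i=1,\dots,n\}\cap\Big\{(t_1,\dots,t_n): \Big|\prod_{i=1}^n t_i\Big|<\frac1{|q|}\Big\},$$ and it has a meromorphic continuation on a double cover of $(\mathbb{C}^\times)^n$ with the set of poles contained in $$\{(t_1,\dots,t_n): q^mt_{i_1}\cdots t_{i_s}=1,\ 1\le i_1<\dots<i_s\le n,\ m\in\mathbb{Z}\}.$$
   Context: Charged free fermions: the Lie superalgebra with odd generators $\psi(n),\psi^*(n)$, $n\in\mathbb{Z}+\frac12$, and central $1$, with $[\psi(n),\psi^*(m)]=\delta_{m+n,0}$, $[\psi(n),\psi(m)]=[\psi^*(n),\psi^*(m)]=0$ (anticommutators). $\mathcal{F}$ is the Fock space generated from $\mathbf 1$ with $\psi(n)\mathbf 1=\psi^*(n)\mathbf 1=0$ for $n>0$; it is a vertex operator superalgebra of central charge $1$ with conformal vector $\omega=\frac12\psi^*(-3/2)\psi(-1/2)\mathbf 1+\frac12\psi(-3/2)\psi^*(-1/2)\mathbf 1$. $\mathcal{F}=\bigoplus_{m\in\mathbb{Z}}\mathcal{F}_m$ is the charge decomposition ($\psi(n)$ has charge $1$, $\psi^*(n)$ has charge $-1$, $\mathbf 1$ has charge $0$). With $\psi=\psi(-1/2)\mathbf 1$, $\psi^*=\psi^*(-1/2)\mathbf 1$ one has $X(\psi,x)=\sum_{n\in\mathbb{Z}+1/2}\psi(n)x^{-n}$, $X(\psi^*,x)=\sum_{n\in\mathbb{Z}+1/2}\psi^*(n)x^{-n}$,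 and $X(\psi,tx)=\sum_n\psi(n)t^{-n}x^{-n}$. $o(X(\psi,tx)X(\psi^*,x))=\mathrm{Res}_x\,x^{-1}X(\psi,tx)X(\psi^*,x)$ is the coefficient of $x^0$. $\bar L(0)=L(0)-\frac1{24}$, $\eta(q)=q^{1/24}\prod_{n\ge1}(1-q^n)$, $\delta_{1/2}(t)=\sum_{n\in\mathbb{Z}+1/2}t^n$. In (a) and (b) all identities are between formal series with exponents of $q^{1/2}$, $t_i^{1/2}$ in $\mathbb{Z}$; in (c) the variables are complex, $q=e^{2\pi i\tau}$ with $\tau$ in the upper half-plane. *)

theory Defs
  imports
    "HOL-Analysis.Analysis"
    "HOL-Computational_Algebra.Formal_Laurent_Series"
    "HOL-Library.Poly_Mapping"
begin

section \<open>Charged free fermions and their Fock space\<close>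

definition half_ints :: "rat set" where
  "half_ints = {n. n - 1/2 \<in> \<int>}"

text \<open>
  A Fock space \<open>\<F>\<close>: a complex vector space, generated from a nonzero vacuum by operators
  \<open>psi n\<close> (for \<open>\<psi>(n)\<close>) and \<open>psis n\<close> (for \<open>\<psi>\<^sup>*(n)\<close>) that satisfy the charged free fermion
  relations. Only the modes \<open>n \<in> half_ints\<close> matter.
  This determines \<open>\<F>\<close> up to a unique isomorphism.
\<close>

locale charged_fermions = vector_space scale
  for scale :: "complex \<Rightarrow> 'v::ab_group_add \<Rightarrow> 'v" +
  fixes psi psis :: "rat \<Rightarrow> 'v \<Rightarrow> 'v" and vac :: 'v
  assumes psi_linear: "n \<in> half_ints \<Longrightarrow> Vector_Spaces.linear scale scale (psi n)"
    and psis_linear: "n \<in> half_ints \<Longrightarrow> Vector_Spaces.linear scale scale (psis n)"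
    and psi_psis: "\<lbrakk>n \<in> half_ints; m \<in> half_ints\<rbrakk> \<Longrightarrow>
          psi n (psis m v) + psis m (psi n v) = (if m + n = 0 then v else 0)"
    and psi_psi: "\<lbrakk>n \<in> half_ints; m \<in> half_ints\<rbrakk> \<Longrightarrow> psi n (psi m v) + psi m (psi n v) = 0"
    and psis_psis: "\<lbrakk>n \<in> half_ints; m \<in> half_ints\<rbrakk> \<Longrightarrow> psis n (psis m v) + psis m (psis n v) = 0"
    and psi_vac: "\<lbrakk>n \<in> half_ints; n > 0\<rbrakk> \<Longrightarrow> psi n vac = 0"
    and psis_vac: "\<lbrakk>n \<in> half_ints; n > 0\<rbrakk> \<Longrightarrow> psis n vac = 0"
    and vac_nonzero: "vac \<noteq> 0"
    and generated: "\<lbrakk>subspace W; vac \<in> W;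
          \<And>n w. \<lbrakk>n \<in> half_ints; w \<in> W\<rbrakk> \<Longrightarrow> psi n w \<in> W \<and> psis n w \<in> W\<rbrakk> \<Longrightarrow> W = UNIV"
begin

inductive word_of_charge :: "int \<Rightarrow> 'v \<Rightarrow> bool" where
  "word_of_charge 0 vac"
| "word_of_charge m v \<Longrightarrow> n \<in> half_ints \<Longrightarrow> word_of_charge (m + 1) (psi n v)"
| "word_of_charge m v \<Longrightarrow> n \<in> half_ints \<Longrightarrow> word_of_charge (m - 1) (psis n v)"

definition charge_space :: "int \<Rightarrow> 'v set" where
  "charge_space m = span {v. word_of_charge m v}"

text \<open>Normally ordered products \<open>:\<psi>(n)\<psi>\<^sup>*(m):\<close> and \<open>:\<psi>\<^sup>*(n)\<psi>(m):\<close>.\<close>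

definition nord_psi_psis :: "rat \<Rightarrow> rat \<Rightarrow> 'v \<Rightarrow> 'v" where
  "nord_psi_psis n m v = (if n < 0 then psi n (psis m v) else - psis m (psi n v))"

definition nord_psis_psi :: "rat \<Rightarrow> rat \<Rightarrow> 'v \<Rightarrow> 'v" where
  "nord_psis_psi n m v = (if n < 0 then psis n (psi m v) else - psi m (psis n v))"

text \<open>
  \<open>L(0)\<close> is the coefficient of \<open>x\<^sup>-\<^sup>2\<close> in the vertex operator of \<open>\<omega>\<close>, which is
  \<open>Y(\<omega>,x) = 1/2 :(d/dx \<psi>\<^sup>*(x)) \<psi>(x): + 1/2 :(d/dx \<psi>(x)) \<psi>\<^sup>*(x):\<close>
  where \<open>\<psi>(x) = \<Sum>\<^sub>n \<psi>(n) x\<^bsup>-n-1/2\<^esup>\<close> and likewise for \<open>\<psi>\<^sup>*(x)\<close>.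
  For each \<open>v\<close> only finitely many terms are nonzero.
\<close>

definition L0_term :: "rat \<Rightarrow> 'v \<Rightarrow> 'v" where
  "L0_term n v = scale (of_rat ((- n - 1/2) / 2)) (nord_psis_psi n (- n) v + nord_psi_psis n (- n) v)"

definition L0 :: "'v \<Rightarrow> 'v" where
  "L0 v = (\<Sum>n | n \<in> half_ints \<and> L0_term n v \<noteq> 0. L0_term n v)"

definition Lbar0 :: "'v \<Rightarrow> 'v" where
  "Lbar0 v = L0 v - scale (1/24) v"

text \<open>
  The coefficient of \<open>t\<^sup>a x\<^sup>r\<close> in
  \<open>X(\<psi>,tx) X(\<psi>\<^sup>*,x) = \<Sum>\<^bsub>n,m\<^esub> \<psi>(n) \<psi>\<^sup>*(m) t\<^bsup>-n\<^esup> x\<^bsup>-n-m\<^esup>\<close>, and the coefficient of \<open>t\<^sup>a\<close> in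
  its zero mode \<open>o(X(\<psi>,tx) X(\<psi>\<^sup>*,x))\<close>.
\<close>

definition XX_coeff :: "rat \<Rightarrow> rat \<Rightarrow> 'v \<Rightarrow> 'v" where
  "XX_coeff a r v = (if - a \<in> half_ints \<and> a - r \<in> half_ints then psi (- a) (psis (a - r) v) else 0)"

definition o_coeff :: "rat \<Rightarrow> 'v \<Rightarrow> 'v" where
  "o_coeff a = XX_coeff a 0"

definition trace_on :: "'v set \<Rightarrow> ('v \<Rightarrow> 'v) \<Rightarrow> complex" where
  "trace_on W A =
     (let B = (SOME B. independent B \<and> span B = W) in \<Sum>b\<in>B. representation B (A b) b)"

text \<open>
  Series in \<open>q\<close> are formal Laurent series whose variable \<open>fls_X\<close> stands for \<open>q\<^bsup>1/24\<^esup>\<close>.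
  Here \<open>A\<close> has to commute with \<open>Lbar0\<close> and to preserve the charge.
\<close>

definition tr_F0 :: "('v \<Rightarrow> 'v) \<Rightarrow> complex fls" where
  "tr_F0 A = Abs_fls (\<lambda>k. trace_on {v \<in> charge_space 0. Lbar0 v = scale (of_int k / 24) v} A)"

end


section \<open>Formal series\<close>

text \<open>\<open>q\<^sup>r\<close> for \<open>r \<in> (1/24)\<int>\<close>\<close>

definition qpow :: "rat \<Rightarrow> complex fls" where
  "qpow r = fls_X_intpow \<lfloor>24 * r\<rfloor>"

definition eta :: "complex fls" where
  "eta = qpow (1/24) * fps_to_fls (prodinf (\<lambda>n. 1 - fps_X ^ (24 * (n + 1))))"

text \<open>
  An element \<open>e\<close> of \<^typ>\<open>nat \<Rightarrow>\<^sub>0 rat\<close> is the exponent of the monomial \<open>\<Prod>\<^sub>i t\<^sub>i\<^bsup>e(i)\<^esup>\<close>; a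
  formal series in the \<open>t\<^sub>i\<close> is the function of its coefficients.
  A pair \<open>(c, e)\<close> stands for the monomial \<open>q\<^sup>c t\<^sup>e\<close>.
\<close>

type_synonym texp = "nat \<Rightarrow>\<^sub>0 rat"
type_synonym fseries = "texp \<Rightarrow> complex fls"
type_synonym qt_monomial = "rat \<times> texp"

text \<open>\<open>q\<^sup>c \<Prod>\<^bsub>i\<in>M\<^esub> t\<^sub>i\<close>\<close>

definition mon :: "rat \<Rightarrow> nat set \<Rightarrow> qt_monomial" where
  "mon c M = (c, \<Sum>i\<in>M. Poly_Mapping.single i 1)"

definition lpoly_mon :: "qt_monomial \<Rightarrow> texp \<Rightarrow>\<^sub>0 complex fls" where
  "lpoly_mon m = Poly_Mapping.single (snd m) (qpow (fst m))"

text \<open>Product of series; it makes sense if each of these sums is finite.\<close>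

definition fmul :: "fseries \<Rightarrow> fseries \<Rightarrow> fseries" (infixl \<open>\<odot>\<close> 70) where
  "(A \<odot> B) a = (\<Sum>(x, y) | x + y = a \<and> A x \<noteq> 0 \<and> B y \<noteq> 0. A x * B y)"

text \<open>
  Substitution of monomials \<open>m\<^sub>1, \<dots>, m\<^sub>k\<close> for the variables of a series in \<open>k\<close> variables.
  The latter is given by its coefficients \<open>A [b\<^sub>1, \<dots>, b\<^sub>k]\<close>.
\<close>

definition fsubst :: "(rat list \<Rightarrow> complex fls) \<Rightarrow> qt_monomial list \<Rightarrow> fseries" where
  "fsubst A ms a =
     (\<Sum>b | length b = length ms \<and> A b \<noteq> 0 \<and>
            (\<forall>i. (\<Sum>j<length ms. b ! j * Poly_Mapping.lookup (snd (ms ! j)) i) = Poly_Mapping.lookup a i).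
        A b * qpow (\<Sum>j<length ms. b ! j * fst (ms ! j)))"

definition delta_half :: "qt_monomial \<Rightarrow> fseries" where
  "delta_half m = fsubst (\<lambda>b. if hd b \<in> half_ints then 1 else 0) [m]"


section \<open>The Bloch--Okounkov function\<close>

context charged_fermions
begin

text \<open>The coefficient of \<open>t\<^sub>1\<^bsup>b\<^sub>1\<^esup> \<dots> t\<^sub>n\<^bsup>b\<^sub>n\<^esup>\<close> in \<open>G(t\<^sub>1, \<dots>, t\<^sub>n)\<close>\<close>

definition G_coeff :: "rat list \<Rightarrow> complex fls" where
  "G_coeff b = (if b = [] then 1 else eta * tr_F0 (foldr (\<circ>) (map o_coeff b) id))"

definition G_series :: "qt_monomial list \<Rightarrow> fseries" where
  "G_series = fsubst G_coeff"

text \<open>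
  The terms of \<open>G(t\<^sub>1, \<dots>, t\<^sub>n)\<close> at complex arguments, where \<open>u\<close> is the value of \<open>q\<^bsup>1/24\<^esup>\<close>.
  All exponents \<open>b\<^sub>j = \<lfloor>b\<^sub>j\<rfloor> + 1/2\<close> are in \<open>\<int> + 1/2\<close>,
  so the value of \<open>\<Prod>\<^sub>j t\<^sub>j\<^bsup>b\<^sub>j\<^esup>\<close> depends on the choice of a square root \<open>s\<close> of \<open>t\<^sub>1 \<cdots> t\<^sub>n\<close> only.
\<close>

definition G_term :: "complex \<Rightarrow> complex list \<Rightarrow> complex \<Rightarrow> int \<times> rat list \<Rightarrow> complex" where
  "G_term u ts s = (\<lambda>(k, b). fls_nth (G_coeff b) k * u powi k *
     (s * (\<Prod>j<length ts. (ts ! j) powi \<lfloor>b ! j\<rfloor>)))"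

definition G_index :: "nat \<Rightarrow> (int \<times> rat list) set" where
  "G_index n = UNIV \<times> {b. length b = n \<and> set b \<subseteq> half_ints}"

end


section \<open>Meromorphic functions on the double cover of the complex torus\<close>

text \<open>The points of the double cover are \<open>(t, s)\<close> where \<open>s\<close> is a square root of \<open>\<Prod>\<^sub>i t\<^sub>i\<close>.\<close>

definition double_cover :: "((complex ^ 'm) \<times> complex) set" where
  "double_cover = {(t, s). (\<forall>i. t $ i \<noteq> 0) \<and> s\<^sup>2 = (\<Prod>i\<in>UNIV. t $ i)}"

definition multi_holomorphic_on :: "((complex ^ 'm) \<times> complex \<Rightarrow> complex) \<Rightarrow> ((complex ^ 'm) \<times> complex) set \<Rightarrow> bool" where
  "multi_holomorphic_on f U \<longleftrightarrow> open U \<and>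
     (\<forall>p\<in>U. \<exists>f'. (f has_derivative f') (at p) \<and> (\<forall>c v w. f' (c *s v, c * w) = c * f' (v, w)))"

text \<open>
  The cover is a closed complex submanifold of \<open>(\<complex>\<^sup>\<times>)\<^sup>m \<times> \<complex>\<close>, so functions on it are holomorphic
  iff they are local restrictions of holomorphic functions on the ambient space.
\<close>

definition holomorphic_at_cover :: "((complex ^ 'm) \<times> complex \<Rightarrow> complex) \<Rightarrow> (complex ^ 'm) \<times> complex \<Rightarrow> bool" where
  "holomorphic_at_cover F p \<longleftrightarrow>
     (\<exists>U f. p \<in> U \<and> multi_holomorphic_on f U \<and> (\<forall>z \<in> U \<inter> double_cover. F z = f z))"

text \<open>
  Locally a quotient \<open>g/h\<close>, where \<open>h\<close> does not vanish identically on any nonempty open subset of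
  the cover. The value of \<open>F\<close> at zeros of \<open>h\<close> is arbitrary.
\<close>

definition meromorphic_on_cover :: "((complex ^ 'm) \<times> complex \<Rightarrow> complex) \<Rightarrow> bool" where
  "meromorphic_on_cover F \<longleftrightarrow>
     (\<forall>p\<in>double_cover. \<exists>U g h. p \<in> U \<and> multi_holomorphic_on g U \<and> multi_holomorphic_on h U \<and>
        (\<forall>V. open V \<and> V \<subseteq> U \<and> V \<inter> double_cover \<noteq> {} \<longrightarrow> (\<exists>z \<in> V \<inter> double_cover. h z \<noteq> 0)) \<and>
        (\<forall>z \<in> U \<inter> double_cover. h z \<noteq> 0 \<longrightarrow> F z = g z / h z))"

text \<open>
  A point is a pole if \<open>F\<close> is not holomorphic there. This counts removable singularities at which
  \<open>F\<close> has the wrong value, so an upper bound for this set is also one for the polar set.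
\<close>

definition cover_poles :: "((complex ^ 'm) \<times> complex \<Rightarrow> complex) \<Rightarrow> ((complex ^ 'm) \<times> complex) set" where
  "cover_poles F = {p \<in> double_cover. \<not> holomorphic_at_cover F p}"

end

(*
  The operators psi(-a) psi^*(a) are commuting projections, and F has a basis of joint
  eigenvectors indexed by Maya diagrams S (sets of occupied sites, where site j stands for the
  mode a = j + 1/2), so the coefficient of t^b in G counts the diagrams of charge 0 in which all
  sites of b are occupied. Removing the particle at site j and translating by one step gives
    f(B + {j}) = q^(j+1) (f(B') - f(B' + {j+1})),   B' = B translated by 1,
  and (a), (b) follow by comparing coefficients; the normalization f({}) = 1 is Euler's formula.
  Iterating this identity to the right for j >= 0 and to the left for j < 0 and summing over b gives
    G(t_J) = sum_I A_|I|(t_i t_I, t_R) G(t_R),   R = J - {i} - I,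
    A_m(x, y) = sum_{r in Z} (-1)^(r-1) r^m q^(r^2/2) y^(-r) (q^r x)^(1/2) / (1 - q^r x),
  with absolute convergence in the domain of (c). The right-hand side is meromorphic with poles only
  where q^r x = 1, so it provides the continuation.
*)
theory Submission
  imports Defs
    "HOL-Complex_Analysis.Cauchy_Integral_Formula"
    "HOL-Library.Nat_Bijection"
begin

section \<open>Maya diagrams\<close>

text \<open>The obstacle is coinciding exponents. The coefficient of t^b depends only on the set of
  sites in b, so emptying the site of one t_i also affects every other variable with the same
  exponent. The sums over subsets I in (a) and (b) account for this, and so does the weight r^m in
  A_m with m = |I|: summed over the subsets of an m-element set, r^|I| gives (r+1)^m, and the r-th
  summand becomes w(r) - w(r-1) with w(r) = (r+1)^m (-1)^r q^(rj + r(r+1)/2) f(B + r), where B + r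
  is the translate of B and m counts the other variables at site j. The direction of the iteration
  follows the sign of j, so that the exponent rj + r(r+1)/2 is at least |r| for every j; the
  remainder then vanishes in each coefficient of q. Afterwards j >= 0 is paired with r >= 1 and j <
  0 with r <= 0. In the domain of (c), |q^r x| is below 1 in the first case and above 1 in the
  second, and both geometric series in j have the same fraction as value up to sign. This fuses the
  two directions into one sum over all r.\<close>

definition maya :: "int set \<Rightarrow> bool" where
  "maya S \<longleftrightarrow> finite (S \<inter> {0..}) \<and> finite ({..<0} - S)"

definition charge :: "int set \<Rightarrow> int" where
  "charge S = int (card (S \<inter> {0..})) - int (card ({..<0} - S))"

text \<open>Site j has energy j + 1/2. The halves are left out: they add up to half the charge,
  which is zero for all diagrams that are counted. Holes sit at negative sites, so they raise the
  energy.\<close>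

definition energy :: "int set \<Rightarrow> int" where
  "energy S = \<Sum>(S \<inter> {0..}) - \<Sum>({..<0} - S)"

lemma maya_vac [simp]: "maya {..<0}"
proof -
  have "{..<0} \<inter> {0..} = ({} :: int set)"
    by auto
  then show ?thesis
    by (simp add: maya_def)
qed

lemma charge_vac [simp]: "charge {..<0} = 0"
proof -
  have "{..<0} \<inter> {0..} = ({} :: int set)"
    by auto
  then show ?thesis
    by (simp add: charge_def)
qed

lemma energy_vac [simp]: "energy {..<0} = 0"
proof -
  have "{..<0} \<inter> {0..} = ({} :: int set)"
    by auto
  then show ?thesis
    by (simp add: energy_def)
qed

lemma
  assumes "j \<notin> S"
  shows maya_insert_iff: "maya (insert j S) \<longleftrightarrow> maya S"
    and charge_insert: "maya S \<Longrightarrow> charge (insert j S) = charge S + 1"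
    and energy_insert: "maya S \<Longrightarrow> energy (insert j S) = energy S + j"
proof -
  have 1: "insert j S \<inter> {0..} = (if j \<ge> 0 then insert j (S \<inter> {0..}) else S \<inter> {0..})"
    by auto
  define H where "H = {..<0} - insert j S"
  have 2: "{..<0} - S = (if j < 0 then insert j H else H)" and 3: "{..<0} - insert j S = H"
    using assms by (auto simp: H_def)
  have nH: "j \<notin> H"
    by (simp add: H_def)
  show m: "maya (insert j S) \<longleftrightarrow> maya S"
    unfolding maya_def 1 2 3 by auto
  assume S: "maya S"
  have f: "finite (S \<inter> {0..})" "finite H"
    using S m by (auto simp: maya_def H_def)
  show "charge (insert j S) = charge S + 1"
    unfolding charge_def 1 2 3 using assms f nH by auto
  show "energy (insert j S) = energy S + j"
    unfolding energy_def 1 2 3 using assms f nH by auto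
qed

lemma
  assumes "j \<in> S" "maya S"
  shows maya_remove: "maya (S - {j})"
    and charge_remove: "charge (S - {j}) = charge S - 1"
    and energy_remove: "energy (S - {j}) = energy S - j"
proof -
  have eq: "insert j (S - {j}) = S" and nin: "j \<notin> S - {j}"
    using assms by auto
  show m: "maya (S - {j})"
    using maya_insert_iff[OF nin] assms eq by simp
  show "charge (S - {j}) = charge S - 1"
    using charge_insert[OF nin m] eq by simp
  show "energy (S - {j}) = energy S - j"
    using energy_insert[OF nin m] eq by simp
qed

definition shift :: "int \<Rightarrow> int set \<Rightarrow> int set" where
  "shift c S = (\<lambda>x. x + c) ` S"

lemma in_shift_iff: "x \<in> shift c S \<longleftrightarrow> x - c \<in> S"
  unfolding shift_def by (auto simp: image_iff intro: bexI[of _ "x - c"])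

lemma shift_insert [simp]: "shift c (insert j S) = insert (j + c) (shift c S)"
  by (simp add: shift_def)

lemma shift_shift [simp]: "shift a (shift b S) = shift (a + b) S"
  by (auto simp: in_shift_iff algebra_simps)

lemma shift_0 [simp]: "shift 0 S = S"
  by (simp add: shift_def)

lemma shift_empty [simp]: "shift c {} = {}"
  by (simp add: shift_def)

lemma finite_shift_iff [simp]: "finite (shift c S) \<longleftrightarrow> finite S"
  unfolding shift_def by (rule finite_image_iff) auto

lemma shift_mono_iff [simp]: "shift c A \<subseteq> shift c B \<longleftrightarrow> A \<subseteq> B"
  unfolding shift_def by (rule inj_image_subset_iff) auto

lemma sum_shift: "(\<Sum>x\<in>shift c S. f x) = (\<Sum>x\<in>S. f (x + c))"
  unfolding shift_def by (subst sum.reindex) auto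

lemma card_shift [simp]: "card (shift c S) = card S"
  unfolding shift_def by (rule card_image) auto

text \<open>Only site -1 changes its status: a particle there starts to be counted at 0, a hole
  there disappears. Every particle gains one unit of energy and every hole loses one, so the energy
  changes by the number of particles minus the number of holes.\<close>

lemma
  assumes "maya S"
  shows maya_shift1: "maya (shift 1 S)"
    and charge_shift1: "charge (shift 1 S) = charge S + 1"
    and energy_shift1: "energy (shift 1 S) = energy S + charge S"
proof -
  define P where "P = shift 1 (S \<inter> {0..})"
  define K where "K = {..<0} - S - {-1}"
  define H where "H = shift 1 K"
  have fin: "finite P" "finite H"
    using assms by (auto simp: maya_def P_def H_def K_def)
  have P: "shift 1 S \<inter> {0..} = (if -1 \<in> S then insert 0 P else P)"
  proof (intro set_eqI)
    fix x :: int
    consider "x = 0" | "x < 0" | "x > 0" by linarith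
    then show "x \<in> shift 1 S \<inter> {0..} \<longleftrightarrow> x \<in> (if -1 \<in> S then insert 0 P else P)"
      by cases (auto simp: P_def in_shift_iff)
  qed
  have H: "{..<0} - shift 1 S = H"
    by (auto simp: H_def K_def in_shift_iff)
  have nP: "0 \<notin> P"
    by (auto simp: P_def in_shift_iff)
  have h: "{..<0} - S = (if -1 \<in> S then K else insert (-1) K)"
    by (auto simp: K_def)
  have f: "finite K" "-1 \<notin> K"
    using assms by (auto simp: maya_def K_def)
  show "maya (shift 1 S)"
    unfolding maya_def P H using fin by auto
  have cP: "card P = card (S \<inter> {0..})" "\<Sum>P = \<Sum>(S \<inter> {0..}) + int (card (S \<inter> {0..}))"
    by (simp_all add: P_def sum_shift sum.distrib)
  have cH: "card H = card K"
    "\<Sum>H = \<Sum>K + int (card K)"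
    by (simp_all add: H_def sum_shift sum.distrib)
  have ch: "int (card ({..<0} - S)) = int (card K) + (if -1 \<in> S then 0 else 1)"
    unfolding h using f by auto
  have eh: "\<Sum>({..<0} - S) = \<Sum>K - (if -1 \<in> S then 0 else 1)"
    unfolding h using f by auto
  show "charge (shift 1 S) = charge S + 1"
    unfolding charge_def P H ch using fin nP cP cH by auto
  show "energy (shift 1 S) = energy S + charge S"
    unfolding energy_def charge_def P H ch eh using fin nP cP cH by auto
qed

lemma maya_shift1_iff [simp]: "maya (shift 1 S) \<longleftrightarrow> maya S"
proof
  assume *: "maya (shift 1 S)"
  have 1: "S \<inter> {0..} \<subseteq> shift (-1) (shift 1 S \<inter> {0..})"
    "{..<0} - S \<subseteq> insert (-1) (shift (-1) ({..<0} - shift 1 S))"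
    by (auto simp: in_shift_iff)
  show "maya S"
    using * unfolding maya_def
    by (auto intro: finite_subset[OF 1(1)] finite_subset[OF 1(2)])
qed (rule maya_shift1)

definition states :: "int set \<Rightarrow> int \<Rightarrow> int set set" where
  "states B k = {S. maya S \<and> charge S = 0 \<and> energy S = k \<and> B \<subseteq> S}"

lemma energy_nonneg: "energy S \<ge> 0"
proof -
  have "\<Sum>(S \<inter> {0..}) \<ge> 0" "\<Sum>({..<0} - S) \<le> 0"
    by (auto intro: sum_nonneg sum_nonpos)
  then show ?thesis
    by (simp add: energy_def)
qed

lemma states_neg: "k < 0 \<Longrightarrow> states B k = {}"
  using energy_nonneg by (auto simp: states_def) (metis not_less)

text \<open>No particle and no hole contributes negatively, so a single one cannot exceed the total.
  Hence a diagram of energy k is determined by its part in [-k, k].\<close>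

lemma states_bounds:
  assumes "maya S"
  shows "x \<in> S \<Longrightarrow> x \<le> energy S" and "x \<notin> S \<Longrightarrow> x \<ge> - energy S"
proof -
  have P: "\<Sum>(S \<inter> {0..}) \<ge> 0" and H: "\<Sum>({..<0} - S) \<le> 0"
    by (auto intro: sum_nonneg sum_nonpos)
  show "x \<le> energy S" if "x \<in> S"
  proof (cases "x \<ge> 0")
    case True
    have "x \<le> \<Sum>(S \<inter> {0..})"
      using member_le_sum[of x "S \<inter> {0..}" "\<lambda>x. x"] that True assms by (auto simp: maya_def)
    then show ?thesis
      using H by (simp add: energy_def)
  qed (use energy_nonneg[of S] in auto)
  show "x \<ge> - energy S" if "x \<notin> S"
  proof (cases "x < 0")
    case True
    have "- x \<le> (\<Sum>x\<in>{..<0} - S. - x)"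
      using member_le_sum[of x "{..<0} - S" "\<lambda>x. - x"] that True assms by (auto simp: maya_def)
    then show ?thesis
      using P by (simp add: energy_def sum_negf)
  qed (use energy_nonneg[of S] in auto)
qed

lemma finite_states [simp]: "finite (states B k)"
proof (rule finite_subset)
  show "states B k \<subseteq> (\<lambda>T. {..<-k} \<union> T) ` Pow {-k..k}"
  proof
    fix S assume S: "S \<in> states B k"
    have "S = {..<-k} \<union> (S \<inter> {-k..k})"
      using S states_bounds[of S] by (force simp: states_def)
    then show "S \<in> (\<lambda>T. {..<-k} \<union> T) ` Pow {-k..k}"
      by blast
  qed
qed auto

text \<open>
  Removing the particle at site \<open>j\<close> lowers the charge by one; translating the result by one step
  brings the charge back to zero.
\<close>

lemma bij_betw_states:
  assumes "j \<notin> B"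
  shows "bij_betw (\<lambda>S. shift 1 (S - {j})) (states (insert j B) k)
           (states (shift 1 B) (k - (j + 1)) - states (insert (j + 1) (shift 1 B)) (k - (j + 1)))"
proof (rule bij_betw_byWitness[where f' = "\<lambda>S. insert j (shift (-1) S)"])
  show "\<forall>S\<in>states (insert j B) k. insert j (shift (-1) (shift 1 (S - {j}))) = S"
    by (auto simp: states_def)
  show "\<forall>S\<in>states (shift 1 B) (k - (j + 1)) - states (insert (j + 1) (shift 1 B)) (k - (j + 1)).
          shift 1 (insert j (shift (-1) S) - {j}) = S"
    by (auto simp: states_def in_shift_iff)
  show "(\<lambda>S. shift 1 (S - {j})) ` states (insert j B) k \<subseteq>
          states (shift 1 B) (k - (j + 1)) - states (insert (j + 1) (shift 1 B)) (k - (j + 1))"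
  proof clarify
    fix S assume S: "S \<in> states (insert j B) k"
    \<comment> \<open>Removal lowers the energy by j and leaves charge -1. Translation then changes
      the energy by this charge, which is the source of j + 1.\<close>
    have *: "maya (S - {j})" "charge (S - {j}) = -1" "energy (S - {j}) = k - j"
      using S maya_remove[of j S] charge_remove[of j S] energy_remove[of j S]
      by (auto simp: states_def)
    have "B \<subseteq> S - {j}"
      using S assms by (auto simp: states_def)
    then show "shift 1 (S - {j}) \<in> states (shift 1 B) (k - (j + 1))
        - states (insert (j + 1) (shift 1 B)) (k - (j + 1))"
      using * charge_shift1[OF *(1)] energy_shift1[OF *(1)]
      by (auto simp: states_def in_shift_iff)
  qed
  show "(\<lambda>S. insert j (shift (-1) S)) ` (states (shift 1 B) (k - (j + 1))
          - states (insert (j + 1) (shift 1 B)) (k - (j + 1))) \<subseteq> states (insert j B) k"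
  proof clarify
    fix S assume S: "S \<in> states (shift 1 B) (k - (j + 1))"
      and nS: "S \<notin> states (insert (j + 1) (shift 1 B)) (k - (j + 1))"
    define T where "T = shift (-1) S"
    have ST: "S = shift 1 T"
      by (simp add: T_def)
    have jT: "j \<notin> T"
      using S nS by (auto simp: states_def ST in_shift_iff)
    have T: "maya T" "charge T = -1" "energy T = k - j" "B \<subseteq> T"
      using S charge_shift1[of T] energy_shift1[of T] by (auto simp: states_def ST)
    show "insert j (shift (-1) S) \<in> states (insert j B) k"
      unfolding T_def[symmetric] using T jT
      by (auto simp: states_def maya_insert_iff charge_insert energy_insert)
  qed
qed

lemma card_states_insert:
  assumes "j \<notin> B"
  shows "int (card (states (insert j B) k)) =
    int (card (states (shift 1 B) (k - (j + 1)))) -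
    int (card (states (insert (j + 1) (shift 1 B)) (k - (j + 1))))"
proof -
  have sub: "states (insert (j + 1) (shift 1 B)) (k - (j + 1)) \<subseteq> states (shift 1 B) (k - (j + 1))"
    by (auto simp: states_def)
  have "card (states (insert j B) k) = card (states (shift 1 B) (k - (j + 1)))
          - card (states (insert (j + 1) (shift 1 B)) (k - (j + 1)))"
    using bij_betw_same_card[OF bij_betw_states[OF assms, of k]] card_Diff_subset[OF _ sub] by simp
  moreover have "card (states (insert (j + 1) (shift 1 B)) (k - (j + 1))) \<le> card (states (shift 1 B) (k - (j + 1)))"
    using sub by (intro card_mono) auto
  ultimately show ?thesis
    by simp
qed

section \<open>Generating functions of Maya diagrams\<close>

unbundle fps_syntax

lemma nth_qpow_mult: "(qpow r * f) $$ k = f $$ (k - \<lfloor>24 * r\<rfloor>)"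
  by (simp add: qpow_def fls_X_intpow_times_conv_shift(1))

lemma qpow_0 [simp]: "qpow 0 = 1"
  by (simp add: qpow_def)

lemma qpow_add:
  assumes "24 * r \<in> \<int>"
  shows "qpow (r + s) = qpow r * qpow s"
proof -
  obtain m where "24 * r = of_int m"
    using assms by (elim Ints_cases)
  then have "\<lfloor>24 * (r + s)\<rfloor> = \<lfloor>24 * r\<rfloor> + \<lfloor>24 * s\<rfloor>"
    by (simp add: distrib_left)
  then show ?thesis
    by (simp only: qpow_def fls_X_intpow_times_fls_X_intpow)
qed

lemma qpow_of_int_add: "qpow (of_int (i + j)) = qpow (of_int i) * qpow (of_int j)"
  by (simp add: qpow_add)

definition state_series :: "int set \<Rightarrow> complex fls" where
  "state_series B =
     Abs_fls (\<lambda>k. if 24 dvd k then of_nat (card (states B (k div 24))) else 0)"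

lemma nth_state_series:
  "state_series B $$ k = (if 24 dvd k then of_nat (card (states B (k div 24))) else 0)"
  unfolding state_series_def
  by (rule nth_Abs_fls_lower_bound[where N = 0]) (auto simp: states_neg)

lemma nth_state_series_neg: "k < 0 \<Longrightarrow> state_series B $$ k = 0"
  by (simp add: nth_state_series states_neg)

lemma nth_state_series_24: "state_series B $$ (24 * m) = of_nat (card (states B m))"
  by (simp add: nth_state_series)

lemma state_series_insert:
  assumes "j \<notin> B"
  shows "state_series (insert j B) =
    qpow (of_int (j + 1)) * (state_series (shift 1 B) - state_series (insert (j + 1) (shift 1 B)))"
proof (rule fls_eqI)
  fix k :: int
  have fl: "\<lfloor>24 * (of_int (j + 1) :: rat)\<rfloor> = 24 * (j + 1)"
    using floor_of_int[of "24 * (j + 1)", where 'a = rat] by (simp only: of_int_mult of_int_numeral)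
  show "state_series (insert j B) $$ k = (qpow (of_int (j + 1)) *
      (state_series (shift 1 B) - state_series (insert (j + 1) (shift 1 B)))) $$ k"
  proof (cases "24 dvd k")
    case True
    then obtain m where m: "k = 24 * m"
      by (elim dvdE)
    have "(of_nat (card (states (insert j B) m)) :: complex) =
        of_nat (card (states (shift 1 B) (m - (j + 1)))) -
        of_nat (card (states (insert (j + 1) (shift 1 B)) (m - (j + 1))))"
      using arg_cong[OF card_states_insert[OF assms, of m], of "of_int :: int \<Rightarrow> complex"]
      by (simp only: of_int_diff of_int_of_nat_eq)
    moreover have "24 * m - 24 * (j + 1) = 24 * (m - (j + 1))"
      by (simp only: right_diff_distrib)
    ultimately show ?thesis
      unfolding nth_qpow_mult fl fls_minus_nth m by (simp only: nth_state_series_24)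
  next
    case False
    then have "\<not> 24 dvd k - 24 * (j + 1)"
      by presburger
    then show ?thesis
      using False unfolding nth_qpow_mult fl fls_minus_nth nth_state_series by (simp only: if_False diff_0_right)
  qed
qed

subsection \<open>Euler's generating function\<close>

definition euler :: "complex fps" where
  "euler = prodinf (\<lambda>n. 1 - fps_X ^ (24 * (n + 1)))"

definition euler_upto :: "nat \<Rightarrow> complex fps" where
  "euler_upto N = (\<Prod>n<N. 1 - fps_X ^ (24 * (n + 1)))"

lemma euler_upto_Suc: "euler_upto (Suc N) = (1 - fps_X ^ (24 * (N + 1))) * euler_upto N"
  by (simp only: euler_upto_def prod.lessThan_Suc) (rule mult.commute)

lemma nth_euler_upto:
  assumes "k \<le> N"
  shows "euler_upto N $ k = euler_upto k $ k"
  using assms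
proof (induction rule: dec_induct)
  case (step N)
  have "euler_upto (Suc N) = euler_upto N - fps_X ^ (24 * (N + 1)) * euler_upto N"
    by (simp only: euler_upto_Suc left_diff_distrib mult_1_left)
  then have "euler_upto (Suc N) $ k = euler_upto N $ k"
    using step.hyps by (simp add: fps_X_power_mult_nth)
  then show ?case
    using step.IH by simp
qed auto

text \<open>The factors with n >= k differ from 1 only above degree k, so the partial products
  stabilize in each coefficient and converge as formal power series. The limit has constant term 1,
  hence it is nonzero, as \<open>has_prod\<close> demands.\<close>

lemma nth_euler:
  assumes "k \<le> N"
  shows "euler $ k = euler_upto N $ k"
proof -
  define L where "L = Abs_fps (\<lambda>k. euler_upto k $ k)"
  have "(\<lambda>N. euler_upto N) \<longlonglongrightarrow> L"
  proof (rule tendsto_fpsI)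
    fix n
    show "\<forall>\<^sub>F N in sequentially. euler_upto N $ n = L $ n"
      using eventually_ge_at_top[of n]
      by eventually_elim (simp only: L_def fps_nth_Abs_fps, rule nth_euler_upto)
  qed
  then have "(\<lambda>N. \<Prod>n\<le>N. (1 - fps_X ^ (24 * (n + 1)) :: complex fps)) \<longlonglongrightarrow> L"
    unfolding euler_upto_def
    by (rule iffD1[OF LIMSEQ_lessThan_iff_atMost[where f = "\<lambda>A. \<Prod>n\<in>A. 1 - fps_X ^ (24 * (n + 1))"]])
  moreover have "L $ 0 = 1"
    by (simp add: L_def euler_upto_def)
  then have "L \<noteq> 0"
    by auto
  ultimately have "(\<lambda>n. 1 - fps_X ^ (24 * (n + 1)) :: complex fps) has_prod L"
    unfolding has_prod_def raw_has_prod_def add_0_right by blast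
  then have "euler = L"
    unfolding euler_def by (rule has_prod_unique[symmetric])
  then have "euler $ k = L $ k"
    by (rule arg_cong)
  also have "L $ k = euler_upto k $ k"
    by (simp only: L_def fps_nth_Abs_fps)
  also have "\<dots> = euler_upto N $ k"
    by (rule nth_euler_upto[OF assms, symmetric])
  finally show ?thesis .
qed

text \<open>Diagrams of charge 0 inside \<open>{..<N}\<close> correspond to partitions with all
  parts at most N. The truncation matches the first N Euler factors.\<close>

definition state_series_upto :: "nat \<Rightarrow> complex fps" where
  "state_series_upto N = Abs_fps (\<lambda>k. if 24 dvd k
     then of_nat (card (states {} (int k div 24) \<inter> {S. S \<subseteq> {..<int N}})) else 0)"

lemma nth_state_series_upto:
  "state_series_upto N $ k = (if 24 dvd k
     then of_nat (card (states {} (int k div 24) \<inter> {S. S \<subseteq> {..<int N}})) else 0)"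
  by (simp add: state_series_upto_def)

lemma nth_state_series_upto_24:
  "state_series_upto N $ (24 * m) = of_nat (card (states {} (int m) \<inter> {S. S \<subseteq> {..<int N}}))"
  by (simp add: nth_state_series_upto)

text \<open>The recurrence for partitions with parts at most N + 1: either no part equals N + 1, or
  one such part is removed. On diagrams the part is the particle at site N. Once it is gone, the
  topmost particle is at N - 1 or below, so the translate stays inside the same range.\<close>

lemma card_states_upto_Suc:
  "card (states {} k \<inter> {S. S \<subseteq> {..<int (Suc N)}}) =
   card (states {} k \<inter> {S. S \<subseteq> {..<int N}}) +
   card (states {} (k - int (Suc N)) \<inter> {S. S \<subseteq> {..<int (Suc N)}})"
proof -
  let ?A = "states {} k \<inter> {S. S \<subseteq> {..<int (Suc N)}}"
  let ?B = "states {} k \<inter> {S. S \<subseteq> {..<int N}}"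
  let ?C = "states {int N} k \<inter> {S. S \<subseteq> {..<int (Suc N)}}"
  let ?D = "states {} (k - int (Suc N)) \<inter> {S. S \<subseteq> {..<int (Suc N)}}"
  let ?f = "\<lambda>S. shift 1 (S - {int N})"
  have "S \<subseteq> {..<int N}" if "S \<subseteq> {..<int (Suc N)}" "int N \<notin> S" for S
    using that by (auto simp: subset_eq) (metis add.commute order_le_less zless_add1_eq)
  then have A: "?A = ?B \<union> ?C"
    by (auto simp: states_def subset_eq)
  have dis: "?B \<inter> ?C = {}"
    by (auto simp: states_def)
  have bij: "bij_betw ?f (states {int N} k)
      (states {} (k - (int N + 1)) - states {int N + 1} (k - (int N + 1)))"
    using bij_betw_states[of "int N" "{}" k] by simp
  have "bij_betw ?f ?C ?D"
  proof (rule bij_betw_subset[OF bij])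
    have iff: "?f S \<subseteq> {..<int (Suc N)} \<longleftrightarrow> S \<subseteq> {..<int (Suc N)}" for S
    proof
      assume *: "?f S \<subseteq> {..<int (Suc N)}"
      show "S \<subseteq> {..<int (Suc N)}"
      proof
        fix x assume x: "x \<in> S"
        show "x \<in> {..<int (Suc N)}"
        proof (cases "x = int N")
          case False
          then have "x + 1 \<in> ?f S"
            using x by (simp add: in_shift_iff)
          then show ?thesis
            using * by force
        qed auto
      qed
    qed (force simp: in_shift_iff)
    show "?f ` ?C = ?D"
    proof (intro equalityI subsetI)
      fix S assume S: "S \<in> ?D"
      then have "S \<in> states {} (k - (int N + 1)) - states {int N + 1} (k - (int N + 1))"
        by (auto simp: states_def algebra_simps)
      then obtain T where T: "T \<in> states {int N} k" "S = ?f T"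
        using bij unfolding bij_betw_def by blast
      then show "S \<in> ?f ` ?C"
        using S iff by auto
    next
      fix S' assume "S' \<in> ?f ` ?C"
      then obtain S where S: "S \<in> states {int N} k" "S \<subseteq> {..<int (Suc N)}" "S' = ?f S"
        by blast
      then have "S' \<in> states {} (k - (int N + 1))"
        using bij unfolding bij_betw_def by blast
      then show "S' \<in> ?D"
        using S iff[of S] by (simp add: algebra_simps)
    qed
  qed auto
  then have "card ?C = card ?D"
    by (rule bij_betw_same_card)
  moreover have "card ?A = card ?B + card ?C"
    unfolding A using dis by (intro card_Un_disjoint) auto
  ultimately show ?thesis
    by simp
qed

lemma states_upto_0: "states {} k \<inter> {S. S \<subseteq> {..<0}} = (if k = 0 then {{..<0}} else {})"
proof -
  have "S = {..<0}" if "S \<subseteq> {..<0}" "maya S" "charge S = 0" for S :: "int set"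
  proof -
    have "S \<inter> {0..} = {}"
      using that by auto
    then have "{..<0} - S = {}"
      using that by (auto simp: charge_def maya_def)
    then show ?thesis
      using that by auto
  qed
  then have "S = {..<0}" if "S \<in> states {} k" "S \<subseteq> {..<0}" for S
    using that by (simp add: states_def)
  moreover have "{..<0} \<in> states {} k \<longleftrightarrow> k = 0"
    by (auto simp: states_def)
  ultimately show ?thesis
    by auto
qed

text \<open>By the partition recurrence, the new Euler factor times the series for N + 1 is the
  series for N.\<close>

lemma euler_upto_mult_state_series_upto: "euler_upto N * state_series_upto N = 1"
proof (induction N)
  case 0
  have "state_series_upto 0 = 1"
    by (rule fps_ext) (auto simp: state_series_upto_def states_upto_0 elim!: dvdE)
  then show ?case
    by (simp add: euler_upto_def)
next
  case (Suc N)
  have "state_series_upto (Suc N) =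
      state_series_upto N + fps_X ^ (24 * (N + 1)) * state_series_upto (Suc N)"
  proof (rule fps_ext)
    fix k
    show "state_series_upto (Suc N) $ k =
        (state_series_upto N + fps_X ^ (24 * (N + 1)) * state_series_upto (Suc N)) $ k"
    proof (cases "24 dvd k")
      case False
      then have "\<not> 24 dvd (k - 24 * (N + 1))" if "\<not> k < 24 * (N + 1)"
        using that by presburger
      then show ?thesis
        using False by (simp add: nth_state_series_upto fps_X_power_mult_nth)
    next
      case True
      then obtain m where m: "k = 24 * m"
        by (elim dvdE)
      show ?thesis
      proof (cases "m < N + 1")
        case True
        then have "states {} (int m - int (Suc N)) = {}"
          by (intro states_neg) simp
        then have "card (states {} (int m) \<inter> {S. S \<subseteq> {..<int (Suc N)}}) =
            card (states {} (int m) \<inter> {S. S \<subseteq> {..<int N}})"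
          using card_states_upto_Suc[of "int m" N] by simp
        then show ?thesis
          using True
          by (simp only: m fps_add_nth fps_X_power_mult_nth nth_state_series_upto_24
              nat_mult_less_cancel1 zero_less_numeral if_True add_0_right)
      next
        case False
        have "24 * m - 24 * (N + 1) = 24 * (m - (N + 1))"
          by (simp only: right_diff_distrib')
        moreover have "int (m - (N + 1)) = int m - int (Suc N)"
          using False by simp
        ultimately show ?thesis
          using False card_states_upto_Suc[of "int m" N]
          by (simp only: m fps_add_nth fps_X_power_mult_nth nth_state_series_upto_24
              nat_mult_less_cancel1 zero_less_numeral if_False of_nat_add)
      qed
    qed
  qed
  then have "state_series_upto (Suc N) * (1 - fps_X ^ (24 * (N + 1))) = state_series_upto N"
    by (simp only: right_diff_distrib mult_1_right mult.commute[of "state_series_upto (Suc N)"] diff_eq_eq)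
  then have "(1 - fps_X ^ (24 * (N + 1))) * state_series_upto (Suc N) = state_series_upto N"
    by (simp only: mult.commute)
  then show ?case
    using Suc.IH by (simp only: euler_upto_Suc mult.commute[of _ "euler_upto N"] mult.assoc)
qed

lemma int_dvd_24: "24 dvd int k \<longleftrightarrow> 24 dvd k"
  by presburger

text \<open>In degree at most k both truncations at N = k are invisible, so the identity for
  truncated series passes to the limit one coefficient at a time.\<close>

lemma euler_mult_state_series: "fps_to_fls euler * state_series {} = 1"
proof -
  define Z where "Z = Abs_fps (\<lambda>k. state_series {} $$ int k)"
  have nth_Z: "Z $ k = state_series_upto N $ k" if "k \<le> N" for k N
  proof -
    have "S \<subseteq> {..<int N}" if S: "S \<in> states {} (int k div 24)" for S
    proof (cases "k = 0")
      case True
      \<comment> \<open>At energy 0 the general bound still admits a particle at site 0. Charge 0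
        then forces exactly one hole, and a hole at a negative site would make the energy
        positive.\<close>
      have "S \<inter> {0..} = {}"
      proof (rule ccontr)
        assume "S \<inter> {0..} \<noteq> {}"
        then obtain y where y: "y \<in> S" "y \<ge> 0"
          by auto
        have le: "x \<le> 0" if "x \<in> S" for x
          using states_bounds(1)[of S x] S that True by (auto simp: states_def)
        have "y = 0"
          using le[OF y(1)] y(2) by simp
        moreover have "x = 0" if "x \<in> S \<inter> {0..}" for x
          using le[of x] that by simp
        moreover have "0 \<in> S \<inter> {0..}"
          using y \<open>y = 0\<close> by simp
        ultimately have "S \<inter> {0..} = {0}"
          by blast
        then have *: "card ({..<0} - S) = 1" "\<Sum>({..<0} - S) = 0"
          using S True by (simp_all add: states_def charge_def energy_def)
        obtain x where x: "{..<0} - S = {x}"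
          using *(1) by (rule card_1_singletonE)
        moreover have "x = 0"
          using *(2) unfolding x by simp
        ultimately show False
          by blast
      qed
      then have "x < 0" if "x \<in> S" for x
        using that by (metis IntI atLeast_iff empty_iff not_less)
      then show ?thesis
        by force
    next
      case False
      have "int k div 24 < int N"
        using False \<open>k \<le> N\<close> by linarith
      then have "x < int N" if "x \<in> S" for x
        using states_bounds(1)[of S x] S that by (simp add: states_def)
      then show ?thesis
        by auto
    qed
    then have "states {} (int k div 24) \<inter> {S. S \<subseteq> {..<int N}} = states {} (int k div 24)"
      by blast
    then show ?thesis
      by (simp only: Z_def fps_nth_Abs_fps nth_state_series nth_state_series_upto int_dvd_24)
  qed
  have "euler * Z = 1"
  proof (rule fps_ext)
    fix k
    have "(euler * Z) $ k = (euler_upto k * state_series_upto k) $ k"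
      unfolding fps_mult_nth by (intro sum.cong refl arg_cong2[of _ _ _ _ times] nth_euler nth_Z) auto
    then show "(euler * Z) $ k = 1 $ k"
      by (simp add: euler_upto_mult_state_series_upto)
  qed
  moreover have "state_series {} = fps_to_fls Z"
  proof (rule fls_eqI)
    fix k
    show "state_series {} $$ k = fps_to_fls Z $$ k"
      by (cases "k \<ge> 0") (simp_all add: Z_def nth_state_series_neg)
  qed
  ultimately show ?thesis
    by (metis fls_times_fps_to_fls fps_one_to_fls)
qed

subsection \<open>The normalized occupation series\<close>

text \<open>By Euler's formula this is the generating function of the diagrams that contain B
  divided by that of all diagrams of charge 0. It is the f(B) of the overview.\<close>

definition occ :: "int set \<Rightarrow> complex fls" where
  "occ B = fps_to_fls euler * state_series B"

lemma occ_empty [simp]: "occ {} = 1"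
  by (simp add: occ_def euler_mult_state_series)

lemma occ_insert:
  assumes "j \<notin> B"
  shows "occ (insert j B) =
    qpow (of_int (j + 1)) * (occ (shift 1 B) - occ (insert (j + 1) (shift 1 B)))"
  by (simp only: occ_def state_series_insert[OF assms] right_diff_distrib mult.left_commute)

text \<open>The absence of negative powers of q is what makes the remainder of the iteration vanish
  in each coefficient.\<close>

lemma nth_occ_neg:
  assumes "k < 0"
  shows "occ B $$ k = 0"
proof -
  have "state_series B = fps_to_fls (Abs_fps (\<lambda>k. state_series B $$ int k))"
    by (rule fls_eqI) (simp add: nth_state_series_neg)
  then have "occ B = fps_to_fls (euler * Abs_fps (\<lambda>k. state_series B $$ int k))"
    unfolding occ_def by (metis fls_times_fps_to_fls)
  then show ?thesis
    using assms by simp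
qed

unbundle no fps_syntax

section \<open>The Fock space in terms of Maya diagrams\<close>

text \<open>Induction on the number of sites at which the diagram deviates from the vacuum.\<close>

lemma maya_induct [consumes 1, case_names vac insert remove]:
  assumes "maya S"
    and "P {..<0}"
    and "\<And>S j. maya S \<Longrightarrow> j \<ge> 0 \<Longrightarrow> j \<notin> S \<Longrightarrow> P S \<Longrightarrow> P (insert j S)"
    and "\<And>S j. maya S \<Longrightarrow> j < 0 \<Longrightarrow> j \<in> S \<Longrightarrow> P S \<Longrightarrow> P (S - {j})"
  shows "P S"
  using assms(1)
proof (induction "card (S \<inter> {0..}) + card ({..<0} - S)" arbitrary: S rule: less_induct)
  case less
  have fin: "finite (S \<inter> {0..})" "finite ({..<0} - S)"
    using less.prems by (auto simp: maya_def)
  consider j where "j \<in> S" "j \<ge> 0" | j where "j \<notin> S" "j < 0" | "S = {..<0}"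
    by force
  then show ?case
  proof cases
    case (1 j)
    have eq: "(S - {j}) \<inter> {0..} = S \<inter> {0..} - {j}" "{..<0} - (S - {j}) = {..<0} - S"
      using 1 by auto
    have "card (S \<inter> {0..} - {j}) < card (S \<inter> {0..})"
      using 1 fin by (intro psubset_card_mono) auto
    then have "P (S - {j})"
      using 1 less.prems by (intro less.hyps) (auto simp: eq maya_remove)
    then have "P (insert j (S - {j}))"
      using 1 less.prems by (intro assms(3)) (auto simp: maya_remove)
    then show ?thesis
      using 1 by (simp add: insert_absorb)
  next
    case (2 j)
    have eq: "insert j S \<inter> {0..} = S \<inter> {0..}" "{..<0} - insert j S = {..<0} - S - {j}"
      using 2 by auto
    have "card ({..<0} - S - {j}) < card ({..<0} - S)"
      using 2 fin by (intro psubset_card_mono) auto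
    then have "P (insert j S)"
      using 2 less.prems by (intro less.hyps) (auto simp: eq maya_insert_iff)
    then have "P (insert j S - {j})"
      using 2 less.prems by (intro assms(4)) (auto simp: maya_insert_iff)
    then show ?thesis
      using 2 by simp
  qed (use assms(2) in simp)
qed

section \<open>Fermion modes as creation and annihilation operators at integer sites\<close>

definition site :: "int \<Rightarrow> rat" where
  "site j = of_int j + 1/2"

lemma site_in_half_ints [simp]: "site j \<in> half_ints"
  by (simp add: site_def half_ints_def)

lemma minus_site: "- site j = site (- j - 1)"
  by (simp add: site_def)

lemma minus_site_in_half_ints [simp]: "- site j \<in> half_ints"
  by (simp add: minus_site)

lemma floor_site [simp]: "\<lfloor>site j\<rfloor> = j"
  by (simp add: site_def floor_eq_iff)

lemma site_floor: "a \<in> half_ints \<Longrightarrow> site \<lfloor>a\<rfloor> = a"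
proof -
  assume "a \<in> half_ints"
  then obtain j where "a = site j"
    by (auto simp: half_ints_def site_def elim!: Ints_cases intro: that[of "\<lfloor>a - 1/2\<rfloor>"])
  then show ?thesis
    by simp
qed

lemma half_intsE:
  assumes "a \<in> half_ints"
  obtains j where "a = site j"
  using site_floor[OF assms] by metis

lemma site_inj [simp]: "site i = site j \<longleftrightarrow> i = j"
  by (simp add: site_def)

lemma minus_in_half_ints_iff [simp]: "- a \<in> half_ints \<longleftrightarrow> a \<in> half_ints"
  by (metis half_intsE minus_minus minus_site_in_half_ints)

unbundle fps_syntax

context charged_fermions
begin

text \<open>With these signs \<open>cr j\<close> fills and \<open>an j\<close> empties the same site
  j: their anticommutator is the identity exactly for equal indices, and the vacuum has the negative
  sites filled.\<close>

definition cr :: "int \<Rightarrow> 'v \<Rightarrow> 'v" where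
  "cr j = psi (- site j)"

definition an :: "int \<Rightarrow> 'v \<Rightarrow> 'v" where
  "an j = psis (site j)"

lemma module_hom_cr: "module_hom scale scale (cr j)"
  unfolding cr_def module_hom_iff_linear by (rule psi_linear) simp

lemma module_hom_an: "module_hom scale scale (an j)"
  unfolding an_def module_hom_iff_linear by (rule psis_linear) simp

lemmas cr_hom = module_hom.add[OF module_hom_cr] module_hom.scale[OF module_hom_cr]
  module_hom.zero[OF module_hom_cr] module_hom.neg[OF module_hom_cr] module_hom.diff[OF module_hom_cr]
  module_hom.sum[OF module_hom_cr]

lemmas an_hom = module_hom.add[OF module_hom_an] module_hom.scale[OF module_hom_an]
  module_hom.zero[OF module_hom_an] module_hom.neg[OF module_hom_an] module_hom.diff[OF module_hom_an]
  module_hom.sum[OF module_hom_an]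

lemma cr_an: "cr i (an j v) + an j (cr i v) = (if i = j then v else 0)"
  unfolding cr_def an_def using psi_psis[of "- site i" "site j" v] by auto

lemma cr_cr: "cr i (cr j v) = - cr j (cr i v)"
  unfolding cr_def by (simp add: eq_neg_iff_add_eq_0 psi_psi)

lemma an_an: "an i (an j v) = - an j (an i v)"
  unfolding an_def by (simp add: eq_neg_iff_add_eq_0 psis_psis)

lemma eq_neg_self_imp_0:
  assumes "v = - (v :: 'v)"
  shows "v = 0"
proof -
  have "scale 2 v = v + v"
    using scale_left_distrib[of 1 1 v] by simp
  also have "v + v = 0"
    using assms by (metis add.right_inverse)
  finally show ?thesis
    by simp
qed

lemma cr_cr_same [simp]: "cr j (cr j v) = 0"
  by (rule eq_neg_self_imp_0, rule cr_cr)

lemma an_an_same [simp]: "an j (an j v) = 0"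
  by (rule eq_neg_self_imp_0, rule an_an)

lemma cr_vac: "j < 0 \<Longrightarrow> cr j vac = 0"
proof -
  assume "j < 0"
  then have "of_int j \<le> (-1 :: rat)"
    using of_int_le_iff[of j "-1", where 'a = rat] by simp
  then have "- site j > 0"
    by (simp add: site_def)
  then show ?thesis
    unfolding cr_def by (intro psi_vac) auto
qed

lemma an_vac: "j \<ge> 0 \<Longrightarrow> an j vac = 0"
  unfolding an_def by (rule psis_vac, simp) (simp add: site_def)

lemma an_cr: "an j (cr i v) = (if i = j then v else 0) - cr i (an j v)"
  using cr_an[of i j v] by (simp add: eq_diff_eq add.commute)

section \<open>Joint eigenspaces of the occupation numbers\<close>

definition num :: "int \<Rightarrow> 'v \<Rightarrow> 'v" where
  "num j v = cr j (an j v)"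

lemmas num_hom = cr_hom an_hom

text \<open>Each \<open>num j\<close> is a projection, so a joint system of eigenvalues 0 and 1 is
  the same as a set of occupied sites.\<close>

definition eig :: "int set \<Rightarrow> 'v set" where
  "eig S = {v. \<forall>j. num j v = (if j \<in> S then v else 0)}"

lemma eigD: "v \<in> eig S \<Longrightarrow> num j v = (if j \<in> S then v else 0)"
  by (simp add: eig_def)

lemma cr_in_eig:
  assumes v: "v \<in> eig S" and j: "j \<notin> S"
  shows "cr j v \<in> eig (insert j S)"
  unfolding eig_def
proof safe
  fix i
  show "num i (cr j v) = (if i \<in> insert j S then cr j v else 0)"
  proof (cases "i = j")
    case True
    then show ?thesis
      by (simp add: num_def an_cr cr_hom)
  next
    case False
    then have "num i (cr j v) = cr j (num i v)"
      using cr_cr[of i j "an i v"] by (simp add: num_def an_cr cr_hom)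
    then show ?thesis
      using False eigD[OF v] by (simp add: cr_hom)
  qed
qed

lemma cr_eig_eq_0:
  assumes v: "v \<in> eig S" and j: "j \<in> S"
  shows "cr j v = 0"
  using eigD[OF v, of j] j cr_cr_same[of j "an j v"] by (simp add: num_def)

lemma an_eig_eq_0:
  assumes v: "v \<in> eig S" and j: "j \<notin> S"
  shows "an j v = 0"
  using eigD[OF v, of j] j an_cr[of j j "an j v"] by (simp add: num_def num_hom)

lemma an_in_eig:
  assumes v: "v \<in> eig S"
  shows "an j v \<in> eig (S - {j})"
  unfolding eig_def
proof safe
  fix i
  show "num i (an j v) = (if i \<in> S - {j} then an j v else 0)"
  proof (cases "i = j")
    case True
    then show ?thesis
      by (simp add: num_def num_hom)
  next
    case False
    then have "num i (an j v) = an j (num i v)"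
      by (simp add: num_def an_cr an_an[of i j v] num_hom)
    then show ?thesis
      using False eigD[OF v] by (simp add: num_hom)
  qed
qed

lemma cr_an_eig: "v \<in> eig S \<Longrightarrow> j \<in> S \<Longrightarrow> cr j (an j v) = v"
  using eigD[of v S j] by (simp add: num_def)

lemma an_cr_eig: "v \<in> eig S \<Longrightarrow> j \<notin> S \<Longrightarrow> an j (cr j v) = v"
  by (simp add: an_cr an_eig_eq_0 num_hom)

lemma vac_in_eig: "vac \<in> eig {..<0}"
proof -
  have "cr j (an j vac) = vac" if "j < 0" for j
    using cr_an[of j j vac] that by (simp add: cr_vac an_hom)
  then show ?thesis
    by (auto simp: eig_def num_def an_vac cr_hom)
qed

lemma subspace_eig: "subspace (eig S)"
  unfolding subspace_def eig_def by (auto simp: num_def num_hom)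

text \<open>A site a at which two of the diagrams differ splits the sum by means of
  \<open>num a\<close> into two sums that both vanish. The one that contains S has fewer
  terms.\<close>

lemma eig_sum_eq_0:
  assumes "finite T" and "\<And>S. S \<in> T \<Longrightarrow> x S \<in> eig S" and "(\<Sum>S\<in>T. x S) = 0" and "S \<in> T"
  shows "x S = 0"
  using assms
proof (induction T arbitrary: S rule: finite_psubset_induct)
  case (psubset T)
  show ?case
  proof (cases "T = {S}")
    case False
    then obtain S' where S': "S' \<in> T" "S' \<noteq> S"
      using psubset.prems by blast
    then obtain a where a: "a \<in> S \<longleftrightarrow> a \<notin> S'"
      by blast
    have "num a (\<Sum>S\<in>T. x S) = (\<Sum>U\<in>T. if a \<in> U then x U else 0)"
      using eigD[OF psubset.prems(1)] by (simp add: num_def num_hom)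
    then have 1: "(\<Sum>U\<in>{U \<in> T. a \<in> U}. x U) = 0"
      using psubset.hyps psubset.prems(2) by (simp add: sum.inter_filter num_def num_hom)
    have "(\<Sum>U\<in>T. x U) = (\<Sum>U\<in>{U \<in> T. a \<in> U}. x U) + (\<Sum>U\<in>{U \<in> T. a \<notin> U}. x U)"
      using psubset.hyps by (subst sum.union_disjoint[symmetric]) (auto intro!: sum.cong)
    with 1 have 2: "(\<Sum>U\<in>{U \<in> T. a \<notin> U}. x U) = 0"
      using psubset.prems(2) by simp
    have "(\<Sum>U\<in>{U \<in> T. a \<in> U \<longleftrightarrow> a \<in> S}. x U) = 0"
      using 1 2 by (cases "a \<in> S") simp_all
    moreover have "{U \<in> T. a \<in> U \<longleftrightarrow> a \<in> S} \<subset> T"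
      using S' a by blast
    ultimately show ?thesis
      using psubset.prems by (intro psubset.IH[of "{U \<in> T. a \<in> U \<longleftrightarrow> a \<in> S}"]) auto
  qed (use psubset.prems in simp)
qed

lemma span_eig_decompose:
  assumes "v \<in> span (\<Union>S\<in>M. eig S)"
  obtains T x where "finite T" "T \<subseteq> M" "\<And>S. x S \<in> eig S" "v = (\<Sum>S\<in>T. x S)"
proof -
  have "\<exists>T x. finite T \<and> T \<subseteq> M \<and> (\<forall>S. x S \<in> eig S) \<and> v = (\<Sum>S\<in>T. x S)"
    using assms
  proof (induction rule: span_induct_alt)
    case base
    show ?case
      by (rule exI[of _ "{}"]) (auto intro!: exI[of _ "\<lambda>_. 0"] subspace_0 subspace_eig)
  next
    case (step c u w)
    then obtain T x S where *: "finite T" "T \<subseteq> M" "\<forall>S. x S \<in> eig S" "w = (\<Sum>S\<in>T. x S)"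
      "S \<in> M" "u \<in> eig S"
      by auto
    let ?x = "x(S := (if S \<in> T then x S else 0) + scale c u)"
    have "(\<Sum>S\<in>insert S T. ?x S) = ?x S + (\<Sum>S\<in>T - {S}. x S)"
      using * by (subst sum.insert_remove) auto
    also have "\<dots> = scale c u + w"
      using * sum.remove[of T S x] by (auto simp: algebra_simps)
    finally have "scale c u + w = (\<Sum>S\<in>insert S T. ?x S)" by simp
    moreover have "\<forall>S. ?x S \<in> eig S"
      using * by (auto intro!: subspace_add subspace_scale subspace_0 subspace_eig)
    ultimately show ?case
      using * by (intro exI[of _ "insert S T"] exI[of _ ?x]) auto
  qed
  then show ?thesis
    using that by blast
qed

text \<open>Nonnegative sites are only filled and negative ones only emptied, so no step leads back
  to the vacuum diagram. Different orders of the steps may give vectors of opposite sign, therefore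
  this is a relation and not a function.\<close>

inductive created :: "int set \<Rightarrow> 'v \<Rightarrow> bool" where
  vac: "created {..<0} vac"
| cr: "created S v \<Longrightarrow> j \<ge> 0 \<Longrightarrow> j \<notin> S \<Longrightarrow> created (insert j S) (cr j v)"
| an: "created S v \<Longrightarrow> j < 0 \<Longrightarrow> j \<in> S \<Longrightarrow> created (S - {j}) (an j v)"

lemma created_props:
  assumes "created S v"
  shows "maya S \<and> v \<in> eig S \<and> v \<noteq> 0 \<and> word_of_charge (charge S) v"
  using assms
proof induction
  case vac
  then show ?case
    using vac_in_eig vac_nonzero by (auto intro: word_of_charge.intros)
next
  case (cr S v j)
  have "an j (cr j v) \<noteq> 0"
    using cr an_cr_eig by auto
  then have "cr j v \<noteq> 0"
    by (auto simp: an_hom)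
  moreover have "word_of_charge (charge S + 1) (cr j v)"
    unfolding cr_def using cr by (intro word_of_charge.intros) auto
  ultimately show ?case
    using cr by (auto simp: maya_insert_iff charge_insert cr_in_eig)
next
  case (an S v j)
  have "cr j (an j v) \<noteq> 0"
    using an cr_an_eig by auto
  then have "an j v \<noteq> 0"
    by (auto simp: cr_hom)
  moreover have "word_of_charge (charge S - 1) (an j v)"
    unfolding an_def using an by (intro word_of_charge.intros) auto
  ultimately show ?case
    using an by (auto simp: maya_remove charge_remove an_in_eig)
qed

lemma created_exists: "maya S \<Longrightarrow> \<exists>v. created S v"
  by (induction S rule: maya_induct) (auto intro: created.intros)

definition created_vecs :: "'v set" where
  "created_vecs = {v. \<exists>S. created S v}"

lemma span_closed:
  assumes "module_hom scale scale f" and "\<And>v. v \<in> B \<Longrightarrow> f v \<in> span C" and "w \<in> span B"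
  shows "f w \<in> span C"
proof -
  have "subspace {w. f w \<in> span C}"
    by (auto simp: subspace_def module_hom.add[OF assms(1)] module_hom.scale[OF assms(1)]
        module_hom.zero[OF assms(1)] span_add span_scale span_zero)
  then have "span B \<subseteq> {w. f w \<in> span C}"
    using assms(2) by (intro span_minimal) auto
  then show ?thesis
    using assms(3) by auto
qed

lemma cr_span_created: "j \<ge> 0 \<Longrightarrow> w \<in> span created_vecs \<Longrightarrow> cr j w \<in> span created_vecs"
proof (erule span_closed[OF module_hom_cr, rotated])
  fix v assume "j \<ge> 0" "v \<in> created_vecs"
  then obtain S where S: "created S v"
    by (auto simp: created_vecs_def)
  show "cr j v \<in> span created_vecs"
  proof (cases "j \<in> S")
    case True
    then show ?thesis
      using created_props[OF S] cr_eig_eq_0[OF _ True, of v] by (simp add: span_zero)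
  next
    case False
    then show ?thesis
      using created.cr[OF S \<open>j \<ge> 0\<close>] by (intro span_base) (auto simp: created_vecs_def)
  qed
qed

lemma an_span_created: "j < 0 \<Longrightarrow> w \<in> span created_vecs \<Longrightarrow> an j w \<in> span created_vecs"
proof (erule span_closed[OF module_hom_an, rotated])
  fix v assume "j < 0" "v \<in> created_vecs"
  then obtain S where S: "created S v"
    by (auto simp: created_vecs_def)
  show "an j v \<in> span created_vecs"
  proof (cases "j \<in> S")
    case False
    then show ?thesis
      using created_props[OF S] an_eig_eq_0[OF _ False, of v] by (simp add: span_zero)
  next
    case True
    then show ?thesis
      using created.an[OF S \<open>j < 0\<close>] by (intro span_base) (auto simp: created_vecs_def)
  qed
qed

lemma created_in_span: "created S v \<Longrightarrow> v \<in> span created_vecs"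
  by (rule span_base) (auto simp: created_vecs_def)

text \<open>The operators that kill the vacuum are moved to the right through the word by
  anticommutation. A contraction leaves the shorter word v, and otherwise the operator moves on
  until it meets \<open>vac\<close>.\<close>

lemma annihilate_created:
  assumes "created S v"
  shows "j < 0 \<Longrightarrow> cr j v \<in> span created_vecs" and "j \<ge> 0 \<Longrightarrow> an j v \<in> span created_vecs"
  using assms
proof (induction)
  case vac
  {
    case 1
    then show ?case by (simp add: cr_vac span_zero)
  next
    case 2
    then show ?case by (simp add: an_vac span_zero)
  }
next
  case (cr S v i)
  {
    case 1
    then show ?case
      using cr by (simp add: cr_cr[of j i] span_neg cr_span_created)
  next
    case 2
    then show ?case
      using cr created_in_span[of S v] by (auto simp: an_cr intro!: span_diff span_neg cr_span_created)
  }
next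
  case (an S v i)
  {
    case 1
    have "cr j (an i v) = (if j = i then v else 0) - an i (cr j v)"
      using cr_an[of j i v] by (simp add: eq_diff_eq)
    then show ?case
      using an 1 created_in_span[of S v] by (auto intro!: span_diff span_neg an_span_created)
  next
    case 2
    then show ?case
      using an by (simp add: an_an[of j i] span_neg an_span_created)
  }
qed

lemma span_created: "span created_vecs = UNIV"
proof (rule generated)
  show "subspace (span created_vecs)"
    by (rule subspace_span)
  show "vac \<in> span created_vecs"
    by (rule created_in_span) (rule created.vac)
  fix n :: rat and w assume n: "n \<in> half_ints" and w: "w \<in> span created_vecs"
  obtain i where i: "n = site i"
    using n by (rule half_intsE)
  have 1: "psi n = cr (- i - 1)"
    by (simp add: cr_def minus_site i)
  have 2: "psis n = an i"
    by (simp add: an_def i)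
  have "cr (- i - 1) v \<in> span created_vecs" if "v \<in> created_vecs" for v
    using that annihilate_created(1) cr_span_created created_in_span
    by (cases "- i - 1 < 0") (auto simp: created_vecs_def)
  moreover have "an i v \<in> span created_vecs" if "v \<in> created_vecs" for v
    using that annihilate_created(2) an_span_created created_in_span
    by (cases "i < 0") (auto simp: created_vecs_def)
  ultimately show "psi n w \<in> span created_vecs \<and> psis n w \<in> span created_vecs"
    unfolding 1 2 using span_closed[OF module_hom_cr _ w] span_closed[OF module_hom_an _ w] by blast
qed

text \<open>Every created vector except \<open>vac\<close> lies in the eigenspace of another
  diagram. Since the created vectors span, x differs from a multiple of \<open>vac\<close> by a sum
  from these other eigenspaces, and independence makes the difference zero.\<close>

lemma eig_vac:
  assumes "x \<in> eig {..<0}"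
  shows "\<exists>c. x = scale c vac"
proof -
  have "v \<in> insert vac (\<Union>S\<in>- {{..<0}}. eig S)" if "created S v" for S v
    using that
  proof cases
    case (cr S' u j)
    have "j \<in> S" "j \<notin> {..<0}"
      using cr by simp_all
    then show ?thesis
      using created_props[OF that] by blast
  next
    case (an S' u j)
    have "j \<notin> S" "j \<in> {..<0}"
      using an by simp_all
    then show ?thesis
      using created_props[OF that] by blast
  qed simp
  then have "created_vecs \<subseteq> insert vac (\<Union>S\<in>- {{..<0}}. eig S)"
    unfolding created_vecs_def by blast
  then have "x \<in> span (insert vac (\<Union>S\<in>- {{..<0}}. eig S))"
    using span_mono span_created by blast
  then obtain c where c: "x - scale c vac \<in> span (\<Union>S\<in>- {{..<0}}. eig S)"
    unfolding span_breakdown_eq by blast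
  then obtain T y where T: "finite T" "T \<subseteq> - {{..<0}}" "\<And>S. y S \<in> eig S"
    "x - scale c vac = (\<Sum>S\<in>T. y S)"
    by (rule span_eig_decompose) blast
  have eig: "x - scale c vac \<in> eig {..<0}"
    using assms vac_in_eig by (intro subspace_diff subspace_scale subspace_eig)
  \<comment> \<open>The difference is moved to the other side as the component at the vacuum
    diagram, which yields a vanishing sum over distinct diagrams.\<close>
  let ?y = "y({..<0} := - (x - scale c vac))"
  have "?y {..<0} = 0"
  proof (rule eig_sum_eq_0[of "insert {..<0} T" ?y])
    have "(\<Sum>S\<in>insert {..<0} T. ?y S) = ?y {..<0} + (\<Sum>S\<in>T. ?y S)"
      using T(1,2) by (intro sum.insert) blast+
    also have "(\<Sum>S\<in>T. ?y S) = (\<Sum>S\<in>T. y S)"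
      using T(2) by (intro sum.cong refl fun_upd_other) blast
    finally show "(\<Sum>S\<in>insert {..<0} T. ?y S) = 0"
      using T(4) by simp
    show "?y S \<in> eig S" for S
      using T(3)[of S] subspace_neg[OF subspace_eig eig] by auto
  qed (use T(1) in simp_all)
  then have "x = scale c vac"
    by simp
  then show ?thesis ..
qed

text \<open>Between the eigenspaces of S and of S with a further site j, \<open>cr j\<close> and
  \<open>an j\<close> are mutually inverse, so dimension one is transported from the vacuum to every
  diagram.\<close>

lemma eig_unique:
  assumes "maya S" "x \<in> eig S" "y \<in> eig S" "y \<noteq> 0"
  shows "\<exists>c. x = scale c y"
  using assms
proof (induction S arbitrary: x y rule: maya_induct)
  case vac
  obtain c where c: "x = scale c vac"
    using eig_vac vac.prems(1) by blast
  obtain d where d: "y = scale d vac"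
    using eig_vac vac.prems(2) by blast
  have "d \<noteq> 0"
    using vac.prems(3) d by auto
  then have "x = scale (c / d) y"
    by (simp add: c d)
  then show ?case ..
next
  case (insert S j)
  have eq: "cr j (an j x) = x" "cr j (an j y) = y"
    using insert.prems by (auto intro: cr_an_eig)
  then have "an j y \<noteq> 0"
    using insert.prems by (auto simp: cr_hom)
  moreover have "an j x \<in> eig S" "an j y \<in> eig S"
    using an_in_eig[of x "insert j S" j] an_in_eig[of y "insert j S" j] insert.prems insert.hyps by auto
  ultimately obtain c where "an j x = scale c (an j y)"
    using insert.IH by blast
  then have "cr j (an j x) = scale c (cr j (an j y))"
    by (simp add: cr_hom)
  then show ?case
    using eq by auto
next
  case (remove S j)
  have eq: "an j (cr j x) = x" "an j (cr j y) = y"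
    using remove.prems by (auto intro: an_cr_eig)
  then have "cr j y \<noteq> 0"
    using remove.prems by (auto simp: an_hom)
  moreover have "cr j x \<in> eig S" "cr j y \<in> eig S"
    using cr_in_eig[of x "S - {j}" j] cr_in_eig[of y "S - {j}" j] remove.prems remove.hyps
    by (auto simp: insert_absorb)
  ultimately obtain c where "cr j x = scale c (cr j y)"
    using remove.IH by blast
  then have "an j (cr j x) = scale c (an j (cr j y))"
    by (simp add: an_hom)
  then show ?case
    using eq by auto
qed

definition evec :: "int set \<Rightarrow> 'v" where
  "evec S = (SOME v. created S v)"

lemma
  assumes "maya S"
  shows evec_in_eig: "evec S \<in> eig S"
    and evec_nonzero: "evec S \<noteq> 0"
    and word_of_charge_evec: "word_of_charge (charge S) (evec S)"
proof -
  have "created S (evec S)"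
    unfolding evec_def using someI_ex[OF created_exists[OF assms]] .
  then show "evec S \<in> eig S" "evec S \<noteq> 0" "word_of_charge (charge S) (evec S)"
    using created_props by auto
qed

lemma eig_subset_span: "maya S \<Longrightarrow> S \<in> M \<Longrightarrow> x \<in> eig S \<Longrightarrow> x \<in> span (evec ` M)"
  using eig_unique[of S x "evec S"] evec_in_eig[of S] evec_nonzero[of S]
  by (auto intro: span_scale[OF span_base])

lemma charge_space_eq: "charge_space m = span (evec ` {S. maya S \<and> charge S = m})"
proof
  show "span (evec ` {S. maya S \<and> charge S = m}) \<subseteq> charge_space m"
    unfolding charge_space_def
    by (rule span_mono) (use word_of_charge_evec in auto)
  have "v \<in> span (evec ` {S. maya S \<and> charge S = m})" if "word_of_charge m v" for v m
    using that
  proof induction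
    case 1
    then show ?case
      using vac_in_eig by (intro eig_subset_span[of "{..<0}"]) auto
  next
    case (2 m v n)
    obtain i where i: "n = site i"
      using 2(2) by (rule half_intsE)
    have psi: "psi n = cr (- i - 1)"
      by (simp add: cr_def minus_site i)
    show ?case
      unfolding psi using module_hom_cr _ 2(3)
    proof (rule span_closed)
      fix w assume "w \<in> evec ` {S. maya S \<and> charge S = m}"
      then obtain S where S: "maya S" "charge S = m" "w \<in> eig S"
        using evec_in_eig by auto
      show "cr (- i - 1) w \<in> span (evec ` {S. maya S \<and> charge S = m + 1})"
      proof (cases "- i - 1 \<in> S")
        case True
        then show ?thesis
          using S cr_eig_eq_0[OF _ True, of w] by (simp add: span_zero)
      next
        case False
        then show ?thesis
          using S by (intro eig_subset_span[OF _ _ cr_in_eig[of _ S]]) (auto simp: maya_insert_iff charge_insert)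
      qed
    qed
  next
    case (3 m v n)
    obtain i where i: "n = site i"
      using 3(2) by (rule half_intsE)
    have psis: "psis n = an i"
      by (simp add: an_def i)
    show ?case
      unfolding psis using module_hom_an _ 3(3)
    proof (rule span_closed)
      fix w assume "w \<in> evec ` {S. maya S \<and> charge S = m}"
      then obtain S where S: "maya S" "charge S = m" "w \<in> eig S"
        using evec_in_eig by auto
      show "an i w \<in> span (evec ` {S. maya S \<and> charge S = m - 1})"
      proof (cases "i \<in> S")
        case False
        then show ?thesis
          using S an_eig_eq_0[OF _ False, of w] by (simp add: span_zero)
      next
        case True
        then show ?thesis
          using S by (intro eig_subset_span[OF _ _ an_in_eig[of _ S]]) (auto simp: maya_remove charge_remove)
      qed
    qed
  qed
  then show "charge_space m \<subseteq> span (evec ` {S. maya S \<and> charge S = m})"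
    unfolding charge_space_def by (intro span_minimal) auto
qed


section \<open>The spectrum of L(0) on Maya diagrams\<close>

lemma L0_term_hom:
  "L0_term n (u + v) = L0_term n u + L0_term n v"
  "L0_term n (scale c v) = scale c (L0_term n v)" if "n \<in> half_ints"
proof -
  have "module_hom scale scale (psi m)" "module_hom scale scale (psis m)" if "m \<in> half_ints" for m
    using psi_linear[OF that] psis_linear[OF that] by (simp_all add: module_hom_iff_linear)
  from this[THEN module_hom.add] this[THEN module_hom.scale] this[THEN module_hom.scale]
  show "L0_term n (u + v) = L0_term n u + L0_term n v"
    "L0_term n (scale c v) = scale c (L0_term n v)"
    using that by (simp_all add: L0_term_def nord_psi_psis_def nord_psis_psi_def
        scale_right_distrib scale_left_commute scale_right_diff_distrib algebra_simps)
qed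

text \<open>Normal ordering subtracts the occupation of the vacuum, so that only this deviation
  enters L(0). Its support is finite for a Maya diagram.\<close>

definition occ_diff :: "int set \<Rightarrow> int \<Rightarrow> complex" where
  "occ_diff S j = (if j \<in> S then 1 else 0) - (if j < 0 then 1 else 0)"

lemma L0_term_eig:
  assumes v: "v \<in> eig S"
  shows "L0_term (site i) v =
    scale (of_int (- i - 1) / 2 * (occ_diff S (- i - 1) - occ_diff S i)) v"
proof -
  have neg: "site i < 0 \<longleftrightarrow> i < 0"
  proof -
    have "of_int i \<le> (-1 :: rat) \<longleftrightarrow> i \<le> -1" "0 \<le> (of_int i :: rat) \<longleftrightarrow> 0 \<le> i"
      using of_int_le_iff[of i "-1", where 'a = rat] by simp_all
    then show ?thesis
      unfolding site_def by (cases "i < 0") auto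
  qed
  have e: "an j (cr j v) = (if j \<in> S then 0 else v)" "cr j (an j v) = (if j \<in> S then v else 0)" for j
    using v eigD[OF v, of j] by (auto simp: num_def an_cr)
  have psi: "psi (site i) = cr (- i - 1)" "psis (- site i) = an (- i - 1)"
    "psis (site i) = an i" "psi (- site i) = cr i"
    by (simp_all add: cr_def an_def minus_site)
  have c: "of_rat ((- site i - 1/2) / 2) = (of_int (- i - 1) / 2 :: complex)"
    by (simp add: site_def of_rat_divide of_rat_diff of_rat_minus of_rat_add)
  show ?thesis
    unfolding L0_term_def nord_psis_psi_def nord_psi_psis_def psi neg e c occ_diff_def
    by (simp add: algebra_simps)
qed

lemma occ_diff_finite:
  assumes "maya S"
  obtains M where "M \<ge> 0" "\<And>i. i \<notin> {-M..<M} \<Longrightarrow> occ_diff S i = 0"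
proof
  have e: "energy S + 1 \<ge> 1"
    using energy_nonneg by simp
  then show "energy S + 1 \<ge> 0" by simp
  fix i assume "i \<notin> {- (energy S + 1)..<energy S + 1}"
  then show "occ_diff S i = 0"
    using states_bounds[OF assms, of i] e by (auto simp: occ_diff_def)
qed

lemma
  assumes "maya S" and M: "M \<ge> 0" "\<And>i. i \<notin> {-M..<M} \<Longrightarrow> occ_diff S i = 0"
  shows sum_occ_diff: "(\<Sum>i\<in>{-M..<M}. occ_diff S i) = of_int (charge S)"
    and sum_occ_diff_mult: "(\<Sum>i\<in>{-M..<M}. of_int i * occ_diff S i) = of_int (energy S)"
proof -
  have od: "occ_diff S i = of_bool (i \<in> S \<inter> {0..}) - of_bool (i \<in> {..<0} - S)" for i
    by (auto simp: occ_diff_def)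
  have sub: "S \<inter> {0..} \<subseteq> {-M..<M}" "{..<0} - S \<subseteq> {-M..<M}"
  proof -
    have "i \<in> {-M..<M}" if "occ_diff S i \<noteq> 0" for i
      using that M(2) by blast
    then show "S \<inter> {0..} \<subseteq> {-M..<M}" "{..<0} - S \<subseteq> {-M..<M}"
      by (simp_all add: subset_eq od)
  qed
  have P: "(\<Sum>i\<in>{-M..<M}. f i * of_bool (i \<in> A)) = (\<Sum>i\<in>A. f i)"
    if "A \<subseteq> {-M..<M}" for A and f :: "int \<Rightarrow> complex"
    using that by (subst sum.mono_neutral_cong_right[of "{-M..<M}" A _ f]) auto
  show "(\<Sum>i\<in>{-M..<M}. occ_diff S i) = of_int (charge S)"
    using P[OF sub(1), of "\<lambda>_. 1"] P[OF sub(2), of "\<lambda>_. 1"]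
    by (simp add: od sum_subtractf charge_def)
  show "(\<Sum>i\<in>{-M..<M}. of_int i * occ_diff S i) = of_int (energy S)"
    using P[OF sub(1), of of_int] P[OF sub(2), of of_int]
    by (simp only: od sum_subtractf energy_def right_diff_distrib of_int_diff of_int_sum)
qed

lemma L0_eq_sum:
  assumes "finite N" "N \<subseteq> half_ints" "\<And>n. n \<in> half_ints \<Longrightarrow> n \<notin> N \<Longrightarrow> L0_term n v = 0"
  shows "L0 v = (\<Sum>n\<in>N. L0_term n v)"
  unfolding L0_def by (rule sum.mono_neutral_left) (use assms in auto)

text \<open>\<open>L0\<close> sums over its nonzero terms, and an infinite such sum has the default
  value 0. Additivity is therefore established together with finiteness of the support.\<close>

definition L0_support :: "'v \<Rightarrow> rat set" where
  "L0_support v = {n \<in> half_ints. L0_term n v \<noteq> 0}"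

lemma
  assumes "maya S" and v: "v \<in> eig S"
  shows L0_eig: "L0 v = scale (of_int (energy S) + of_int (charge S) / 2) v"
    and finite_L0_support_eig: "finite (L0_support v)"
proof -
  obtain M where M: "M \<ge> 0" "\<And>i. i \<notin> {-M..<M} \<Longrightarrow> occ_diff S i = 0"
    using occ_diff_finite[OF assms(1)] by blast
  let ?N = "site ` {-M..<M}"
  have 0: "L0_term n v = 0" if n: "n \<in> half_ints" "n \<notin> ?N" for n
  proof -
    obtain i where i: "n = site i"
      using n(1) by (rule half_intsE)
    then have "i \<notin> {-M..<M}" "- i - 1 \<notin> {-M..<M}"
      using n by auto
    then have "occ_diff S i = 0" "occ_diff S (- i - 1) = 0"
      using M(2) by blast+
    then show ?thesis
      unfolding i L0_term_eig[OF v] by simp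
  qed
  then have "L0_support v \<subseteq> ?N"
    by (auto simp: L0_support_def)
  then show "finite (L0_support v)"
    by (rule finite_subset) simp
  have inj: "inj_on site {-M..<M}"
    by (auto simp: inj_on_def)
  \<comment> \<open>A mode involves the sites i and -i-1. Reflection collects both contributions at
    site i, with weights i/2 and (i+1)/2 that add up to the energy i + 1/2 of the site.\<close>
  have refl: "(\<Sum>i\<in>{-M..<M}. of_int (- i - 1) / 2 * occ_diff S (- i - 1)) =
      (\<Sum>i\<in>{-M..<M}. of_int i / 2 * occ_diff S i)"
    by (rule sum.reindex_bij_witness[of _ "\<lambda>i. - i - 1" "\<lambda>i. - i - 1"]) auto
  have "L0 v = (\<Sum>n\<in>?N. L0_term n v)"
    by (rule L0_eq_sum) (use 0 in auto)
  also have "\<dots> = (\<Sum>i\<in>{-M..<M}. L0_term (site i) v)"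
    using inj by (subst sum.reindex) auto
  also have "\<dots> = scale (\<Sum>i\<in>{-M..<M}. of_int (- i - 1) / 2 * (occ_diff S (- i - 1) - occ_diff S i)) v"
    unfolding L0_term_eig[OF v] by (simp only: scale_sum_left)
  also have "(\<Sum>i\<in>{-M..<M}. of_int (- i - 1) / 2 * (occ_diff S (- i - 1) - occ_diff S i)) =
      (\<Sum>i\<in>{-M..<M}. of_int i / 2 * occ_diff S i) - (\<Sum>i\<in>{-M..<M}. of_int (- i - 1) / 2 * occ_diff S i)"
    unfolding refl[symmetric] by (simp only: right_diff_distrib sum_subtractf)
  also have "\<dots> = (\<Sum>i\<in>{-M..<M}. of_int i * occ_diff S i + occ_diff S i / 2)"
    unfolding sum_subtractf[symmetric] by (rule sum.cong) (auto simp: field_simps)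
  also have "\<dots> = of_int (energy S) + of_int (charge S) / 2"
    using sum_occ_diff[OF assms(1) M] sum_occ_diff_mult[OF assms(1) M]
    by (simp add: sum.distrib sum_divide_distrib[symmetric])
  finally show "L0 v = scale (of_int (energy S) + of_int (charge S) / 2) v" .
qed

lemma
  assumes u: "finite (L0_support u)" and v: "finite (L0_support v)"
  shows L0_add: "L0 (u + v) = L0 u + L0 v"
    and finite_L0_support_add: "finite (L0_support (u + v))"
proof -
  let ?N = "L0_support u \<union> L0_support v"
  have N: "finite ?N" "?N \<subseteq> half_ints"
    using assms by (auto simp: L0_support_def)
  have 0: "L0_term n u = 0" "L0_term n v = 0" "L0_term n (u + v) = 0"
    if "n \<in> half_ints" "n \<notin> ?N" for n
    using that by (auto simp: L0_support_def L0_term_hom)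
  then have "L0_support (u + v) \<subseteq> ?N"
    unfolding L0_support_def by blast
  then show "finite (L0_support (u + v))"
    using N finite_subset by blast
  have "L0 (u + v) = (\<Sum>n\<in>?N. L0_term n u + L0_term n v)"
    using 0 N by (subst L0_eq_sum[OF N]) (auto intro!: sum.cong L0_term_hom)
  also have "\<dots> = L0 u + L0 v"
  proof -
    have "L0 u = (\<Sum>n\<in>?N. L0_term n u)" "L0 v = (\<Sum>n\<in>?N. L0_term n v)"
      using 0 by (blast intro: L0_eq_sum[OF N])+
    then show ?thesis
      by (simp only: sum.distrib)
  qed
  finally show "L0 (u + v) = L0 u + L0 v" .
qed

lemma L0_sum:
  assumes "finite T" "\<And>S. S \<in> T \<Longrightarrow> maya S" "\<And>S. S \<in> T \<Longrightarrow> x S \<in> eig S"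
  shows "L0 (\<Sum>S\<in>T. x S) = (\<Sum>S\<in>T. scale (of_int (energy S) + of_int (charge S) / 2) (x S))"
proof -
  have "L0 (\<Sum>S\<in>T. x S) = (\<Sum>S\<in>T. scale (of_int (energy S) + of_int (charge S) / 2) (x S)) \<and>
      finite (L0_support (\<Sum>S\<in>T. x S))"
    using assms
  proof (induction T rule: finite_induct)
    case empty
    have "0 \<in> eig {..<0}"
      by (intro subspace_0 subspace_eig)
    then show ?case
      using L0_eig[of "{..<0}" 0] finite_L0_support_eig[of "{..<0}" 0] by simp
  next
    case (insert S T)
    have S: "maya S" "x S \<in> eig S"
      using insert.prems by auto
    have IH: "L0 (\<Sum>S\<in>T. x S) = (\<Sum>S\<in>T. scale (of_int (energy S) + of_int (charge S) / 2) (x S))"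
      "finite (L0_support (\<Sum>S\<in>T. x S))"
      using insert.IH insert.prems by auto
    show ?case
      using insert.hyps L0_add[OF finite_L0_support_eig[OF S] IH(2)] L0_eig[OF S] IH(1)
        finite_L0_support_add[OF finite_L0_support_eig[OF S] IH(2)]
      by simp
  qed
  then show ?thesis ..
qed

lemma L0_eigenspace_eq:
  "{v \<in> charge_space 0. Lbar0 v = scale (of_int k / 24) v} =
   span (evec ` {S. maya S \<and> charge S = 0 \<and> 24 * energy S - 1 = k})" (is "?W = span (evec ` ?M)")
proof (intro equalityI subsetI)
  fix v assume "v \<in> span (evec ` ?M)"
  moreover have "evec ` ?M \<subseteq> (\<Union>S\<in>?M. eig S)"
    using evec_in_eig by blast
  ultimately have "v \<in> span (\<Union>S\<in>?M. eig S)"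
    using span_mono by blast
  then obtain T x where T: "finite T" "T \<subseteq> ?M" "\<And>S. x S \<in> eig S" "v = (\<Sum>S\<in>T. x S)"
    by (rule span_eig_decompose) blast
  have "L0 v = (\<Sum>S\<in>T. scale (of_int (energy S) + of_int (charge S) / 2) (x S))"
    unfolding T(4) using T by (intro L0_sum) auto
  also have "\<dots> = (\<Sum>S\<in>T. scale (of_int (k + 1) / 24) (x S))"
  proof (intro sum.cong refl)
    fix S assume "S \<in> T"
    then have "charge S = 0" "24 * energy S = k + 1"
      using T(2) by auto
    moreover from this(2) have "24 * of_int (energy S) = (of_int (k + 1) :: complex)"
      by (metis of_int_mult of_int_numeral)
    ultimately show "scale (of_int (energy S) + of_int (charge S) / 2) (x S) = scale (of_int (k + 1) / 24) (x S)"
      by (simp add: field_simps)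
  qed
  also have "\<dots> = scale (of_int (k + 1) / 24) v"
    by (simp add: T(4) scale_sum_right)
  finally have "Lbar0 v = scale (of_int k / 24) v"
    by (simp add: Lbar0_def add_divide_distrib scale_left_distrib)
  moreover have "v \<in> charge_space 0"
    unfolding charge_space_eq using \<open>v \<in> span (evec ` ?M)\<close>
    by (rule subsetD[OF span_mono, rotated]) auto
  ultimately show "v \<in> ?W"
    by simp
next
  fix v assume v: "v \<in> ?W"
  let ?Z = "{S. maya S \<and> charge S = 0}"
  have "evec ` ?Z \<subseteq> (\<Union>S\<in>?Z. eig S)"
    using evec_in_eig by blast
  then have "v \<in> span (\<Union>S\<in>?Z. eig S)"
    using v span_mono unfolding charge_space_eq by blast
  then obtain T x where T: "finite T" "T \<subseteq> ?Z" "\<And>S. x S \<in> eig S" "v = (\<Sum>S\<in>T. x S)"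
    by (rule span_eig_decompose) blast
  have "L0 v = (\<Sum>S\<in>T. scale (of_int (energy S) + of_int (charge S) / 2) (x S))"
    unfolding T(4) using T by (intro L0_sum) auto
  also have "\<dots> = (\<Sum>S\<in>T. scale (of_int (energy S)) (x S))"
    using T(2) by (intro sum.cong) auto
  finally have L0: "L0 v = (\<Sum>S\<in>T. scale (of_int (energy S)) (x S))" .
  let ?c = "\<lambda>S. of_int (energy S) - 1/24 - of_int k / 24 :: complex"
  have "L0 v - scale (1/24) v - scale (of_int k / 24) v = 0"
    using v by (simp add: Lbar0_def)
  then have "(\<Sum>S\<in>T. scale (?c S) (x S)) = 0"
    unfolding L0 by (simp add: T(4) scale_sum_right scale_left_diff_distrib sum_subtractf)
  then have 0: "scale (?c S) (x S) = 0" if "S \<in> T" for S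
    using that T by (intro eig_sum_eq_0[of T "\<lambda>S. scale (?c S) (x S)"]) (auto intro: subspace_scale subspace_eig)
  have "x S \<in> span (evec ` ?M)" if "S \<in> T" for S
  proof (cases "x S = 0")
    case False
    then have "?c S = 0"
      using 0[OF that] unfolding scale_eq_0_iff by blast
    then have "24 * ?c S = 0"
      by (simp only: mult_zero_right)
    moreover have "of_int (24 * energy S - 1) - (of_int k :: complex) = 24 * ?c S"
      by (simp add: right_diff_distrib)
    ultimately have "of_int (24 * energy S - 1) = (of_int k :: complex)"
      by (metis eq_iff_diff_eq_0)
    then have "24 * energy S - 1 = k"
      by (simp only: of_int_eq_iff)
    then show ?thesis
      using T that by (intro eig_subset_span[of S]) auto
  qed (simp add: span_zero)
  then show "v \<in> span (evec ` ?M)"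
    unfolding T(4) by (rule span_sum)
qed

text \<open>\<open>trace_on\<close> refers to an arbitrary basis B of the space, so the value has to
  be independent of it. Expanding B in E and E in B, the change of basis and its inverse multiply to
  the identity.\<close>

lemma trace_on_diagonal:
  assumes fin: "finite E" and ind: "independent E" and A: "module_hom scale scale A"
    and diag: "\<And>e. e \<in> E \<Longrightarrow> A e = scale (l e) e"
  shows "trace_on (span E) A = (\<Sum>e\<in>E. l e)"
proof -
  define B where "B = (SOME B. independent B \<and> span B = span E)"
  have "independent B \<and> span B = span E"
    unfolding B_def by (rule someI[of _ E]) (use ind in simp)
  then have B: "independent B" "span B = span E"
    by auto
  have finB: "finite B"
    using independent_span_bound[OF fin B(1)] B(2) span_superset by auto
  let ?r = representation
  have "?r B (A b) b = (\<Sum>e\<in>E. ?r E b e * (l e * ?r B e b))" if "b \<in> B" for b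
  proof -
    have bE: "b \<in> span E"
      using that B(2) span_superset by blast
    have eB: "e \<in> span B" if "e \<in> E" for e
      using that B(2) span_superset by blast
    have "A b = A (\<Sum>e\<in>E. scale (?r E b e) e)"
      using sum_representation_eq[OF ind bE fin] by simp
    also have "\<dots> = (\<Sum>e\<in>E. scale (?r E b e) (scale (l e) e))"
      using diag by (simp add: module_hom.sum[OF A] module_hom.scale[OF A])
    finally have "?r B (A b) = ?r B (\<Sum>e\<in>E. scale (?r E b e) (scale (l e) e))"
      by simp
    also have "\<dots> = (\<lambda>b'. \<Sum>e\<in>E. ?r B (scale (?r E b e) (scale (l e) e)) b')"
      using B eB by (intro representation_sum) (auto intro: span_scale)
    also have "\<dots> = (\<lambda>b'. \<Sum>e\<in>E. ?r E b e * (l e * ?r B e b'))"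
      using B(1) eB by (intro ext sum.cong) (auto simp: representation_scale span_scale)
    finally show ?thesis by simp
  qed
  then have "trace_on (span E) A = (\<Sum>b\<in>B. \<Sum>e\<in>E. ?r E b e * (l e * ?r B e b))"
    by (simp add: trace_on_def B_def[symmetric])
  also have "\<dots> = (\<Sum>e\<in>E. l e * (\<Sum>b\<in>B. ?r B e b * ?r E b e))"
    by (subst sum.swap) (simp add: sum_distrib_left mult_ac)
  also have "\<dots> = (\<Sum>e\<in>E. l e)"
  proof (rule sum.cong)
    fix e assume e: "e \<in> E"
    then have eB: "e \<in> span B"
      using B(2) span_superset by blast
    have "?r E e = ?r E (\<Sum>b\<in>B. scale (?r B e b) b)"
      using sum_representation_eq[OF B(1) eB finB] by simp
    also have "\<dots> = (\<lambda>e'. \<Sum>b\<in>B. ?r E (scale (?r B e b) b) e')"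
      using ind B(2) span_superset by (intro representation_sum) (auto intro: span_scale)
    also have "\<dots> = (\<lambda>e'. \<Sum>b\<in>B. ?r B e b * ?r E b e')"
    proof (intro ext sum.cong refl)
      fix b e' assume "b \<in> B"
      then have "b \<in> span E"
        using B(2) span_superset by blast
      then show "?r E (scale (?r B e b) b) e' = ?r B e b * ?r E b e'"
        by (simp add: representation_scale[OF ind])
    qed
    finally have "(\<Sum>b\<in>B. ?r B e b * ?r E b e) = ?r E e e"
      by simp
    then show "l e * (\<Sum>b\<in>B. ?r B e b * ?r E b e) = l e"
      using representation_basis[OF ind e] by simp
  qed simp
  finally show ?thesis .
qed

lemma inj_on_evec: "inj_on evec {S. maya S}"
proof (rule inj_onI)
  fix S S' assume S: "S \<in> {S. maya S}" "S' \<in> {S. maya S}" and eq: "evec S = evec S'"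
  have "evec S \<in> eig S" "evec S \<in> eig S'" "evec S \<noteq> 0"
    using S eq evec_in_eig[of S] evec_in_eig[of S'] evec_nonzero[of S] by simp_all
  then show "S = S'"
    by (metis eigD set_eqI)
qed

lemma independent_evec:
  assumes "M \<subseteq> {S. maya S}"
  shows "independent (evec ` M)"
  unfolding independent_explicit_module
proof (intro allI impI)
  fix t u v assume t: "finite t" "t \<subseteq> evec ` M" "(\<Sum>v\<in>t. scale (u v) v) = 0" "v \<in> t"
  obtain T where T: "T \<subseteq> M" "t = evec ` T"
    using t(2) by (auto simp: subset_image_iff)
  have inj: "inj_on evec T"
    using inj_on_subset[OF inj_on_evec] T(1) assms by blast
  have "finite T"
    using t(1) T(2) inj finite_image_iff by blast
  obtain S where S: "S \<in> T" "v = evec S"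
    using t(4) T(2) by blast
  have "scale (u (evec S)) (evec S) = 0"
  proof (rule eig_sum_eq_0[OF \<open>finite T\<close> _ _ S(1)])
    show "scale (u (evec U)) (evec U) \<in> eig U" if "U \<in> T" for U
      using that T(1) assms by (intro subspace_scale subspace_eig evec_in_eig) auto
    show "(\<Sum>U\<in>T. scale (u (evec U)) (evec U)) = 0"
      using t(3) inj by (simp add: T(2) sum.reindex)
  qed
  moreover have "maya S"
    using S(1) T(1) assms by auto
  ultimately show "u v = 0"
    using evec_nonzero S(2) by simp
qed

section \<open>The coefficients of G as normalized counts of diagrams\<close>

lemma o_coeff_site: "o_coeff (site j) v = num j v"
  by (simp add: o_coeff_def XX_coeff_def num_def cr_def an_def)

lemma o_coeff_eq_0: "a \<notin> half_ints \<Longrightarrow> o_coeff a = (\<lambda>_. 0)"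
  by (auto simp: o_coeff_def XX_coeff_def)

lemma module_hom_o_coeff: "module_hom scale scale (o_coeff a)"
proof (cases "a \<in> half_ints")
  case True
  then obtain j where "a = site j"
    by (rule half_intsE)
  then have "o_coeff a = cr j \<circ> an j"
    by (auto simp: o_coeff_site num_def)
  then show ?thesis
    using module_hom_compose[OF module_hom_an module_hom_cr] by simp
next
  case False
  then show ?thesis
    by (simp add: o_coeff_eq_0 module_hom.intro[OF module_axioms module_axioms] module_hom_axioms_def)
qed

lemma module_hom_o_coeffs: "module_hom scale scale (foldr (\<circ>) (map o_coeff b) id)"
proof (induction b)
  case Nil
  then show ?case
    unfolding module_hom_iff_linear using linear_ident by (simp add: id_def)
next
  case (Cons a b)
  then show ?case
    using module_hom_compose[OF Cons.IH module_hom_o_coeff]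
    by (simp add: comp_def)
qed

lemma o_coeffs_eig:
  assumes "v \<in> eig S" "set b \<subseteq> half_ints"
  shows "foldr (\<circ>) (map o_coeff b) id v = (if floor ` set b \<subseteq> S then v else 0)"
  using assms(2)
proof (induction b)
  case (Cons a b)
  obtain j where j: "a = site j"
    using Cons.prems by (auto elim: half_intsE)
  then show ?case
    using Cons eigD[OF assms(1), of j] by (auto simp: o_coeff_site num_def num_hom)
qed simp

lemma o_coeffs_eq_0:
  assumes "\<not> set b \<subseteq> half_ints"
  shows "foldr (\<circ>) (map o_coeff b) id v = 0"
  using assms
proof (induction b)
  case (Cons a b)
  then show ?case
    by (cases "a \<in> half_ints") (auto simp: o_coeff_eq_0 module_hom.zero[OF module_hom_o_coeff])
qed simp

lemma trace_o_coeffs: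
  assumes "set b \<subseteq> half_ints"
  shows "trace_on {v \<in> charge_space 0. Lbar0 v = scale (of_int k / 24) v}
           (foldr (\<circ>) (map o_coeff b) id) = state_series (floor ` set b) $$ (k + 1)"
proof -
  define M where "M = {S. maya S \<and> charge S = 0 \<and> 24 * energy S - 1 = k}"
  have M: "M = (if 24 dvd k + 1 then states {} ((k + 1) div 24) else {})"
  proof (cases "24 dvd k + 1")
    case True
    then obtain m where "k + 1 = 24 * m"
      by (elim dvdE)
    then have "k = 24 * m - 1" "(k + 1) div 24 = m"
      by simp_all
    then show ?thesis
      using True by (auto simp: M_def states_def)
  next
    case False
    have "24 * energy S - 1 \<noteq> k" for S
      using False by presburger
    then show ?thesis
      using False by (simp add: M_def)
  qed
  have fin: "finite M"
    by (simp add: M)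
  have inj: "inj_on evec M"
    by (rule inj_on_subset[OF inj_on_evec]) (auto simp: M_def)
  \<comment> \<open>Each basis vector is either fixed or killed by the product of projections;
    \<open>l\<close> reads the eigenvalue off the vector itself.\<close>
  define l where "l = (\<lambda>e. if foldr (\<circ>) (map o_coeff b) id e = e then 1 else 0 :: complex)"
  have ev: "foldr (\<circ>) (map o_coeff b) id (evec S) = (if floor ` set b \<subseteq> S then evec S else 0)"
    if "S \<in> M" for S
    using that assms by (intro o_coeffs_eig evec_in_eig) (auto simp: M_def)
  have nz: "evec S \<noteq> 0" if "S \<in> M" for S
    using that evec_nonzero by (auto simp: M_def)
  have "trace_on (span (evec ` M)) (foldr (\<circ>) (map o_coeff b) id) = (\<Sum>e\<in>evec ` M. l e)"
  proof (rule trace_on_diagonal)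
    show "independent (evec ` M)"
      by (rule independent_evec) (auto simp: M_def)
    show "foldr (\<circ>) (map o_coeff b) id e = scale (l e) e" if "e \<in> evec ` M" for e
      using that ev nz by (auto simp: l_def)
  qed (use fin module_hom_o_coeffs in auto)
  also have "\<dots> = (\<Sum>S\<in>M. l (evec S))"
    using inj by (simp add: sum.reindex)
  also have "\<dots> = (\<Sum>S\<in>M. if floor ` set b \<subseteq> S then 1 else 0)"
    using ev nz by (intro sum.cong) (auto simp: l_def)
  also have "\<dots> = of_nat (card {S \<in> M. floor ` set b \<subseteq> S})"
    using fin by (simp add: sum.inter_filter[symmetric])
  also have "\<dots> = state_series (floor ` set b) $$ (k + 1)"
  proof (cases "24 dvd k + 1")
    case True
    then have "{S \<in> M. floor ` set b \<subseteq> S} = states (floor ` set b) ((k + 1) div 24)"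
      unfolding M by (simp only: if_True) (auto simp: states_def)
    then show ?thesis
      using True by (simp add: nth_state_series)
  next
    case False
    then show ?thesis
      unfolding nth_state_series M by simp
  qed
  finally show ?thesis
    unfolding L0_eigenspace_eq M_def .
qed

text \<open>The factor q^(1/24) of eta cancels the shift by -1/24 in \<open>Lbar0\<close>, and the
  rest of eta is the Euler product. Only the set of sites counts, because commuting projections are
  multiplied.\<close>

lemma G_coeff_eq_occ:
  assumes "set b \<subseteq> half_ints"
  shows "G_coeff b = occ (floor ` set b)"
proof (cases "b = []")
  case False
  have "tr_F0 (foldr (\<circ>) (map o_coeff b) id) = Abs_fls (\<lambda>k. state_series (floor ` set b) $$ (k + 1))"
    unfolding tr_F0_def trace_o_coeffs[OF assms] ..
  also have "\<dots> = fls_shift 1 (state_series (floor ` set b))"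
    by (simp add: fls_shift_def)
  also have "\<dots> = fls_X_intpow (-1) * state_series (floor ` set b)"
    using fls_X_intpow_times_conv_shift(1)[of "-1" "state_series (floor ` set b)"]
    by (simp only: minus_minus)
  finally have tr: "tr_F0 (foldr (\<circ>) (map o_coeff b) id) = fls_X_intpow (-1) * state_series (floor ` set b)" .
  have "qpow (1/24) = fls_X_intpow 1"
    by (simp add: qpow_def)
  then have "G_coeff b = (fls_X_intpow 1 * fls_X_intpow (-1)) * (fps_to_fls euler * state_series (floor ` set b))"
    using False unfolding G_coeff_def eta_def euler_def[symmetric] tr by (simp only: if_False mult_ac)
  also have "fls_X_intpow 1 * fls_X_intpow (-1) = (1 :: complex fls)"
    unfolding fls_X_intpow_times_fls_X_intpow by simp
  finally show ?thesis
    by (simp add: occ_def)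
qed (simp add: G_coeff_def)

lemma G_coeff_eq_0:
  assumes "\<not> set b \<subseteq> half_ints"
  shows "G_coeff b = 0"
proof -
  have "foldr (\<circ>) (map o_coeff b) id = (\<lambda>_. 0)"
    using o_coeffs_eq_0[OF assms] by auto
  then have "tr_F0 (foldr (\<circ>) (map o_coeff b) id) = Abs_fls (\<lambda>_. 0)"
    unfolding tr_F0_def by (simp add: trace_on_def representation_zero Let_def)
  then have "tr_F0 (foldr (\<circ>) (map o_coeff b) id) = 0"
    by (simp add: zero_fls_def)
  then show ?thesis
    using assms by (auto simp: G_coeff_def)
qed

end

unbundle no fps_syntax

section \<open>The formal difference equations\<close>

text \<open>The binomial theorem over subsets. With x = -1 it is the cancellation in (b), with x = r
  it explains the weights of the iteration.\<close>

lemma sum_Pow_power_card: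
  fixes x :: "'a::comm_ring_1"
  assumes "finite A"
  shows "(\<Sum>I\<in>Pow A. x ^ card I) = (x + 1) ^ card A"
  using assms
proof (induction A rule: finite_induct)
  case (insert a A)
  have "(\<Sum>I\<in>Pow (insert a A). x ^ card I) =
      (\<Sum>I\<in>Pow A. x ^ card I) + (\<Sum>I\<in>insert a ` Pow A. x ^ card I)"
    unfolding Pow_insert using insert.hyps by (intro sum.union_disjoint) auto
  also have "(\<Sum>I\<in>insert a ` Pow A. x ^ card I) = (\<Sum>I\<in>Pow A. x ^ card (insert a I))"
    using insert.hyps by (subst sum.reindex) (auto simp: inj_on_def)
  also have "\<dots> = (\<Sum>I\<in>Pow A. x * x ^ card I)"
  proof (rule sum.cong)
    fix I assume "I \<in> Pow A"
    then have "finite I" "a \<notin> I"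
      using insert.hyps finite_subset by auto
    then show "x ^ card (insert a I) = x * x ^ card I"
      by simp
  qed simp
  finally show ?case
    using insert by (simp add: sum_distrib_left[symmetric] algebra_simps)
qed simp

section \<open>Coefficients of substitutions and products\<close>

abbreviation lookup :: "texp \<Rightarrow> nat \<Rightarrow> rat" where
  "lookup \<equiv> Poly_Mapping.lookup"

lemma lookup_snd_mon:
  assumes "finite M"
  shows "lookup (snd (mon c M)) i = of_bool (i \<in> M)"
proof -
  have "lookup (snd (mon c M)) i = (\<Sum>j\<in>M. if j = i then 1 else 0)"
    by (simp add: mon_def Poly_Mapping.lookup_sum lookup_single when_def)
  then show ?thesis
    using assms by (simp add: sum.delta)
qed

lemma fst_mon [simp]: "fst (mon c M) = c"
  by (simp add: mon_def)

text \<open>The exponents of the arguments solve a linear system. Monomials in disjoint sets of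
  variables leave at most one solution, and the defining sum collapses to one term.\<close>

lemma fsubst_unique:
  assumes "\<And>b. length b = length ms \<and>
      (\<forall>i. (\<Sum>j<length ms. b ! j * lookup (snd (ms ! j)) i) = lookup a i) \<longleftrightarrow> P \<and> b = b0"
  shows "fsubst A ms a = (if P then A b0 * qpow (\<Sum>j<length ms. b0 ! j * fst (ms ! j)) else 0)"
proof -
  have "length b = length ms \<and> A b \<noteq> 0 \<and>
      (\<forall>i. (\<Sum>j<length ms. b ! j * lookup (snd (ms ! j)) i) = lookup a i) \<longleftrightarrow> P \<and> A b \<noteq> 0 \<and> b = b0" for b
    using assms[of b] by blast
  then have "{b. length b = length ms \<and> A b \<noteq> 0 \<and>
      (\<forall>i. (\<Sum>j<length ms. b ! j * lookup (snd (ms ! j)) i) = lookup a i)} =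
    (if P \<and> A b0 \<noteq> 0 then {b0} else {})"
    by auto
  then show ?thesis
    unfolding fsubst_def by auto
qed

lemma singles_lookup_eq_iff:
  assumes "distinct js" "length b = length js"
  shows "(\<forall>i. (\<Sum>j<length js. b ! j * lookup (snd (mon 0 {js ! j})) i) = f i) \<longleftrightarrow>
    b = map f js \<and> (\<forall>i. i \<notin> set js \<longrightarrow> f i = 0)"
proof -
  let ?S = "\<lambda>i. \<Sum>j<length js. b ! j * lookup (snd (mon 0 {js ! j})) i"
  have S: "?S i = (\<Sum>j<length js. if js ! j = i then b ! j else 0)" for i
    by (intro sum.cong) (auto simp: lookup_snd_mon)
  have 1: "?S i = 0" if "i \<notin> set js" for i
    unfolding S using that by (intro sum.neutral) auto
  have 2: "?S (js ! k) = b ! k" if "k < length js" for k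
  proof -
    have "?S (js ! k) = (\<Sum>j<length js. if j = k then b ! j else 0)"
      unfolding S using that assms(1) by (intro sum.cong) (auto simp: nth_eq_iff_index_eq)
    then show ?thesis
      using that by simp
  qed
  show ?thesis
  proof
    assume *: "\<forall>i. ?S i = f i"
    have "b = map f js"
      using 2 * assms(2) by (intro nth_equalityI) auto
    then show "b = map f js \<and> (\<forall>i. i \<notin> set js \<longrightarrow> f i = 0)"
      using 1 * by metis
  next
    assume *: "b = map f js \<and> (\<forall>i. i \<notin> set js \<longrightarrow> f i = 0)"
    show "\<forall>i. ?S i = f i"
    proof
      fix i
      show "?S i = f i"
      proof (cases "i \<in> set js")
        case True
        then obtain k where "k < length js" "i = js ! k"
          by (auto simp: in_set_conv_nth)
        then show ?thesis
          using 2 * by auto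
      qed (use 1 * in auto)
    qed
  qed
qed

lemma fsubst_singles:
  assumes "distinct js"
  shows "fsubst A (map (\<lambda>j. mon 0 {j}) js) a =
    (if Poly_Mapping.keys a \<subseteq> set js then A (map (lookup a) js) else 0)"
proof -
  have "fsubst A (map (\<lambda>j. mon 0 {j}) js) a = (if Poly_Mapping.keys a \<subseteq> set js then A (map (lookup a) js) *
      qpow (\<Sum>j<length (map (\<lambda>j. mon 0 {j}) js). map (lookup a) js ! j * fst (map (\<lambda>j. mon 0 {j}) js ! j)) else 0)"
  proof (rule fsubst_unique)
    fix b
    show "length b = length (map (\<lambda>j. mon 0 {j}) js) \<and>
        (\<forall>i. (\<Sum>j<length (map (\<lambda>j. mon 0 {j}) js). b ! j * lookup (snd (map (\<lambda>j. mon 0 {j}) js ! j)) i) = lookup a i)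
      \<longleftrightarrow> Poly_Mapping.keys a \<subseteq> set js \<and> b = map (lookup a) js"
    proof -
      have keys: "Poly_Mapping.keys a \<subseteq> set js \<longleftrightarrow> (\<forall>i. i \<notin> set js \<longrightarrow> lookup a i = 0)"
        by (auto simp: in_keys_iff)
      have sum: "(\<Sum>j<length (map (\<lambda>j. mon 0 {j}) js). b ! j *
            lookup (snd (map (\<lambda>j. mon 0 {j}) js ! j)) i) =
          (\<Sum>j<length js. b ! j * lookup (snd (mon 0 {js ! j})) i)" for i
        by simp
      show ?thesis
      proof (cases "length b = length js")
        case True
        show ?thesis
          unfolding sum singles_lookup_eq_iff[OF assms True] keys using True by simp blast
      next
        case False
        then have "length b \<noteq> length (map (\<lambda>j. mon 0 {j} :: qt_monomial) js)" "b \<noteq> map (lookup a) js"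
          by auto
        then show ?thesis
          by blast
      qed
    qed
  qed
  also have "(\<Sum>j<length (map (\<lambda>j. mon 0 {j}) js).
      map (lookup a) js ! j * fst (map (\<lambda>j. mon 0 {j}) js ! j)) = 0"
    by (intro sum.neutral) auto
  finally show ?thesis
    by simp
qed

text \<open>All variables of the first monomial inherit the exponent of the first argument, so a
  coefficient survives only if they agree on M; any representative k of M then supplies this
  exponent.\<close>

lemma fsubst_Cons_singles:
  assumes "distinct js" "finite M" "k \<in> M" "set js \<inter> M = {}"
  shows "fsubst A (mon c M # map (\<lambda>j. mon 0 {j}) js) a =
    (if (\<forall>i\<in>M. lookup a i = lookup a k) \<and> Poly_Mapping.keys a \<subseteq> M \<union> set js
     then A (lookup a k # map (lookup a) js) * qpow (lookup a k * c) else 0)"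
proof -
  let ?ms = "mon c M # map (\<lambda>j. mon 0 {j}) js"
  let ?P = "(\<forall>i\<in>M. lookup a i = lookup a k) \<and> Poly_Mapping.keys a \<subseteq> M \<union> set js"
  let ?b = "lookup a k # map (lookup a) js"
  have "fsubst A ?ms a = (if ?P then A ?b * qpow (\<Sum>j<length ?ms. ?b ! j * fst (?ms ! j)) else 0)"
  proof (rule fsubst_unique)
    fix b :: "rat list"
    show "length b = length ?ms \<and>
        (\<forall>i. (\<Sum>j<length ?ms. b ! j * lookup (snd (?ms ! j)) i) = lookup a i) \<longleftrightarrow> ?P \<and> b = ?b"
    proof (cases b)
      case (Cons x b')
      have sum: "(\<Sum>j<length ?ms. b ! j * lookup (snd (?ms ! j)) i) =
        x * of_bool (i \<in> M) + (\<Sum>j<length js. b' ! j * lookup (snd (mon 0 {js ! j})) i)" for i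
        using assms(2) by (simp add: Cons sum.lessThan_Suc_shift lookup_snd_mon del: sum.lessThan_Suc)
      define f where "f = (\<lambda>i. lookup a i - x * of_bool (i \<in> M))"
      have eq: "(\<forall>i. (\<Sum>j<length ?ms. b ! j * lookup (snd (?ms ! j)) i) = lookup a i) \<longleftrightarrow>
        (\<forall>i. (\<Sum>j<length js. b' ! j * lookup (snd (mon 0 {js ! j})) i) = f i)"
        unfolding sum f_def eq_diff_eq by (simp only: add.commute)
      have map: "map f js = map (lookup a) js"
        using assms(4) by (auto simp: f_def)
      have P: "(\<forall>i. i \<notin> set js \<longrightarrow> f i = 0) \<longleftrightarrow> ?P \<and> x = lookup a k"
      proof
        assume *: "\<forall>i. i \<notin> set js \<longrightarrow> f i = 0"
        have M: "lookup a i = x" if "i \<in> M" for i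
        proof -
          have "f i = 0"
            using * that assms(4) by blast
          then show ?thesis
            using that by (simp add: f_def)
        qed
        have "i \<in> M \<union> set js" if "i \<in> Poly_Mapping.keys a" for i
        proof (rule ccontr)
          assume "i \<notin> M \<union> set js"
          then have "f i = 0" "lookup a i = f i"
            using * by (auto simp: f_def)
          then show False
            using that by (simp add: in_keys_iff)
        qed
        then show "?P \<and> x = lookup a k"
          using M assms(3) by auto
      next
        assume P: "?P \<and> x = lookup a k"
        show "\<forall>i. i \<notin> set js \<longrightarrow> f i = 0"
        proof (intro allI impI)
          fix i assume "i \<notin> set js"
          show "f i = 0"
          proof (cases "i \<in> M")
            case True
            then show ?thesis
              using P by (simp add: f_def)
          next
            case False
            then have "i \<notin> Poly_Mapping.keys a"
              using P \<open>i \<notin> set js\<close> by blast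
            then show ?thesis
              using False by (simp add: f_def in_keys_iff)
          qed
        qed
      qed
      show ?thesis
      proof (cases "length b' = length js")
        case True
        show ?thesis
          unfolding eq singles_lookup_eq_iff[OF assms(1) True] P map
          using True by (simp only: Cons list.inject length_Cons length_map) blast
      next
        case False
        then have "length b \<noteq> length ?ms" "b \<noteq> ?b"
          by (auto simp: Cons)
        then show ?thesis
          by blast
      qed
    next
      case Nil
      then have "length b \<noteq> length ?ms" "b \<noteq> ?b"
        by auto
      then show ?thesis
        by blast
    qed
  qed
  moreover have "(\<Sum>j<length ?ms. ?b ! j * fst (?ms ! j)) = lookup a k * c"
    by (simp add: sum.lessThan_Suc_shift del: sum.lessThan_Suc)
  ultimately show ?thesis
    by simp
qed

lemma delta_half_mon:
  assumes "finite M" "k \<in> M"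
  shows "delta_half (mon 0 M) a = (if (\<forall>i\<in>M. lookup a i = lookup a k) \<and> Poly_Mapping.keys a \<subseteq> M \<and>
    lookup a k \<in> half_ints then 1 else 0)"
proof -
  have "fsubst A [mon 0 M] a = (if (\<forall>i\<in>M. lookup a i = lookup a k) \<and> Poly_Mapping.keys a \<subseteq> M
      then A [lookup a k] else 0)" for A
  proof -
    have "fsubst A (mon 0 M # map (\<lambda>j. mon 0 {j}) []) a =
        (if (\<forall>i\<in>M. lookup a i = lookup a k) \<and> Poly_Mapping.keys a \<subseteq> M \<union> set []
         then A (lookup a k # map (lookup a) []) * qpow (lookup a k * 0) else 0)"
      by (rule fsubst_Cons_singles) (use assms in simp_all)
    then show ?thesis
      by (simp only: list.map list.set Un_empty_right mult_zero_right qpow_0 mult_1_right)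
  qed
  then show ?thesis
    unfolding delta_half_def by (simp only: list.sel split: if_split) blast
qed

text \<open>An exponent splits in only one way over disjoint sets of variables, so even series
  infinite in both directions have a well-defined product.\<close>

lemma fmul_disjoint:
  assumes "finite M" "M \<inter> N = {}"
    and "\<And>x. A x \<noteq> 0 \<Longrightarrow> Poly_Mapping.keys x \<subseteq> M" and "\<And>y. B y \<noteq> 0 \<Longrightarrow> Poly_Mapping.keys y \<subseteq> N"
    and x0: "x0 = (\<Sum>i\<in>M. Poly_Mapping.single i (lookup a i))"
  shows "(A \<odot> B) a = A x0 * B (a - x0)"
proof -
  have lx0: "lookup x0 i = (if i \<in> M then lookup a i else 0)" for i
    unfolding x0 using assms(1) by (simp add: Poly_Mapping.lookup_sum lookup_single when_def)
  have "x = x0" if "A x \<noteq> 0" "B y \<noteq> 0" "x + y = a" for x y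
  proof (rule poly_mapping_eqI)
    fix i
    have "lookup x i = (if i \<in> M then lookup a i else 0)"
      using assms(2) assms(3)[OF that(1)] assms(4)[OF that(2)] that(3)
      by (auto simp: lookup_add in_keys_iff)
    then show "lookup x i = lookup x0 i"
      by (simp add: lx0)
  qed
  then have dec: "x = x0 \<and> y = a - x0" if "x + y = a" "A x \<noteq> 0" "B y \<noteq> 0" for x y
    using that by (metis add_diff_cancel_left')
  have "x0 + (a - x0) = a"
    by simp
  then have "x + y = a \<and> A x \<noteq> 0 \<and> B y \<noteq> 0 \<longleftrightarrow>
      x = x0 \<and> y = a - x0 \<and> A x0 \<noteq> 0 \<and> B (a - x0) \<noteq> 0" for x y
    using dec[of x y] by metis
  then have "{(x, y). x + y = a \<and> A x \<noteq> 0 \<and> B y \<noteq> 0} =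
      (if A x0 \<noteq> 0 \<and> B (a - x0) \<noteq> 0 then {(x0, a - x0)} else {})"
    by auto
  then show ?thesis
    unfolding fmul_def by auto
qed

lemma fmul_lookup:
  "(Poly_Mapping.lookup P \<odot> B) a = (\<Sum>k\<in>Poly_Mapping.keys P. Poly_Mapping.lookup P k * B (a - k))"
proof -
  have "(Poly_Mapping.lookup P \<odot> B) a =
      (\<Sum>k | k \<in> Poly_Mapping.keys P \<and> B (a - k) \<noteq> 0. Poly_Mapping.lookup P k * B (a - k))"
    unfolding fmul_def
    by (rule sum.reindex_bij_witness[of _ "\<lambda>k. (k, a - k)" fst])
      (auto simp: in_keys_iff algebra_simps)
  also have "\<dots> = (\<Sum>k\<in>Poly_Mapping.keys P. Poly_Mapping.lookup P k * B (a - k))"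
    by (rule sum.mono_neutral_left) auto
  finally show ?thesis .
qed

lemma fmul_lpoly_mon:
  "(Poly_Mapping.lookup (lpoly_mon m) \<odot> B) a = qpow (fst m) * B (a - snd m)"
proof -
  have "qpow c \<noteq> 0" for c
    by (simp add: qpow_def)
  then show ?thesis
    unfolding fmul_lookup lpoly_mon_def by simp
qed

lemma fmul_lookup_add:
  "(Poly_Mapping.lookup (P + Q) \<odot> B) a =
   (Poly_Mapping.lookup P \<odot> B) a + (Poly_Mapping.lookup Q \<odot> B) a"
  unfolding fmul_lookup
  by (rule setsum_keys_plus_distrib) (auto simp: distrib_right)

lemma fmul_zero_left: "((\<lambda>_. 0) \<odot> B) a = 0"
  by (simp add: fmul_def)

lemma fmul_lookup_sum:
  "(Poly_Mapping.lookup (\<Sum>i\<in>T. P i) \<odot> B) a = (\<Sum>i\<in>T. (Poly_Mapping.lookup (P i) \<odot> B) a)"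
  by (induction T rule: infinite_finite_induct) (simp_all add: fmul_lookup_add fmul_zero_left)

lemma fmul_single: "(Poly_Mapping.lookup (Poly_Mapping.single k v) \<odot> B) a = v * B (a - k)"
  unfolding fmul_lookup by (cases "v = 0") auto

text \<open>A series fixed by multiplication with a monomial is annihilated by 1 minus this
  monomial. The cofactor P is expanded into monomials together with that factor, and the terms
  cancel in pairs.\<close>

lemma fmul_mult_one_minus_mon_eq_0:
  assumes "\<And>x. B x = qpow (fst m) * B (x - snd m)"
  shows "(Poly_Mapping.lookup (P * (1 - lpoly_mon m)) \<odot> B) a = 0"
proof -
  have P: "P = (\<Sum>k\<in>Poly_Mapping.keys P. Poly_Mapping.single k (Poly_Mapping.lookup P k))"
    by (rule poly_mapping_eqI)
      (auto simp: Poly_Mapping.lookup_sum lookup_single when_def in_keys_iff)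
  have PQ: "P * (1 - lpoly_mon m) = (\<Sum>k\<in>Poly_Mapping.keys P.
      Poly_Mapping.single k (Poly_Mapping.lookup P k) +
      Poly_Mapping.single (k + snd m) (- (Poly_Mapping.lookup P k * qpow (fst m))))"
    by (subst P) (simp add: lpoly_mon_def sum_distrib_right right_diff_distrib mult_single single_uminus
        sum_subtractf sum.distrib sum_negf)
  have "(Poly_Mapping.lookup (P * (1 - lpoly_mon m)) \<odot> B) a = (\<Sum>k\<in>Poly_Mapping.keys P.
      Poly_Mapping.lookup P k * B (a - k) - Poly_Mapping.lookup P k * (qpow (fst m) * B (a - k - snd m)))"
    unfolding PQ fmul_lookup_sum fmul_lookup_add fmul_single
    by (rule sum.cong) (simp_all add: diff_diff_eq mult.assoc)
  also have "\<dots> = 0"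
  proof (rule sum.neutral, rule ballI)
    fix k
    show "Poly_Mapping.lookup P k * B (a - k) -
        Poly_Mapping.lookup P k * (qpow (fst m) * B (a - k - snd m)) = 0"
      unfolding assms[of "a - k", symmetric] by (rule diff_self)
  qed
  finally show ?thesis .
qed

lemma sum_by_card:
  assumes "finite A"
  shows "(\<Sum>s\<in>{0..card A}. \<Sum>I\<in>{I. I \<subseteq> A \<and> card I = s}. f I) = (\<Sum>I\<in>Pow A. f I)"
    and "(\<Sum>s\<in>{1..card A}. \<Sum>I\<in>{I. I \<subseteq> A \<and> card I = s}. f I) = (\<Sum>I\<in>Pow A - {{}}. f I)"
proof -
  have "{I \<in> Pow A. card I = s} = {I. I \<subseteq> A \<and> card I = s}" for s
    by auto
  then show "(\<Sum>s\<in>{0..card A}. \<Sum>I\<in>{I. I \<subseteq> A \<and> card I = s}. f I) = (\<Sum>I\<in>Pow A. f I)"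
    using sum.group[of "Pow A" "{0..card A}" card f] assms by (auto simp: card_mono image_subset_iff)
  have "{I \<in> Pow A - {{}}. card I = s} = {I. I \<subseteq> A \<and> card I = s}" if "s \<in> {1..card A}" for s
    using that by auto
  moreover have "card ` (Pow A - {{}}) \<subseteq> {1..card A}"
    using assms by (auto simp: card_mono Suc_le_eq card_gt_0_iff finite_subset)
  ultimately show "(\<Sum>s\<in>{1..card A}. \<Sum>I\<in>{I. I \<subseteq> A \<and> card I = s}. f I) = (\<Sum>I\<in>Pow A - {{}}. f I)"
    using sum.group[of "Pow A - {{}}" "{1..card A}" card f] assms by simp
qed

text \<open>\<open>occ_insert\<close> at site b - 1, solved for the series without b. It is the
  left-hand side of (a) in one coefficient: multiplication by the product of all t_i translates
  every site by -1.\<close>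

lemma occ_recurrence:
  "occ (insert b B) + qpow (of_int (- b)) * occ (shift (-1) (insert b B)) = occ (B - {b})"
proof -
  have "occ (insert (b - 1) (shift (-1) (B - {b}))) =
      qpow (of_int b) * (occ (B - {b}) - occ (insert b (B - {b})))"
    using occ_insert[of "b - 1" "shift (-1) (B - {b})"] by (simp add: in_shift_iff)
  moreover have "insert (b - 1) (shift (-1) (B - {b})) = shift (-1) (insert b B)"
    by (auto simp: in_shift_iff)
  moreover have "qpow (of_int (- b)) * qpow (of_int b) = 1"
    unfolding qpow_of_int_add[symmetric] by simp
  ultimately show ?thesis
    by (simp add: mult.assoc[symmetric])
qed


declare One_nat_def [simp del]

text \<open>From here on the Fock space enters only through the values of the coefficients of
  G.\<close>

locale coefficient_data =
  fixes g :: "rat list \<Rightarrow> complex fls" and n :: nat and rest :: "nat set \<Rightarrow> qt_monomial list"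
  assumes g_occ: "\<And>b. set b \<subseteq> half_ints \<Longrightarrow> g b = occ (floor ` set b)"
    and g_0: "\<And>b. \<not> set b \<subseteq> half_ints \<Longrightarrow> g b = 0"
    and n_pos: "n \<ge> 1"
    and rest_eq: "rest = (\<lambda>I. map (\<lambda>j. mon 0 {j}) (filter (\<lambda>j. j \<notin> I) [2..<n+1]))"
begin

definition others :: "nat set \<Rightarrow> nat list" where
  "others I = filter (\<lambda>j. j \<notin> I) [2..<n+1]"

lemma set_others: "set (others I) = {2..n} - I"
  by (auto simp: others_def)

lemma distinct_others [simp]: "distinct (others I)"
  by (simp add: others_def)

definition half_exponent :: "texp \<Rightarrow> bool" where
  "half_exponent a \<longleftrightarrow> Poly_Mapping.keys a \<subseteq> {1..n} \<and> lookup a ` {1..n} \<subseteq> half_ints"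

definition sites :: "texp \<Rightarrow> nat set \<Rightarrow> int set" where
  "sites a J = (\<lambda>j. \<lfloor>lookup a j\<rfloor>) ` J"

definition e1n :: texp where
  "e1n = snd (mon 0 {1..n})"

lemma snd_mon_e1n: "snd (mon c {1..n}) = e1n"
  by (simp add: e1n_def mon_def)

lemma range_split: "I \<subseteq> {2..n} \<Longrightarrow> insert 1 I \<union> ({2..n} - I) = {1..n}"
  using n_pos by auto

text \<open>The exponents on I equal that of t_1, so the half-integrality of the arguments is the
  same as that of all exponents from 1 to n.\<close>

lemma fsubst_first:
  assumes "I \<subseteq> {2..n}"
  shows "fsubst g (mon c (insert 1 I) # rest I) a =
    (if half_exponent a \<and> (\<forall>i\<in>I. lookup a i = lookup a 1)
     then occ (sites a (insert 1 ({2..n} - I))) * qpow (lookup a 1 * c) else 0)"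
proof -
  have fin: "finite (insert 1 I)"
    using assms finite_subset by auto
  have dis: "set (others I) \<inter> insert 1 I = {}"
    by (auto simp: set_others)
  have eq: "fsubst g (mon c (insert 1 I) # rest I) a =
    (if (\<forall>i\<in>I. lookup a i = lookup a 1) \<and> Poly_Mapping.keys a \<subseteq> {1..n}
     then g (lookup a 1 # map (lookup a) (others I)) * qpow (lookup a 1 * c) else 0)"
    unfolding rest_eq others_def[symmetric]
    by (subst fsubst_Cons_singles[OF distinct_others fin insertI1 dis])
      (simp only: set_others range_split[OF assms] ball_simps(7) simp_thms)
  show ?thesis
  proof (cases "(\<forall>i\<in>I. lookup a i = lookup a 1) \<and> Poly_Mapping.keys a \<subseteq> {1..n}")
    case True
    have set: "set (lookup a 1 # map (lookup a) (others I)) = lookup a ` (insert 1 ({2..n} - I))"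
      by (simp add: set_others)
    also have "lookup a ` (insert 1 ({2..n} - I)) = lookup a ` (insert 1 I \<union> ({2..n} - I))"
      using True by auto
    also have "\<dots> = lookup a ` {1..n}"
      using range_split[OF assms] by simp
    finally have half: "half_exponent a \<longleftrightarrow> set (lookup a 1 # map (lookup a) (others I)) \<subseteq> half_ints"
      using True by (simp add: half_exponent_def)
    show ?thesis
    proof (cases "half_exponent a")
      case h: True
      have "g (lookup a 1 # map (lookup a) (others I)) =
          occ (floor ` set (lookup a 1 # map (lookup a) (others I)))"
        using half h by (intro g_occ) simp
      also have "floor ` set (lookup a 1 # map (lookup a) (others I)) = sites a (insert 1 ({2..n} - I))"
        unfolding set sites_def by (simp add: image_image)
      finally show ?thesis
        using True h unfolding eq by simp
    next
      case False
      then have "g (lookup a 1 # map (lookup a) (others I)) = 0"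
        using half by (intro g_0) simp
      then show ?thesis
        using False unfolding eq by simp
    qed
  next
    case False
    then show ?thesis
      unfolding eq half_exponent_def by auto
  qed
qed

lemma fsubst_rest:
  assumes "Poly_Mapping.keys a \<subseteq> {2..n} - I"
  shows "fsubst g (rest I) a = g (map (lookup a) (others I))"
  unfolding rest_eq others_def[symmetric] using assms
  by (subst fsubst_singles) (auto simp: set_others)

lemma fsubst_rest_eq_0:
  "fsubst g (rest I) a \<noteq> 0 \<Longrightarrow> Poly_Mapping.keys a \<subseteq> {2..n} - I"
  unfolding rest_eq others_def[symmetric]
  by (subst (asm) fsubst_singles) (auto simp: set_others split: if_splits)

lemma fmul_delta_rest:
  assumes "I \<subseteq> {2..n}"
  shows "(delta_half (mon 0 (insert 1 I)) \<odot> fsubst g (rest I)) a =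
    (if half_exponent a \<and> (\<forall>i\<in>I. lookup a i = lookup a 1) then occ (sites a ({2..n} - I)) else 0)"
proof -
  have fin: "finite (insert 1 I)"
    using assms finite_subset by auto
  define x where "x = (\<Sum>i\<in>insert 1 I. Poly_Mapping.single i (lookup a i))"
  have lx: "lookup x i = (if i \<in> insert 1 I then lookup a i else 0)" for i
    unfolding x_def using fin
    by (simp only: Poly_Mapping.lookup_sum lookup_single when_def) (simp only: sum.delta if_cancel)
  have ly: "lookup (a - x) i = (if i \<in> insert 1 I then 0 else lookup a i)" for i
    by (simp add: lookup_minus lx)
  have D: "delta_half (mon 0 (insert 1 I)) x = (if (\<forall>i\<in>I. lookup a i = lookup a 1) \<and>
      lookup a 1 \<in> half_ints then 1 else 0)"
    by (subst delta_half_mon[OF fin insertI1]) (auto simp: lx in_keys_iff split: if_splits)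
  have eq: "(delta_half (mon 0 (insert 1 I)) \<odot> fsubst g (rest I)) a =
      delta_half (mon 0 (insert 1 I)) x * fsubst g (rest I) (a - x)"
  proof (rule fmul_disjoint[OF fin _ _ _ x_def])
    show "insert 1 I \<inter> ({2..n} - I) = {}"
      by auto
    show "Poly_Mapping.keys x \<subseteq> insert 1 I" if "delta_half (mon 0 (insert 1 I)) x \<noteq> 0" for x
      using that by (subst (asm) delta_half_mon[OF fin insertI1]) (auto split: if_splits)
  qed (rule fsubst_rest_eq_0)
  show ?thesis
  proof (cases "(\<forall>i\<in>I. lookup a i = lookup a 1) \<and> lookup a 1 \<in> half_ints \<and> Poly_Mapping.keys a \<subseteq> {1..n}")
    case True
    have "Poly_Mapping.keys (a - x) \<subseteq> {2..n} - I"
    proof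
      fix i assume "i \<in> Poly_Mapping.keys (a - x)"
      then have "i \<notin> insert 1 I" "i \<in> Poly_Mapping.keys a"
        by (auto simp: in_keys_iff ly split: if_splits)
      then show "i \<in> {2..n} - I"
        using True range_split[OF assms] by blast
    qed
    then have "fsubst g (rest I) (a - x) = g (map (lookup (a - x)) (others I))"
      by (rule fsubst_rest)
    also have "map (lookup (a - x)) (others I) = map (lookup a) (others I)"
      by (auto simp: ly set_others)
    finally have eq2: "(delta_half (mon 0 (insert 1 I)) \<odot> fsubst g (rest I)) a = g (map (lookup a) (others I))"
      unfolding eq D using True by simp
    have "lookup a ` {1..n} = lookup a ` (insert 1 I \<union> ({2..n} - I))"
      using range_split[OF assms] by simp
    also have "\<dots> = insert (lookup a 1) (set (map (lookup a) (others I)))"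
      using True by (auto simp: set_others)
    finally have half: "half_exponent a \<longleftrightarrow> set (map (lookup a) (others I)) \<subseteq> half_ints"
      using True by (simp add: half_exponent_def)
    show ?thesis
    proof (cases "half_exponent a")
      case h: True
      have "g (map (lookup a) (others I)) = occ (floor ` set (map (lookup a) (others I)))"
        using half h by (intro g_occ) simp
      also have "floor ` set (map (lookup a) (others I)) = sites a ({2..n} - I)"
        by (simp add: sites_def set_others image_image)
      finally show ?thesis
        using True h eq2 by simp
    next
      case False
      then have "g (map (lookup a) (others I)) = 0"
        using half by (intro g_0) simp
      then show ?thesis
        using False eq2 by simp
    qed
  next
    case False
    have "delta_half (mon 0 (insert 1 I)) x * fsubst g (rest I) (a - x) = 0"
    proof (cases "(\<forall>i\<in>I. lookup a i = lookup a 1) \<and> lookup a 1 \<in> half_ints")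
      case True
      then obtain i where i: "i \<in> Poly_Mapping.keys a" "i \<notin> {1..n}"
        using False by blast
      then have "i \<in> Poly_Mapping.keys (a - x)" "i \<notin> {2..n} - I"
        using assms n_pos by (auto simp: in_keys_iff ly)
      then have "fsubst g (rest I) (a - x) = 0"
        using fsubst_rest_eq_0 by blast
      then show ?thesis
        by simp
    next
      case False
      then show ?thesis
        unfolding D by (simp only: if_False mult_zero_left)
    qed
    moreover have "\<not> (half_exponent a \<and> (\<forall>i\<in>I. lookup a i = lookup a 1))"
    proof -
      have "lookup a 1 \<in> half_ints" "Poly_Mapping.keys a \<subseteq> {1..n}" if "half_exponent a"
        using that n_pos by (simp_all add: half_exponent_def image_subset_iff)
      then show ?thesis
        using False by blast
    qed
    ultimately show ?thesis
      unfolding eq by (simp only: if_False)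
  qed
qed

lemma lookup_e1n: "lookup e1n i = of_bool (i \<in> {1..n})"
  unfolding e1n_def by (rule lookup_snd_mon) simp

lemma half_exponent_diff: "half_exponent (a - e1n) \<longleftrightarrow> half_exponent a"
proof -
  have 1: "Poly_Mapping.keys (a - e1n) \<subseteq> {1..n} \<longleftrightarrow> Poly_Mapping.keys a \<subseteq> {1..n}"
  proof -
    have "lookup (a - e1n) i = lookup a i" if "i \<notin> {1..n}" for i
      using that by (simp only: lookup_minus lookup_e1n of_bool_eq(1) if_False diff_0_right simp_thms)
    then show ?thesis
      unfolding subset_iff in_keys_iff by metis
  qed
  have "r - 1 \<in> half_ints \<longleftrightarrow> r \<in> half_ints" for r :: rat
  proof -
    have "r - 1 - 1/2 = (r - 1/2) - 1"
      by simp
    then show ?thesis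
      unfolding half_ints_def mem_Collect_eq by (metis Ints_1 Ints_add Ints_diff diff_add_cancel)
  qed
  then have "lookup (a - e1n) ` {1..n} \<subseteq> half_ints \<longleftrightarrow> lookup a ` {1..n} \<subseteq> half_ints"
    by (auto simp: image_subset_iff lookup_minus lookup_e1n)
  with 1 show ?thesis
    by (simp add: half_exponent_def)
qed

lemma sites_diff:
  assumes "J \<subseteq> {1..n}"
  shows "sites (a - e1n) J = shift (-1) (sites a J)"
  unfolding sites_def shift_def image_image
  by (rule image_cong) (use assms in \<open>auto simp: lookup_minus lookup_e1n\<close>)

lemma lookup_site:
  assumes "half_exponent a" "i \<in> {1..n}"
  shows "lookup a i = site \<lfloor>lookup a i\<rfloor>"
  using assms by (auto simp: half_exponent_def image_subset_iff site_floor)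

text \<open>The variables whose particle shares the site of t_1. In the argument t_1 t_I only
  subsets I of this set can contribute to the coefficient at a.\<close>

definition coinciding :: "texp \<Rightarrow> nat set" where
  "coinciding a = {i \<in> {2..n}. lookup a i = lookup a 1}"

lemma sites_coinciding:
  assumes "half_exponent a"
  shows "sites a ({2..n} - coinciding a) = sites a {2..n} - {\<lfloor>lookup a 1\<rfloor>}"
proof -
  have "i \<in> coinciding a \<longleftrightarrow> \<lfloor>lookup a i\<rfloor> = \<lfloor>lookup a 1\<rfloor>" if "i \<in> {2..n}" for i
  proof -
    have "lookup a i = site \<lfloor>lookup a i\<rfloor>" "lookup a 1 = site \<lfloor>lookup a 1\<rfloor>"
      using that n_pos by (auto intro!: lookup_site[OF assms])
    then have "lookup a i = lookup a 1 \<longleftrightarrow> \<lfloor>lookup a i\<rfloor> = \<lfloor>lookup a 1\<rfloor>"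
      by metis
    then show ?thesis
      using that unfolding coinciding_def by blast
  qed
  then have "sites a ({2..n} - coinciding a) = (\<lambda>i. \<lfloor>lookup a i\<rfloor>) ` {i \<in> {2..n}. \<lfloor>lookup a i\<rfloor> \<noteq> \<lfloor>lookup a 1\<rfloor>}"
    unfolding sites_def by (intro image_cong) blast+
  also have "\<dots> = sites a {2..n} - {\<lfloor>lookup a 1\<rfloor>}"
    unfolding sites_def by (simp only: set_eq_iff image_iff Diff_iff mem_Collect_eq singleton_iff Bex_def) metis
  finally show ?thesis .
qed

lemma sites_psubset_coinciding:
  assumes "I \<subset> coinciding a"
  shows "\<lfloor>lookup a 1\<rfloor> \<in> sites a ({2..n} - I)"
proof -
  obtain i where "i \<in> coinciding a" "i \<notin> I"
    using assms by blast
  then show ?thesis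
    unfolding sites_def by (intro image_eqI[of _ _ i]) (auto simp: coinciding_def)
qed

lemma sites_insert_coinciding:
  assumes "I \<subseteq> coinciding a"
  shows "sites a (insert 1 ({2..n} - I)) = insert \<lfloor>lookup a 1\<rfloor> (sites a {2..n})"
  using assms unfolding sites_def coinciding_def by force

lemma subset_coinciding_iff: "I \<subseteq> {2..n} \<Longrightarrow> (\<forall>i\<in>I. lookup a i = lookup a 1) \<longleftrightarrow> I \<subseteq> coinciding a"
  by (auto simp: coinciding_def)

lemma occ_recurrence_exponent:
  assumes "half_exponent a"
  shows "occ (sites a {1..n}) +
      qpow (- 1/2) * (occ (shift (-1) (sites a {1..n})) * qpow ((lookup a 1 - 1) * (-1))) =
    occ (sites a {2..n} - {\<lfloor>lookup a 1\<rfloor>})"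
proof -
  define b where "b = \<lfloor>lookup a 1\<rfloor>"
  have S: "sites a {1..n} = insert b (sites a {2..n})"
  proof -
    have "{1..n} = insert 1 {2..n}"
      using n_pos by auto
    then show ?thesis
      by (simp add: sites_def b_def)
  qed
  have "lookup a 1 = site b"
    unfolding b_def using lookup_site[OF assms] n_pos by simp
  then have "- 1/2 + (lookup a 1 - 1) * (-1) = of_int (- b)"
    by (simp add: site_def)
  moreover have "qpow (- 1/2 + (lookup a 1 - 1) * (-1)) = qpow (- 1/2) * qpow ((lookup a 1 - 1) * (-1))"
    by (rule qpow_add) simp
  ultimately have "qpow (of_int (- b)) = qpow (- 1/2) * qpow ((lookup a 1 - 1) * (-1))"
    by simp
  then show ?thesis
    using occ_recurrence[of b "sites a {2..n}"] unfolding S b_def[symmetric] by (simp only: mult_ac)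
qed

text \<open>Let C be the coinciding set, b the site of t_1 and B the set of the other sites. For I
  strictly inside C some remaining variable still occupies b, and the two terms for I cancel. A
  nonempty I = C leaves f(B - {b}) - f(B), which turns the first term f(B) on the right into the
  value f(B - {b}) that the recurrence gives on the left.\<close>

lemma formula_a:
  "fsubst g (mon 0 {1} # rest {}) a
     + (Poly_Mapping.lookup (lpoly_mon (mon (-1/2) {1..n})) \<odot> fsubst g (mon (-1) {1} # rest {})) a
   = (delta_half (mon 0 {1}) \<odot> fsubst g (rest {})) a
     + (\<Sum>I\<in>Pow {2..n} - {{}}. - fsubst g (mon 0 (insert 1 I) # rest I) a
          + (delta_half (mon 0 (insert 1 I)) \<odot> fsubst g (rest I)) a)"
proof (cases "half_exponent a")
  case False
  then have "\<not> half_exponent (a - e1n)"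
    by (simp add: half_exponent_diff)
  then show ?thesis
    using False fsubst_first[of "{}"] fmul_delta_rest[of "{}"]
    by (auto simp: fmul_lpoly_mon snd_mon_e1n fsubst_first fmul_delta_rest intro!: sum.neutral)
next
  case half: True
  define b where "b = \<lfloor>lookup a 1\<rfloor>"
  define B where "B = sites a {2..n}"
  have one: "insert 1 {2..n} = {1..n}"
    using n_pos by auto
  have la: "lookup (a - e1n) 1 = lookup a 1 - 1"
    using n_pos by (simp add: lookup_minus lookup_e1n)
  have lhs: "fsubst g (mon 0 {1} # rest {}) a
     + (Poly_Mapping.lookup (lpoly_mon (mon (-1/2) {1..n})) \<odot> fsubst g (mon (-1) {1} # rest {})) a = occ (B - {b})"
    using fsubst_first[of "{}"] half occ_recurrence_exponent[OF half]
    by (simp add: fmul_lpoly_mon snd_mon_e1n half_exponent_diff one sites_diff la b_def B_def)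
  have rhs1: "(delta_half (mon 0 {1}) \<odot> fsubst g (rest {})) a = occ B"
    using fmul_delta_rest[of "{}"] half by (simp add: B_def)
  let ?f = "\<lambda>I. - fsubst g (mon 0 (insert 1 I) # rest I) a
          + (delta_half (mon 0 (insert 1 I)) \<odot> fsubst g (rest I)) a"
  let ?C = "coinciding a"
  have C: "?C \<subseteq> {2..n}"
    by (auto simp: coinciding_def)
  have f: "?f I = (if I = ?C then occ (B - {b}) - occ B else 0)"
    if I: "I \<in> Pow {2..n} - {{}}" for I
  proof -
    have I2: "I \<subseteq> {2..n}" "I \<noteq> {}"
      using I by auto
    consider "\<not> I \<subseteq> ?C" | "I = ?C" | "I \<subset> ?C"
      by blast
    then show ?thesis
    proof cases
      case 1
      then have no: "\<not> (half_exponent a \<and> (\<forall>i\<in>I. lookup a i = lookup a 1))"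
        using subset_coinciding_iff[OF I2(1), of a] by blast
      have "I \<noteq> ?C"
        using 1 by blast
      then show ?thesis
        unfolding fsubst_first[OF I2(1)] fmul_delta_rest[OF I2(1)] if_not_P[OF no] by simp
    next
      case 2
      then obtain i where i: "i \<in> ?C"
        using I2 by blast
      then have "b \<in> B"
        unfolding b_def B_def sites_def by (intro image_eqI[of _ _ i]) (auto simp: coinciding_def)
      then have "insert b B = B"
        by blast
      moreover have yes: "half_exponent a \<and> (\<forall>i\<in>I. lookup a i = lookup a 1)"
        using 2 half subset_coinciding_iff[OF I2(1), of a] by blast
      ultimately have "?f I = - occ B + occ (B - {b})"
        unfolding fsubst_first[OF I2(1)] fmul_delta_rest[OF I2(1)] if_P[OF yes]
        using sites_coinciding[OF half] sites_insert_coinciding[of I a] 2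
        by (simp add: b_def B_def)
      then show ?thesis
        using 2 by simp
    next
      case 3
      have "sites a (insert 1 ({2..n} - I)) = insert b (sites a ({2..n} - I))"
        by (simp add: sites_def b_def)
      also have "\<dots> = sites a ({2..n} - I)"
        using sites_psubset_coinciding[OF 3] unfolding b_def by blast
      finally have S: "sites a (insert 1 ({2..n} - I)) = sites a ({2..n} - I)" .
      have yes: "half_exponent a \<and> (\<forall>i\<in>I. lookup a i = lookup a 1)"
        using 3 half subset_coinciding_iff[OF I2(1), of a] by blast
      show ?thesis
        unfolding fsubst_first[OF I2(1)] fmul_delta_rest[OF I2(1)] if_P[OF yes] S
        using 3 by simp
    qed
  qed
  have "(\<Sum>I\<in>Pow {2..n} - {{}}. ?f I) =
      (\<Sum>I\<in>Pow {2..n} - {{}}. if I = ?C then occ (B - {b}) - occ B else 0)"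
    by (rule sum.cong) (use f in auto)
  also have "\<dots> = occ (B - {b}) - occ B"
  proof (cases "?C = {}")
    \<comment> \<open>Here no nonempty I contributes, but the difference is zero anyway because b
      does not occur in B.\<close>
    case True
    have "B - {b} = B"
      using sites_coinciding[OF half] True by (simp add: B_def b_def)
    then show ?thesis
      by simp
  next
    case False
    then have "?C \<in> Pow {2..n} - {{}}"
      using C by auto
    then show ?thesis
      by (simp add: sum.delta)
  qed
  finally show ?thesis
    unfolding lhs rhs1 by simp
qed

text \<open>The right-hand side is the coefficient of delta_{1/2}(q t_1) G(t_2, ..., t_n). If
  another variable shares the exponent of t_1, the alternating sum over subsets of
  \<open>coinciding a\<close> vanishes and b already lies in B, so the first term is all that
  remains. Otherwise only I = {} is left and the recurrence applies.\<close>

lemma inner_b: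
  "fsubst g (mon 1 {1} # rest {}) a
     + (Poly_Mapping.lookup (lpoly_mon (mon (1/2) {1..n})) \<odot>
         (\<lambda>a. \<Sum>I\<in>Pow {2..n}. (-1) ^ card I * fsubst g (mon 0 (insert 1 I) # rest I) a)) a
   = (if half_exponent a then qpow (lookup a 1) * occ (sites a {2..n}) else 0)"
proof (cases "half_exponent a")
  case False
  then have "\<not> half_exponent (a - e1n)"
    by (simp add: half_exponent_diff)
  then show ?thesis
    using False fsubst_first[of "{}"]
    by (auto simp: fmul_lpoly_mon snd_mon_e1n fsubst_first intro!: sum.neutral)
next
  case half: True
  define b where "b = \<lfloor>lookup a 1\<rfloor>"
  define B where "B = sites a {2..n}"
  let ?C = "coinciding a"
  have C: "?C \<subseteq> {2..n}" "finite ?C"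
    by (auto simp: coinciding_def)
  have one: "insert 1 {2..n} = {1..n}"
    using n_pos by auto
  have S: "sites a {1..n} = insert b B"
    unfolding one[symmetric] by (simp add: sites_def b_def B_def)
  have h': "half_exponent (a - e1n)"
    using half by (simp add: half_exponent_diff)
  have eqs: "lookup (a - e1n) i = lookup (a - e1n) 1 \<longleftrightarrow> lookup a i = lookup a 1" if "i \<in> {2..n}" for i
    using that n_pos by (simp add: lookup_minus lookup_e1n)
  have shifted: "fsubst g (mon 0 (insert 1 I) # rest I) (a - e1n) =
      (if I \<subseteq> ?C then occ (shift (-1) (insert b B)) else 0)" if I: "I \<subseteq> {2..n}" for I
  proof -
    have "(\<forall>i\<in>I. lookup (a - e1n) i = lookup (a - e1n) 1) \<longleftrightarrow> I \<subseteq> ?C"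
      using subset_coinciding_iff[OF I, of a] eqs I by blast
    moreover have "sites (a - e1n) (insert 1 ({2..n} - I)) = shift (-1) (insert b B)" if "I \<subseteq> ?C"
      using sites_insert_coinciding[OF that] n_pos by (subst sites_diff) (auto simp: b_def B_def)
    ultimately show ?thesis
      using h' by (simp add: fsubst_first[OF I])
  qed
  have "(\<Sum>I\<in>Pow {2..n}. (-1) ^ card I * fsubst g (mon 0 (insert 1 I) # rest I) (a - e1n)) =
      (\<Sum>I\<in>Pow {2..n}. if I \<in> Pow ?C then (-1) ^ card I * occ (shift (-1) (insert b B)) else 0)"
    by (rule sum.cong) (auto simp: shifted)
  also have "\<dots> = (\<Sum>I\<in>Pow ?C. (-1) ^ card I * occ (shift (-1) (insert b B)))"
    using C by (subst sum.inter_restrict[symmetric]) (auto intro!: sum.cong)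
  also have "\<dots> = (if ?C = {} then occ (shift (-1) (insert b B)) else 0)"
    using sum_Pow_power_card[OF C(2), of "-1 :: complex fls"] C(2)
    by (auto simp: sum_distrib_right[symmetric] card_gt_0_iff)
  finally have sum: "(\<Sum>I\<in>Pow {2..n}. (-1) ^ card I * fsubst g (mon 0 (insert 1 I) # rest I) (a - e1n)) =
      (if ?C = {} then occ (shift (-1) (insert b B)) else 0)" .
  have first: "fsubst g (mon 1 {1} # rest {}) a = occ (insert b B) * qpow (lookup a 1)"
    using fsubst_first[of "{}" 1 a] half S by (simp add: one)
  show ?thesis
  proof (cases "?C = {}")
    case True
    have "B - {b} = B"
      using sites_coinciding[OF half] True by (simp add: B_def b_def)
    then have rec: "occ (insert b B) +
        qpow (- 1/2) * (occ (shift (-1) (insert b B)) * qpow ((lookup a 1 - 1) * (-1))) = occ B"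
      using occ_recurrence_exponent[OF half] by (simp add: S b_def[symmetric] B_def[symmetric])
    have a1: "lookup a 1 = site b"
      unfolding b_def using lookup_site[OF half] n_pos by simp
    \<comment> \<open>The recurrence carries the factor q^(-1/2) q^(1 - a_1) on its second term;
      multiplied by q^(a_1) it becomes the q^(1/2) of the bracket.\<close>
    have "qpow (1/2) = qpow (lookup a 1) * (qpow (- 1/2) * qpow ((lookup a 1 - 1) * (-1)))"
    proof -
      have "lookup a 1 + (- 1/2 + (lookup a 1 - 1) * (-1)) = 1/2"
        by simp
      moreover have "24 * lookup a 1 \<in> \<int>" "24 * (- 1/2 :: rat) \<in> \<int>"
        by (simp_all add: a1 site_def distrib_left)
      ultimately show ?thesis
        by (metis qpow_add)
    qed
    then have "fsubst g (mon 1 {1} # rest {}) a + qpow (1/2) * occ (shift (-1) (insert b B)) =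
        qpow (lookup a 1) * (occ (insert b B) +
          qpow (- 1/2) * (occ (shift (-1) (insert b B)) * qpow ((lookup a 1 - 1) * (-1))))"
      unfolding first by (simp only: distrib_left mult_ac)
    then show ?thesis
      using half True unfolding rec by (simp add: fmul_lpoly_mon snd_mon_e1n sum B_def)
  next
    case False
    then obtain i where i: "i \<in> ?C"
      by blast
    then have "b \<in> B"
      unfolding b_def B_def sites_def by (intro image_eqI[of _ _ i]) (auto simp: coinciding_def)
    then have "insert b B = B"
      by blast
    then show ?thesis
      using half False by (simp add: fmul_lpoly_mon snd_mon_e1n sum first B_def mult.commute)
  qed
qed

lemma lookup_single_1:
  "lookup (snd (mon 1 {1})) i = of_bool (i = 1)"
  using lookup_snd_mon[of "{1}" 1 i] by simp

text \<open>Since H is delta_{1/2}(q t_1) times a series in the other variables, multiplication by q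
  t_1 fixes it. In the application P collects the factors of the product with nonempty I.\<close>

lemma formula_b:
  assumes "H = (\<lambda>a. if half_exponent a then qpow (lookup a 1) * occ (sites a {2..n}) else 0)"
  shows "(Poly_Mapping.lookup (P * (1 - lpoly_mon (mon 1 {1}))) \<odot> H) a = 0"
proof (rule fmul_mult_one_minus_mon_eq_0)
  fix x
  define y where "y = x - snd (mon 1 {1})"
  have ly: "lookup y i = lookup x i - of_bool (i = 1)" for i
    by (simp add: y_def lookup_minus lookup_single_1)
  have "half_exponent y \<longleftrightarrow> half_exponent x"
  proof -
    have "Poly_Mapping.keys y \<subseteq> {1..n} \<longleftrightarrow> Poly_Mapping.keys x \<subseteq> {1..n}"
    proof -
      have "lookup y i = lookup x i" if "i \<notin> {1..n}" for i
        using that n_pos by (auto simp: ly)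
      then show ?thesis
        unfolding subset_iff in_keys_iff by metis
    qed
    moreover have "lookup y i \<in> half_ints \<longleftrightarrow> lookup x i \<in> half_ints" for i
    proof -
      have "lookup x 1 - 1 - 1/2 = (lookup x 1 - 1/2) - 1"
        by simp
      then have "lookup x 1 - 1 \<in> half_ints \<longleftrightarrow> lookup x 1 \<in> half_ints"
        unfolding half_ints_def mem_Collect_eq by (metis Ints_1 Ints_add Ints_diff diff_add_cancel)
      then show ?thesis
        by (simp add: ly)
    qed
    ultimately show ?thesis
      by (simp add: half_exponent_def image_subset_iff)
  qed
  moreover have "sites y {2..n} = sites x {2..n}"
    unfolding sites_def by (rule image_cong) (auto simp: ly)
  moreover have "qpow 1 * qpow (lookup y 1) = qpow (lookup x 1)"
    using qpow_add[of 1 "lookup y 1"] by (simp add: ly)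
  ultimately show "H x = qpow (fst (mon 1 {1})) * H (x - snd (mon 1 {1}))"
    unfolding assms y_def[symmetric] by (simp add: mult.assoc[symmetric])
qed

end

declare One_nat_def [simp]

section \<open>Iterating the difference equation\<close>

unbundle fps_syntax

definition tri :: "int \<Rightarrow> int" where
  "tri r = r * (r + 1) div 2"

lemma tri_Suc: "tri (r + 1) = tri r + r + 1"
proof -
  have "(r + 1) * (r + 1 + 1) = r * (r + 1) + (r + 1) * 2"
    by (simp add: algebra_simps)
  then show ?thesis
    unfolding tri_def by simp
qed

lemma two_tri: "2 * tri r = r * (r + 1)"
  unfolding tri_def by (intro dvd_mult_div_cancel) simp

lemma tri_nonneg: "tri r \<ge> 0"
proof -
  have "r * (r + 1) \<ge> 0"
    by (cases "r \<ge> 0") (auto intro: mult_nonneg_nonneg mult_nonpos_nonpos)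
  then show ?thesis
    using two_tri[of r] by linarith
qed

lemma tri_ge: "r \<ge> 1 \<Longrightarrow> tri r \<ge> r"
proof -
  assume r: "r \<ge> 1"
  then have "r * 2 \<le> r * (r + 1)"
    by (intro mult_left_mono) auto
  then show ?thesis
    using two_tri[of r] by linarith
qed

lemma tri_minus: "tri (- 1 - r) = tri r"
  unfolding tri_def by (simp add: algebra_simps)

text \<open>The sum (j+1) + ... + (j+r), that is, the power of q collected in r steps to the right
  from site j. Negative r continues the same recursion to the left.\<close>

definition iterate_exponent :: "int \<Rightarrow> int \<Rightarrow> int" where
  "iterate_exponent r j = r * j + tri r"

definition sign :: "int \<Rightarrow> 'a::comm_ring_1" where
  "sign r = (if even r then 1 else -1)"

lemma sign_diff_1: "sign (r - 1) = - sign r"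
  by (simp add: sign_def)

text \<open>The values of r met when iterating from site j: to the right from 1 for j >= 0, to the
  left from 0 for j < 0. In this direction the collected exponent is at least |r|.\<close>

definition compat :: "int \<Rightarrow> int set" where
  "compat j = (if j \<ge> 0 then {1..} else {..0})"

text \<open>A telescoping sum over r >= 1 ends in -w(0), one over r <= 0 in w(0); this sign makes
  both equal to w(0).\<close>

definition dir_sign :: "int \<Rightarrow> 'a::comm_ring_1" where
  "dir_sign j = (if j \<ge> 0 then -1 else 1)"

lemma iterate_exponent_ge:
  assumes "r \<in> compat j"
  shows "iterate_exponent r j \<ge> \<bar>r\<bar>"
proof (cases "j \<ge> 0")
  case True
  then have "r \<ge> 1" "r * j \<ge> 0"
    using assms by (auto simp: compat_def)
  then show ?thesis
    using tri_ge[of r] by (simp add: iterate_exponent_def)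
next
  case False
  then have "r \<le> 0" "j \<le> -1"
    using assms by (auto simp: compat_def)
  then have "r * j \<ge> r * (-1)"
    by (intro mult_left_mono_neg) auto
  then show ?thesis
    using tri_nonneg[of r] \<open>r \<le> 0\<close> by (simp add: iterate_exponent_def)
qed

definition hser :: "int \<Rightarrow> int set \<Rightarrow> int \<Rightarrow> complex fls" where
  "hser j S r = sign r * (qpow (of_int (iterate_exponent r j)) * occ (shift r S))"

text \<open>This is \<open>occ_insert\<close> at site j + r - 1 for the translated diagram. The sign
  and the q-power in \<open>hser\<close> are chosen so that the recurrence reads as a difference of
  neighbours.\<close>

lemma hser_diff:
  assumes "j \<in> S"
  shows "sign r * (qpow (of_int (iterate_exponent r j)) * occ (shift r (S - {j}))) =
    hser j S r - hser j S (r - 1)"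
proof -
  have S: "insert j (S - {j}) = S"
    using assms by blast
  have "shift (r - 1) S = insert (j + r - 1) (shift (r - 1) (S - {j}))"
    by (subst S[symmetric], subst shift_insert) (simp only: add_diff_eq)
  moreover have "occ (insert (j + r - 1) (shift (r - 1) (S - {j}))) =
      qpow (of_int (j + r)) * (occ (shift r (S - {j})) - occ (insert (j + r) (shift r (S - {j}))))"
    using occ_insert[of "j + r - 1" "shift (r - 1) (S - {j})"] by (simp add: in_shift_iff)
  moreover have "insert (j + r) (shift r (S - {j})) = shift r S"
    by (subst (2) S[symmetric], subst shift_insert) simp
  ultimately have occ: "occ (shift (r - 1) S) =
      qpow (of_int (j + r)) * (occ (shift r (S - {j})) - occ (shift r S))"
    by simp
  have "iterate_exponent (r - 1) j + (j + r) = iterate_exponent r j"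
    using tri_Suc[of "r - 1"] by (simp add: iterate_exponent_def algebra_simps)
  then have "qpow (of_int (iterate_exponent r j)) =
      qpow (of_int (iterate_exponent (r - 1) j)) * qpow (of_int (j + r))"
    by (metis qpow_of_int_add)
  then have "hser j S (r - 1) = - (sign r * (qpow (of_int (iterate_exponent r j)) *
      (occ (shift r (S - {j})) - occ (shift r S))))"
    unfolding hser_def occ sign_diff_1 by (simp only: mult.assoc mult_minus_left)
  then show ?thesis
    by (simp add: hser_def algebra_simps)
qed

text \<open>
  Summing over the sets \<open>I\<close> of indices whose site coincides with that of \<open>i\<close> turns the terms into
  differences of consecutive members of one sequence.
\<close>

lemma telescoping_term:
  fixes b :: "'i \<Rightarrow> int"
  assumes J: "finite J" "i \<in> J"
  defines "I0 \<equiv> {k \<in> J - {i}. b k = b i}"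
  shows "(\<Sum>I\<in>Pow I0. of_int (r ^ card I) *
      (sign r * (qpow (of_int (iterate_exponent r (b i))) * occ (shift r (b ` (J - {i} - I)))))) =
    of_int ((r + 1) ^ card I0) * hser (b i) (b ` J) r - of_int (r ^ card I0) * hser (b i) (b ` J) (r - 1)"
proof -
  let ?X = "\<lambda>S. sign r * (qpow (of_int (iterate_exponent r (b i))) * occ (shift r S))"
  let ?m = "card I0"
  have fin: "finite I0"
    using J by (simp add: I0_def)
  have full: "b ` (J - {i} - I0) = b ` J - {b i}"
    by (auto simp: I0_def)
  \<comment> \<open>As long as some index of \<open>I0\<close> lies outside I, the site
    \<open>b i\<close> is still occupied by it. Only I = \<open>I0\<close> empties the site.\<close>
  have part: "b ` (J - {i} - I) = b ` J" if I: "I \<in> Pow I0 - {I0}" for I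
  proof -
    obtain k where k: "k \<in> I0" "k \<notin> I"
      using I by blast
    then have "b i = b k" "k \<in> J - {i} - I"
      by (auto simp: I0_def)
    then have "b i \<in> b ` (J - {i} - I)"
      by (simp only: image_eqI)
    moreover have "b ` J \<subseteq> insert (b i) (b ` (J - {i} - I))"
    proof (rule image_subsetI)
      fix l assume "l \<in> J"
      show "b l \<in> insert (b i) (b ` (J - {i} - I))"
      proof (cases "l \<in> insert i I")
        case True
        then show ?thesis
          using I by (auto simp: I0_def)
      next
        case False
        then show ?thesis
          using \<open>l \<in> J\<close> by blast
      qed
    qed
    ultimately have "b ` J \<subseteq> b ` (J - {i} - I)"
      by (metis insert_absorb)
    moreover have "b ` (J - {i} - I) \<subseteq> b ` J"
      by blast
    ultimately show ?thesis
      by (rule equalityI[rotated])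
  qed
  have "(\<Sum>I\<in>Pow I0. of_int (r ^ card I) * ?X (b ` (J - {i} - I))) =
      of_int (r ^ ?m) * ?X (b ` J - {b i}) + (\<Sum>I\<in>Pow I0 - {I0}. of_int (r ^ card I) * ?X (b ` (J - {i} - I)))"
    using fin by (subst sum.remove[of _ I0]) (simp_all add: full)
  also have "(\<Sum>I\<in>Pow I0 - {I0}. of_int (r ^ card I) * ?X (b ` (J - {i} - I))) =
      (\<Sum>I\<in>Pow I0 - {I0}. of_int (r ^ card I) * ?X (b ` J))"
    by (intro sum.cong refl) (simp only: part)
  also have "\<dots> = (\<Sum>I\<in>Pow I0. of_int (r ^ card I) * ?X (b ` J)) - of_int (r ^ ?m) * ?X (b ` J)"
    using fin by (simp add: sum_diff1)
  also have "(\<Sum>I\<in>Pow I0. of_int (r ^ card I) * ?X (b ` J)) = of_int ((r + 1) ^ ?m) * ?X (b ` J)"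
    using sum_Pow_power_card[OF fin, of r]
    by (simp only: sum_distrib_right[symmetric] of_int_sum[symmetric])
  also have "?X (b ` J) = hser (b i) (b ` J) r"
    by (simp only: hser_def)
  also have "?X (b ` J - {b i}) = hser (b i) (b ` J) r - hser (b i) (b ` J) (r - 1)"
    using J(2) by (intro hser_diff) blast
  finally show ?thesis
    by (simp add: algebra_simps)
qed

lemma nth_sign_mult: "(sign r * f) $$ k = sign r * (f $$ k)" for f :: "complex fls"
  by (simp add: sign_def)

lemma nth_qpow_of_int_mult: "(qpow (of_int e) * f) $$ k = f $$ (k - 24 * e)"
proof -
  have "\<lfloor>24 * (of_int e :: rat)\<rfloor> = 24 * e"
    using floor_of_int[of "24 * e", where 'a = rat] by (simp only: of_int_mult of_int_numeral)
  then show ?thesis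
    by (simp only: nth_qpow_mult)
qed

lemma nth_hser: "hser j S r $$ k = sign r * (occ (shift r S) $$ (k - 24 * iterate_exponent r j))"
  unfolding hser_def nth_sign_mult nth_qpow_of_int_mult ..

lemma nth_occ_compat_eq_0:
  assumes "r \<in> compat j" "\<bar>r\<bar> > k"
  shows "occ S $$ (k - 24 * iterate_exponent r j) = 0"
proof (rule nth_occ_neg)
  have "\<bar>r\<bar> \<le> 24 * iterate_exponent r j"
    using iterate_exponent_ge[OF assms(1)] by linarith
  then show "k - 24 * iterate_exponent r j < 0"
    using assms(2) by linarith
qed

lemma sum_telescope_int:
  fixes f :: "int \<Rightarrow> 'a::ab_group_add"
  assumes "a \<le> c + 1"
  shows "(\<Sum>r\<in>{a..c}. f r - f (r - 1)) = f c - f (a - 1)"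
proof -
  have "(\<Sum>r\<in>{a..a - 1 + int n}. f r - f (r - 1)) = f (a - 1 + int n) - f (a - 1)" for n
  proof (induction n)
    case (Suc n)
    have "{a..a - 1 + int (Suc n)} = insert (a - 1 + int (Suc n)) {a..a - 1 + int n}"
      by auto
    then show ?case
      using Suc by (simp add: algebra_simps)
  qed simp
  from this[of "nat (c + 1 - a)"] show ?thesis
    using assms by simp
qed

text \<open>The inner sums are w(r) - w(r-1) with w(r) the coefficient of (r+1)^m times the r-th
  iterate. The far end of the telescope vanishes because the collected exponent is at least |r| > k
  there and \<open>occ\<close> has no negative powers; the near end is w(0). At r = 0 the convention
  0^0 = 1 keeps the term with I empty.\<close>

lemma occ_coefficient:
  fixes b :: "'i \<Rightarrow> int"
  assumes J: "finite J" "i \<in> J" and N: "N \<ge> 1" "N > k"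
  defines "I0 \<equiv> {l \<in> J - {i}. b l = b i}"
  shows "occ (b ` J) $$ k = (\<Sum>r\<in>compat (b i) \<inter> {-N..N}. \<Sum>I\<in>Pow I0.
    dir_sign (b i) * sign r * of_int r ^ card I *
      occ (shift r (b ` (J - {i} - I))) $$ (k - 24 * iterate_exponent r (b i)))"
proof -
  let ?m = "card I0"
  let ?j = "b i"
  define w :: "int \<Rightarrow> complex" where "w = (\<lambda>r. of_int ((r + 1) ^ ?m) * hser ?j (b ` J) r $$ k)"
  have inner: "(\<Sum>I\<in>Pow I0. dir_sign ?j * sign r * of_int r ^ card I *
      occ (shift r (b ` (J - {i} - I))) $$ (k - 24 * iterate_exponent r ?j)) =
      dir_sign ?j * (w r - w (r - 1))" for r
  proof -
    have "(\<Sum>I\<in>Pow I0. of_int (r ^ card I) *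
        (sign r * (qpow (of_int (iterate_exponent r ?j)) * occ (shift r (b ` (J - {i} - I)))))) $$ k =
      w r - w (r - 1)"
      unfolding I0_def telescoping_term[OF J]
      by (simp only: w_def I0_def fls_minus_nth fls_mult_of_int_nth(1) diff_add_cancel)
    then have X: "(\<Sum>I\<in>Pow I0. of_int (r ^ card I) *
        (sign r * (occ (shift r (b ` (J - {i} - I))) $$ (k - 24 * iterate_exponent r ?j)))) =
      w r - w (r - 1)"
      by (simp only: fls_nth_sum fls_mult_of_int_nth(1) nth_sign_mult nth_qpow_of_int_mult)
    show ?thesis
      unfolding X[symmetric] sum_distrib_left by (simp only: of_int_power mult_ac)
  qed
  have w0: "w 0 = occ (b ` J) $$ k"
    by (simp add: w_def nth_hser sign_def iterate_exponent_def tri_def)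
  show ?thesis
  proof (cases "?j \<ge> 0")
    case True
    have rng: "compat ?j \<inter> {-N..N} = {1..N}"
      using True N by (auto simp: compat_def)
    have "N \<in> compat ?j" "\<bar>N\<bar> > k"
      using True N by (auto simp: compat_def)
    then have "w N = 0"
      by (simp add: w_def nth_hser nth_occ_compat_eq_0)
    then show ?thesis
      unfolding inner sum_distrib_left[symmetric] rng using sum_telescope_int[of 1 N w] N True w0
      by (simp add: dir_sign_def)
  next
    case False
    have rng: "compat ?j \<inter> {-N..N} = {-N..0}"
      using False N by (auto simp: compat_def)
    have "- N - 1 \<in> compat ?j" "\<bar>- N - 1\<bar> > k"
      using False N by (auto simp: compat_def)
    then have "w (- N - 1) = 0"
      by (simp add: w_def nth_hser nth_occ_compat_eq_0)
    then show ?thesis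
      unfolding inner sum_distrib_left[symmetric] rng using sum_telescope_int[of "- N" 0 w] N False w0
      by (simp add: dir_sign_def)
  qed
qed

unbundle no fps_syntax

section \<open>Convergence\<close>

lemma prod_power_int:
  fixes f :: "'i \<Rightarrow> 'a::field"
  shows "(\<Prod>l\<in>A. f l powi n) = (\<Prod>l\<in>A. f l) powi n"
  by (induction A rule: infinite_finite_induct) (simp_all add: power_int_mult_distrib)

text \<open>Consecutive terms have a quotient of at most p^n times a constant: p^n comes from the
  growth of \<open>tri\<close>, and the factor 2^m in the constant from (n+2)^m <=
  (2(n+1))^m.\<close>

lemma summable_gauss_nat:
  fixes p D :: real
  assumes p: "0 < p" "p < 1" and D: "D \<ge> 0"
  shows "summable (\<lambda>n. (real n + 1) ^ m * p powi tri (int n) * D ^ n)"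
proof -
  let ?f = "\<lambda>n. (real n + 1) ^ m * p powi tri (int n) * D ^ n"
  have "(\<lambda>n. p ^ n * (p * D * 2 ^ m)) \<longlonglongrightarrow> 0 * (p * D * 2 ^ m)"
    using p by (intro tendsto_mult LIMSEQ_realpow_zero tendsto_const) auto
  then have "\<forall>\<^sub>F n in sequentially. p ^ n * (p * D * 2 ^ m) < 1/2"
    by (rule order_tendstoD) simp
  then obtain N where N: "\<And>n. n \<ge> N \<Longrightarrow> p ^ n * (p * D * 2 ^ m) < 1/2"
    by (auto simp: eventually_sequentially)
  show ?thesis
  proof (rule summable_ratio_test[of "1/2" N])
    fix n assume "n \<ge> N"
    have tri: "p powi tri (int (Suc n)) = p powi tri (int n) * p ^ n * p"
    proof -
      have "tri (int (Suc n)) = tri (int n) + int n + 1"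
        using tri_Suc[of "int n"] by (simp add: add.commute)
      then show ?thesis
        using p by (simp add: power_int_add)
    qed
    have "(real (Suc n) + 1) ^ m \<le> (2 * (real n + 1)) ^ m"
      by (intro power_mono) auto
    then have "(real (Suc n) + 1) ^ m \<le> 2 ^ m * (real n + 1) ^ m"
      by (simp only: power_mult_distrib)
    then have "?f (Suc n) \<le> (2 ^ m * (real n + 1) ^ m) * (p powi tri (int n) * p ^ n * p) * (D ^ n * D)"
      unfolding tri power_Suc2 using p D by (intro mult_right_mono) auto
    also have "\<dots> = ?f n * (p ^ n * (p * D * 2 ^ m))"
      by (simp add: mult_ac)
    also have "\<dots> \<le> ?f n * (1/2)"
      using p D N[OF \<open>n \<ge> N\<close>] by (intro mult_left_mono) auto
    finally show "norm (?f (Suc n)) \<le> 1/2 * norm (?f n)"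
      using p D by simp
  qed simp
qed

lemma summable_gauss_int:
  fixes p D :: real
  assumes p: "0 < p" "p < 1" and D: "D \<ge> 0"
  shows "(\<lambda>r::int. \<bar>of_int r\<bar> ^ m * p powi tri r * D ^ nat \<bar>r\<bar>) summable_on UNIV"
proof -
  let ?f = "\<lambda>r::int. \<bar>of_int r\<bar> ^ m * p powi tri r * D ^ nat \<bar>r\<bar>"
  let ?g = "\<lambda>n. (real n + 1) ^ m * p powi tri (int n) * D ^ n"
  have g: "?g summable_on UNIV"
    using summable_gauss_nat[OF assms, of m] p D
    by (intro summable_nonneg_imp_summable_on) auto
  have "(\<lambda>n. ?f (int n)) summable_on UNIV"
    using g
  proof (rule summable_on_comparison_test)
    show "?f (int n) \<le> ?g n" "0 \<le> ?f (int n)" for n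
      using p D by (auto intro!: mult_right_mono power_mono)
  qed
  then have 1: "?f summable_on range int"
    by (subst summable_on_reindex) (auto simp: o_def)
  \<comment> \<open>The reflection r -> -1-r preserves \<open>tri\<close>, so the negative half is
    majorized by the same series with one extra factor D.\<close>
  have "(\<lambda>n. ?f (- 1 - int n)) summable_on UNIV"
  proof (rule summable_on_cong[THEN iffD1])
    show "(\<lambda>n. ?g n * D) summable_on UNIV"
      using g by (rule summable_on_cmult_left)
    show "?g n * D = ?f (- 1 - int n)" for n
    proof -
      have "nat \<bar>- 1 - int n\<bar> = Suc n"
        by simp
      moreover have "\<bar>of_int (- 1 - int n)\<bar> = real n + 1"
        by simp
      ultimately show ?thesis
        by (simp only: tri_minus power_Suc mult_ac)
    qed
  qed
  then have 2: "?f summable_on range (\<lambda>n. - 1 - int n)"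
    by (subst summable_on_reindex) (auto simp: o_def inj_on_def)
  have "UNIV = range int \<union> range (\<lambda>n. - 1 - int n)"
  proof (intro equalityI subsetI)
    fix r :: int
    show "r \<in> range int \<union> range (\<lambda>n. - 1 - int n)"
    proof (cases "r \<ge> 0")
      case True
      then have "r = int (nat r)"
        by simp
      then show ?thesis
        by blast
    next
      case False
      then have "r = - 1 - int (nat (- 1 - r))"
        by simp
      then show ?thesis
        by blast
    qed
  qed simp
  moreover have "range int \<inter> range (\<lambda>n. - 1 - int n) = {}"
    by auto
  ultimately show ?thesis
    using summable_on_Un_disjoint[OF 1 2] by simp
qed

lemma has_sum_geometric_int_nonneg:
  fixes z :: "'a::{real_normed_field,banach}"
  assumes "norm z < 1"
  shows "((\<lambda>j::int. z powi j) has_sum 1 / (1 - z)) {0..}"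
proof -
  have "((\<lambda>n. z ^ n) has_sum 1 / (1 - z)) UNIV"
    using assms by (intro norm_summable_imp_has_sum geometric_sums)
      (auto simp: norm_power intro: summable_geometric)
  then have "((\<lambda>j. z powi j) \<circ> int has_sum 1 / (1 - z)) UNIV"
    by (simp add: o_def)
  then have "((\<lambda>j. z powi j) has_sum 1 / (1 - z)) (range int)"
    by (subst has_sum_reindex) auto
  moreover have "range int = {0..}"
    by (auto dest: zero_le_imp_eq_int)
  ultimately show ?thesis
    by simp
qed

text \<open>Outside the unit disc the negative powers sum to minus the same fraction. This lets both
  directions of the iteration end in one formula.\<close>

lemma has_sum_geometric_int_neg:
  fixes z :: "'a::{real_normed_field,banach}"
  assumes "norm z > 1"
  shows "((\<lambda>j::int. z powi j) has_sum - (1 / (1 - z))) {..<0}"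
proof -
  have z: "z \<noteq> 0" "z \<noteq> 1"
    using assms by auto
  have "norm (inverse z) < 1"
    using assms by (simp add: norm_inverse inverse_less_1_iff)
  then have "((\<lambda>j::int. inverse z powi j) has_sum 1 / (1 - inverse z)) {0..}"
    by (rule has_sum_geometric_int_nonneg)
  then have "((\<lambda>j::int. inverse z * inverse z powi j) has_sum inverse z * (1 / (1 - inverse z))) {0..}"
    by (rule has_sum_cmult_right)
  moreover have "inverse z * (1 / (1 - inverse z)) = - (1 / (1 - z))"
    using z by (simp add: field_simps)
  ultimately have *: "((\<lambda>j::int. inverse z * inverse z powi j) has_sum - (1 / (1 - z))) {0..}"
    by simp
  show ?thesis
  proof (rule has_sum_reindex_bij_witness[of _ "\<lambda>j. - 1 - j" "\<lambda>j. - 1 - j", THEN iffD1, OF _ _ _ _ _ refl *])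
    fix j :: int
    have "z powi (- 1 - j) = z powi (-1) * z powi (- j)"
      using z power_int_add[of z "-1" "- j"] by simp
    then show "z powi (- 1 - j) = inverse z * inverse z powi j"
      by (simp add: power_int_minus power_int_inverse)
  qed auto
qed

lemma has_sum_sum:
  fixes f :: "'i \<Rightarrow> 'a \<Rightarrow> 'b::topological_comm_monoid_add"
  assumes "\<And>i. i \<in> I \<Longrightarrow> (f i has_sum S i) A"
  shows "((\<lambda>x. \<Sum>i\<in>I. f i x) has_sum (\<Sum>i\<in>I. S i)) A"
  using assms by (induction I rule: infinite_finite_induct) (simp_all add: has_sum_add)

lemma has_sum_times:
  fixes f :: "'a \<Rightarrow> complex" and g :: "'b \<Rightarrow> complex"
  assumes f: "(f has_sum A) S" and g: "(g has_sum B) T"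
  shows "((\<lambda>(s, t). f s * g t) has_sum A * B) (S \<times> T)"
proof (rule has_sum_SigmaI[where g = "\<lambda>s. f s * B"])
  show "((\<lambda>t. case (s, t) of (s, t) \<Rightarrow> f s * g t) has_sum f s * B) T" for s
    using g by (simp add: has_sum_cmult_right)
  show "((\<lambda>s. f s * B) has_sum A * B) S"
    using f by (rule has_sum_cmult_left)
  have fa: "(\<lambda>s. norm (f s)) summable_on S"
    using f has_sum_imp_summable summable_on_iff_abs_summable_on_complex by blast
  have ga: "(\<lambda>t. norm (g t)) summable_on T"
    using g has_sum_imp_summable summable_on_iff_abs_summable_on_complex by blast
  have "(\<lambda>x. norm (case x of (s, t) \<Rightarrow> f s * g t)) summable_on Sigma S (\<lambda>_. T)"
  proof (rule summable_on_SigmaI[where g = "\<lambda>s. norm (f s) * infsum (\<lambda>t. norm (g t)) T"])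
    show "((\<lambda>t. norm (case (s, t) of (s, t) \<Rightarrow> f s * g t)) has_sum
        norm (f s) * infsum (\<lambda>t. norm (g t)) T) T" for s
      using has_sum_cmult_right[OF has_sum_infsum[OF ga], of "norm (f s)"] by (simp add: norm_mult)
    show "(\<lambda>s. norm (f s) * infsum (\<lambda>t. norm (g t)) T) summable_on S"
      using fa by (rule summable_on_cmult_left)
  qed simp
  then show "(\<lambda>(s, t). f s * g t) summable_on S \<times> T"
    by (rule abs_summable_summable)
qed

section \<open>Appell-Lerch sums and their double expansion\<close>

locale nome =
  fixes q u :: complex
  assumes norm_q: "norm q < 1" and u_power: "u ^ 24 = q" and u_nonzero: "u \<noteq> 0"
begin

lemma q_nonzero [simp]: "q \<noteq> 0"
  using u_power u_nonzero by auto

lemma u_powi: "u powi (24 * e) = q powi e"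
proof -
  have "u powi (24 * e) = (u powi 24) powi e"
    by (rule power_int_mult)
  then show ?thesis
    by (simp add: u_power)
qed

text \<open>For m = 0 the negative of the term of a level-one Appell-Lerch sum; r^m stems from m
  applications of -y d/dy. It is the term of A_m in the overview without x^(1/2): exponents are
  rounded down to integers here, the square root s of the product of the t_i takes up the halves,
  and q^(r^2/2) (q^r)^(1/2) is q to the power \<open>tri r\<close>.\<close>

definition lerch_term :: "nat \<Rightarrow> complex \<Rightarrow> complex \<Rightarrow> int \<Rightarrow> complex" where
  "lerch_term m x y r =
     - sign r * of_int r ^ m * q powi tri r * y powi (- r) / (1 - q powi r * x)"

definition lerch :: "nat \<Rightarrow> complex \<Rightarrow> complex \<Rightarrow> complex" where
  "lerch m x y = infsum (lerch_term m x y) UNIV"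

lemma norm_sign [simp]: "norm (sign r :: complex) = 1"
  by (simp add: sign_def)

lemma norm_powi_le:
  fixes y :: complex
  assumes "y \<noteq> 0" "norm y \<le> D" "inverse (norm y) \<le> D"
  shows "norm (y powi (- r)) \<le> D ^ nat \<bar>r\<bar>"
proof (cases "r \<ge> 0")
  case True
  then have "norm (y powi (- r)) = inverse (norm y) ^ nat \<bar>r\<bar>"
    by (simp add: power_int_def norm_inverse norm_power power_inverse)
  then show ?thesis
    using assms by (simp add: power_mono)
next
  case False
  then have "norm (y powi (- r)) = norm y ^ nat \<bar>r\<bar>"
    by (simp add: power_int_def norm_power)
  then show ?thesis
    using assms by (simp add: power_mono)
qed

lemma norm_lerch_term_le:
  assumes "y \<noteq> 0" "norm y \<le> D" "inverse (norm y) \<le> D" "0 < c" "c \<le> norm (1 - q powi r * x)"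
  shows "norm (lerch_term m x y r) \<le> (\<bar>of_int r\<bar> ^ m * norm q powi tri r * D ^ nat \<bar>r\<bar>) / c"
proof -
  have "norm (lerch_term m x y r) =
      (\<bar>of_int r\<bar> ^ m * norm q powi tri r * norm (y powi (- r))) / norm (1 - q powi r * x)"
    by (simp add: lerch_term_def norm_mult norm_divide norm_power norm_power_int)
  also have "\<dots> \<le> (\<bar>of_int r\<bar> ^ m * norm q powi tri r * D ^ nat \<bar>r\<bar>) / c"
    using norm_powi_le[OF assms(1-3), of r] assms(2,4,5)
    by (intro frac_le mult_left_mono mult_nonneg_nonneg) (auto intro: order_trans[OF norm_ge_zero])
  finally show ?thesis .
qed

lemma summable_lerch_bound:
  assumes "D \<ge> 0"
  shows "(\<lambda>r. (\<bar>of_int r\<bar> ^ m * norm q powi tri r * D ^ nat \<bar>r\<bar>) / c) summable_on UNIV"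
  using summable_on_cmult_left[OF summable_gauss_int[of "norm q" D m], of "1 / c"] assms norm_q by simp

text \<open>The annulus 1 < |x| < 1/|q| contains no power of q, and q^r x stays inside or outside
  the unit circle according to the sign of r - 1/2, with a distance independent of r.\<close>

lemma denominator_bounds:
  assumes "1 < norm x" "norm x * norm q < 1"
  shows "r \<ge> 1 \<Longrightarrow> norm (q powi r * x) \<le> norm x * norm q"
    and "r \<le> 0 \<Longrightarrow> norm (q powi r * x) \<ge> norm x"
proof -
  show "norm (q powi r * x) \<le> norm x * norm q" if "r \<ge> 1"
  proof -
    have "norm q powi r \<le> norm q powi 1"
      using norm_q that by (intro power_int_decreasing) auto
    then have "norm q powi r * norm x \<le> norm q powi 1 * norm x"
      by (intro mult_right_mono) auto
    then show ?thesis
      by (simp add: norm_mult norm_power_int mult.commute)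
  qed
  show "norm (q powi r * x) \<ge> norm x" if "r \<le> 0"
  proof -
    have "norm q powi 0 \<le> norm q powi r"
      using norm_q that by (intro power_int_decreasing) auto
    then have "1 * norm x \<le> norm q powi r * norm x"
      by (intro mult_right_mono) auto
    then show ?thesis
      by (simp add: norm_mult norm_power_int)
  qed
qed

lemma summable_lerch:
  assumes x: "1 < norm x" "norm x * norm q < 1" and y: "y \<noteq> 0"
  shows "lerch_term m x y summable_on UNIV"
proof (rule abs_summable_summable, rule summable_on_comparison_test)
  define D where "D = max (norm y) (inverse (norm y))"
  define c where "c = min (1 - norm x * norm q) (norm x - 1)"
  have D: "norm y \<le> D" "inverse (norm y) \<le> D" "D \<ge> 0"
    unfolding D_def by (auto simp: le_max_iff_disj)
  show "(\<lambda>r. (\<bar>of_int r\<bar> ^ m * norm q powi tri r * D ^ nat \<bar>r\<bar>) / c) summable_on UNIV"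
    by (rule summable_lerch_bound[OF D(3)])
  fix r :: int
  have "c \<le> norm (1 - q powi r * x)"
  proof (cases "r \<ge> 1")
    case True
    then show ?thesis
      using denominator_bounds(1)[OF x True] norm_triangle_ineq2[of 1 "q powi r * x"] by (simp add: c_def)
  next
    case False
    then show ?thesis
      using denominator_bounds(2)[OF x, of r] norm_triangle_ineq2[of "q powi r * x" 1]
      by (simp add: c_def norm_minus_commute)
  qed
  moreover have "c > 0"
    using x by (simp add: c_def)
  ultimately show "norm (lerch_term m x y r) \<le> (\<bar>of_int r\<bar> ^ m * norm q powi tri r * D ^ nat \<bar>r\<bar>) / c"
    using norm_lerch_term_le[OF y D(1,2)] by blast
qed auto

definition compat_sites :: "int \<Rightarrow> int set" where
  "compat_sites r = {j. r \<in> compat j}"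

lemma compat_sites_eq: "compat_sites r = (if r \<ge> 1 then {0..} else {..<0})"
  by (auto simp: compat_sites_def compat_def split: if_splits)

definition expansion_term :: "nat \<Rightarrow> complex \<Rightarrow> complex \<Rightarrow> int \<times> int \<Rightarrow> complex" where
  "expansion_term m x y = (\<lambda>(r, j). dir_sign j * sign r * of_int r ^ m *
     q powi iterate_exponent r j * x powi j * y powi (- r))"

lemma expansion_term_eq:
  assumes "j \<in> compat_sites r" "x \<noteq> 0"
  shows "expansion_term m x y (r, j) = (if r \<ge> 1 then -1 else 1) *
    (sign r * of_int r ^ m * q powi tri r * y powi (- r)) * (q powi r * x) powi j"
proof -
  have "dir_sign j = (if r \<ge> 1 then -1 else 1 :: complex)"
    using assms by (auto simp: compat_sites_eq dir_sign_def split: if_splits)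
  moreover have "q powi iterate_exponent r j * x powi j = q powi tri r * (q powi r * x) powi j"
    by (simp add: iterate_exponent_def power_int_add power_int_mult power_int_mult_distrib)
  ultimately show ?thesis
    by (simp add: expansion_term_def mult_ac)
qed

text \<open>Summing over j first gives geometric series in q^r x: the pairing in
  \<open>compat\<close> puts j >= 0 with |q^r x| < 1 and j < 0 with |q^r x| > 1.
  \<open>dir_sign\<close> makes both values equal to \<open>lerch_term\<close>. The same computation
  with norms gives absolute convergence.\<close>

lemma has_sum_expansion:
  assumes x: "1 < norm x" "norm x * norm q < 1" and y: "y \<noteq> 0"
  shows "(expansion_term m x y has_sum lerch m x y) (Sigma UNIV compat_sites)"
proof (rule has_sum_SigmaI[where g = "lerch_term m x y"])
  have x0: "x \<noteq> 0"
    using x by auto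
  let ?z = "\<lambda>r. q powi r * x"
  let ?c = "\<lambda>r. sign r * of_int r ^ m * q powi tri r * y powi (- r)"
  show "((\<lambda>j. expansion_term m x y (r, j)) has_sum lerch_term m x y r) (compat_sites r)" for r
  proof (rule has_sum_cong[THEN iffD2])
    show "expansion_term m x y (r, j) = (if r \<ge> 1 then -1 else 1) * ?c r * ?z r powi j"
      if "j \<in> compat_sites r" for j
      using that x0 by (rule expansion_term_eq)
    show "((\<lambda>j. (if r \<ge> 1 then -1 else 1) * ?c r * ?z r powi j) has_sum lerch_term m x y r) (compat_sites r)"
    proof (cases "r \<ge> 1")
      case True
      have "norm (?z r) < 1"
        using denominator_bounds(1)[OF x True] x by simp
      then have "((\<lambda>j. - ?c r * ?z r powi j) has_sum - ?c r * (1 / (1 - ?z r))) {0..}"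
        by (intro has_sum_cmult_right has_sum_geometric_int_nonneg)
      then show ?thesis
        using True by (simp add: compat_sites_eq lerch_term_def)
    next
      case False
      have "norm (?z r) > 1"
        using denominator_bounds(2)[OF x, of r] x False by simp
      then have "((\<lambda>j. ?c r * ?z r powi j) has_sum ?c r * - (1 / (1 - ?z r))) {..<0}"
        by (intro has_sum_cmult_right has_sum_geometric_int_neg)
      then show ?thesis
        using False by (simp add: compat_sites_eq lerch_term_def)
    qed
  qed
  show "(lerch_term m x y has_sum lerch m x y) UNIV"
    unfolding lerch_def using summable_lerch[OF assms] by (rule has_sum_infsum)
  define D where "D = max (norm y) (inverse (norm y))"
  have D: "norm y \<le> D" "inverse (norm y) \<le> D" "D \<ge> 0"
    unfolding D_def by (auto simp: le_max_iff_disj)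
  define c where "c = min (1 - norm x * norm q) (norm x - 1)"
  have c: "c > 0"
    using x by (simp add: c_def)
  define g where "g = (\<lambda>r. norm (?c r) * \<bar>1 / (1 - norm (?z r))\<bar>)"
  have "(\<lambda>p. norm (expansion_term m x y p)) summable_on Sigma UNIV compat_sites"
  proof (rule summable_on_SigmaI[where g = g])
    show "((\<lambda>j. norm (expansion_term m x y (r, j))) has_sum g r) (compat_sites r)" for r
    proof (rule has_sum_cong[THEN iffD2])
      show "norm (expansion_term m x y (r, j)) = norm (?c r) * norm (?z r) powi j"
        if "j \<in> compat_sites r" for j
        unfolding expansion_term_eq[OF that x0] by (simp add: norm_mult norm_power_int)
      show "((\<lambda>j. norm (?c r) * norm (?z r) powi j) has_sum g r) (compat_sites r)"
      proof (cases "r \<ge> 1")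
        case True
        have z: "norm (?z r) < 1"
          using denominator_bounds(1)[OF x True] x by simp
        then have "((\<lambda>j. norm (?c r) * norm (?z r) powi j) has_sum norm (?c r) * (1 / (1 - norm (?z r)))) {0..}"
          by (intro has_sum_cmult_right has_sum_geometric_int_nonneg) simp
        moreover have "g r = norm (?c r) * (1 / (1 - norm (?z r)))"
          using z by (simp add: g_def)
        ultimately show ?thesis
          using True by (simp add: compat_sites_eq)
      next
        case False
        have z: "norm (?z r) > 1"
          using denominator_bounds(2)[OF x, of r] x False by simp
        then have "((\<lambda>j. norm (?c r) * norm (?z r) powi j) has_sum norm (?c r) * - (1 / (1 - norm (?z r)))) {..<0}"
          by (intro has_sum_cmult_right has_sum_geometric_int_neg) simp
        moreover have "g r = norm (?c r) * - (1 / (1 - norm (?z r)))"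
          using z by (simp add: g_def abs_if)
        ultimately show ?thesis
          using False by (simp add: compat_sites_eq)
      qed
    qed
    show "g summable_on UNIV"
    proof (rule summable_on_comparison_test[OF summable_lerch_bound[OF D(3), of m c]])
      fix r :: int
      have "c \<le> \<bar>1 - norm (?z r)\<bar>"
        using denominator_bounds[OF x, of r] unfolding c_def by (cases "r \<ge> 1") linarith+
      then have "\<bar>1 / (1 - norm (?z r))\<bar> \<le> 1 / c"
        using c by (simp add: abs_divide frac_le)
      moreover have "norm (?c r) \<le> \<bar>of_int r\<bar> ^ m * norm q powi tri r * D ^ nat \<bar>r\<bar>"
        using norm_powi_le[OF y D(1,2), of r]
        by (simp add: norm_mult norm_power norm_power_int mult_left_mono)
      ultimately have "g r \<le> (\<bar>of_int r\<bar> ^ m * norm q powi tri r * D ^ nat \<bar>r\<bar>) * (1 / c)"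
        unfolding g_def by (intro mult_mono) (auto simp: D)
      then show "g r \<le> (\<bar>of_int r\<bar> ^ m * norm q powi tri r * D ^ nat \<bar>r\<bar>) / c"
        by simp
    qed (simp add: g_def)
  qed simp
  then show "expansion_term m x y summable_on Sigma UNIV compat_sites"
    by (rule abs_summable_summable)
qed


text \<open>The terms of G with exponents rounded down and without the factor s. Variables are
  indexed by an arbitrary set J, so that an induction can remove several of them at once.\<close>

definition phi_term :: "('i \<Rightarrow> complex) \<Rightarrow> 'i set \<Rightarrow> int \<times> ('i \<Rightarrow> int) \<Rightarrow> complex" where
  "phi_term t J = (\<lambda>(k, b). fls_nth (occ (b ` J)) k * u powi k * (\<Prod>l\<in>J. t l powi b l))"

definition in_domain :: "'i set \<Rightarrow> ('i \<Rightarrow> complex) \<Rightarrow> bool" where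
  "in_domain J t \<longleftrightarrow> (\<forall>l\<in>J. 1 < norm (t l)) \<and> norm (\<Prod>l\<in>J. t l) * norm q < 1"

abbreviation terms_index :: "'i set \<Rightarrow> (int \<times> ('i \<Rightarrow> int)) set" where
  "terms_index J \<equiv> UNIV \<times> PiE J (\<lambda>_. UNIV)"

text \<open>Since every |t_l| exceeds 1, a nonempty subproduct has modulus above 1, and no
  subproduct has larger modulus than the full product.\<close>

lemma in_domain_split:
  assumes t: "in_domain J t" and J: "finite J" "X \<subseteq> J" "X \<noteq> {}"
  shows "1 < norm (\<Prod>l\<in>X. t l)" "norm (\<Prod>l\<in>X. t l) * norm q < 1" "in_domain (J - X) t"
proof -
  have fin: "finite X"
    using J finite_subset by blast
  have x: "1 < norm (\<Prod>l\<in>X. t l)"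
    unfolding prod_norm[symmetric] using t J fin by (intro less_1_prod) (auto simp: in_domain_def)
  have y: "1 \<le> norm (\<Prod>l\<in>J - X. t l)"
    unfolding prod_norm[symmetric] using t by (intro prod_ge_1) (auto simp: in_domain_def intro: less_imp_le)
  have xy: "norm (\<Prod>l\<in>J. t l) = norm (\<Prod>l\<in>X. t l) * norm (\<Prod>l\<in>J - X. t l)"
    using prod.subset_diff[OF J(2,1), of t] by (simp add: norm_mult mult.commute)
  have J': "norm (\<Prod>l\<in>J. t l) * norm q < 1"
    using t by (simp add: in_domain_def)
  show "1 < norm (\<Prod>l\<in>X. t l)"
    by (rule x)
  have "norm (\<Prod>l\<in>X. t l) * 1 \<le> norm (\<Prod>l\<in>X. t l) * norm (\<Prod>l\<in>J - X. t l)"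
    using y by (intro mult_left_mono) auto
  then have "norm (\<Prod>l\<in>X. t l) * norm q \<le> norm (\<Prod>l\<in>J. t l) * norm q"
    unfolding xy by (intro mult_right_mono) auto
  then show "norm (\<Prod>l\<in>X. t l) * norm q < 1"
    using J' by linarith
  have "1 * norm (\<Prod>l\<in>J - X. t l) \<le> norm (\<Prod>l\<in>X. t l) * norm (\<Prod>l\<in>J - X. t l)"
    using x by (intro mult_right_mono) auto
  then have "norm (\<Prod>l\<in>J - X. t l) * norm q \<le> norm (\<Prod>l\<in>J. t l) * norm q"
    unfolding xy by (intro mult_right_mono) auto
  then have "norm (\<Prod>l\<in>J - X. t l) * norm q < 1"
    using J' by linarith
  then show "in_domain (J - X) t"
    using t by (simp add: in_domain_def)
qed

section \<open>One step of the induction on the set of variables\<close>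

definition fiber_term :: "('i \<Rightarrow> complex) \<Rightarrow> 'i set \<Rightarrow> 'i \<Rightarrow> 'i set \<Rightarrow> int \<times> ('i \<Rightarrow> int) \<Rightarrow> int \<Rightarrow> complex" where
  "fiber_term t J i I = (\<lambda>(k, b) r. dir_sign (b i) * sign r * of_int r ^ card I *
     fls_nth (occ (shift r (b ` (J - {i} - I)))) (k - 24 * iterate_exponent r (b i)) *
     u powi k * (\<Prod>l\<in>J. t l powi b l))"

definition fiber :: "'i \<Rightarrow> 'i set \<Rightarrow> int \<times> ('i \<Rightarrow> int) \<Rightarrow> int set" where
  "fiber i I = (\<lambda>(k, b). if \<forall>l\<in>I. b l = b i then compat (b i) else {})"

text \<open>Assembles the exponents on J from the common site j of \<open>insert i I\<close> and
  from sites on R that had been translated by r. The value \<open>undefined\<close> elsewhere is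
  that of functions in \<open>PiE\<close>.\<close>

definition glue :: "'i \<Rightarrow> 'i set \<Rightarrow> 'i set \<Rightarrow> int \<Rightarrow> int \<Rightarrow> ('i \<Rightarrow> int) \<Rightarrow> 'i \<Rightarrow> int" where
  "glue i I R r j b = (\<lambda>l. if l \<in> insert i I then j else if l \<in> R then b l - r else undefined)"

text \<open>For fixed I the sites of \<open>insert i I\<close> agree, and the others are translated
  by r in the coefficient. Expressed in the translated sites, the triple (k, b, r) falls apart into
  a pair (r, j), which runs through the expansion of \<open>lerch\<close>, and a free index of the
  series for R. Undoing the translation on R produces y^(-r), and undoing the shift of k the power
  of q.\<close>

lemma has_sum_fiber_term:
  assumes J: "finite J" "i \<in> J" "I \<subseteq> J - {i}" and t: "in_domain J t"
    and S: "(phi_term t (J - {i} - I) has_sum S) (terms_index (J - {i} - I))"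
  shows "((\<lambda>(p, r). fiber_term t J i I p r) has_sum
      lerch (card I) (\<Prod>l\<in>insert i I. t l) (\<Prod>l\<in>J - {i} - I. t l) * S)
    (Sigma (terms_index J) (fiber i I))"
proof -
  define R where "R = J - {i} - I"
  define x where "x = (\<Prod>l\<in>insert i I. t l)"
  define y where "y = (\<Prod>l\<in>R. t l)"
  have R: "R = J - insert i I" "insert i I \<subseteq> J" "insert i I \<noteq> {}" "finite R"
    using J by (auto simp: R_def)
  note dom = in_domain_split[OF t J(1) R(2,3), folded R(1) x_def]
  have tnz: "t l \<noteq> 0" if "l \<in> J" for l
    using t that by (auto simp: in_domain_def)
  have y0: "y \<noteq> 0"
    unfolding y_def using tnz R by auto
  have prod: "(\<Prod>l\<in>J. t l powi glue i I R r j b l) = x powi j * y powi (- r) * (\<Prod>l\<in>R. t l powi b l)" for r j b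
  proof -
    have "(\<Prod>l\<in>J. t l powi glue i I R r j b l) =
        (\<Prod>l\<in>insert i I. t l powi glue i I R r j b l) * (\<Prod>l\<in>R. t l powi glue i I R r j b l)"
      unfolding R(1) using prod.subset_diff[OF R(2) J(1)] by (simp add: mult.commute)
    also have "(\<Prod>l\<in>insert i I. t l powi glue i I R r j b l) = (\<Prod>l\<in>insert i I. t l powi j)"
      by (intro prod.cong) (auto simp: glue_def)
    also have "(\<Prod>l\<in>R. t l powi glue i I R r j b l) = (\<Prod>l\<in>R. t l powi (- r) * t l powi b l)"
    proof (intro prod.cong refl)
      fix l assume l: "l \<in> R"
      then have "glue i I R r j b l = - r + b l" "t l \<noteq> 0"
        using R tnz by (auto simp: glue_def)
      then show "t l powi glue i I R r j b l = t l powi (- r) * t l powi b l"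
        by (metis power_int_add)
    qed
    finally show ?thesis
      by (simp add: prod.distrib prod_power_int x_def y_def)
  qed
  have img: "shift r (glue i I R r j b ` R) = b ` R" for r j b
  proof -
    have "glue i I R r j b ` R = (\<lambda>l. b l - r) ` R"
      by (rule image_cong) (auto simp: glue_def R)
    then show ?thesis
      by (simp add: shift_def image_image)
  qed
  have gi: "glue i I R r j b l = j" if "l \<in> insert i I" for r j b l
    using that by (simp add: glue_def)
  have "((\<lambda>(s, p). expansion_term (card I) x y s * phi_term t R p) has_sum lerch (card I) x y * S)
      (Sigma UNIV compat_sites \<times> terms_index R)"
    using has_sum_expansion[OF dom(1,2) y0] S unfolding R_def by (rule has_sum_times)
  also have "?this \<longleftrightarrow> ((\<lambda>(p, r). fiber_term t J i I p r) has_sum lerch (card I) x y * S)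
      (Sigma (terms_index J) (fiber i I))"
  proof (rule has_sum_reindex_bij_witness[where
        j = "\<lambda>((r, j), (k, b)). ((k + 24 * iterate_exponent r j, glue i I R r j b), r)" and
        i = "\<lambda>((k, b), r). ((r, b i), (k - 24 * iterate_exponent r (b i), \<lambda>l. if l \<in> R then b l + r else undefined))"],
      goal_cases)
    case (1 a)
    obtain r j k b where a: "a = ((r, j), (k, b))"
      by (metis surj_pair)
    have "b l = undefined" if "l \<notin> R" for l
      using 1 that by (auto simp: a PiE_def extensional_def)
    then have "(\<lambda>l. if l \<in> R then glue i I R r j b l + r else undefined) = b"
      by (auto simp: glue_def R)
    then show ?case
      by (simp add: a gi)
  next
    case (2 a)
    obtain r j k b where a: "a = ((r, j), (k, b))"
      by (metis surj_pair)
    have "glue i I R r j b \<in> PiE J (\<lambda>_. UNIV)"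
      using R by (auto simp: glue_def PiE_def extensional_def)
    moreover have "r \<in> compat j"
      using 2 by (simp add: a compat_sites_def)
    ultimately show ?case
      by (simp add: a fiber_def gi)
  next
    case (3 c)
    obtain k b r where c: "c = ((k, b), r)"
      by (metis surj_pair)
    have I: "\<forall>l\<in>I. b l = b i"
      using 3 by (auto simp: c fiber_def split: if_splits)
    have "b l = undefined" if "l \<notin> J" for l
      using 3 that by (auto simp: c PiE_def extensional_def)
    then have "glue i I R r (b i) (\<lambda>l. if l \<in> R then b l + r else undefined) = b"
      using I R by (auto simp: glue_def fun_eq_iff)
    then show ?case
      by (simp add: c)
  next
    case (4 c)
    obtain k b r where c: "c = ((k, b), r)"
      by (metis surj_pair)
    have "r \<in> compat (b i)"
      using 4 by (auto simp: c fiber_def split: if_splits)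
    then show ?case
      by (simp add: c compat_sites_def PiE_def extensional_def)
  next
    case (5 a)
    obtain r j k b where a: "a = ((r, j), (k, b))"
      by (metis surj_pair)
    have "u powi (k + 24 * iterate_exponent r j) = u powi k * q powi iterate_exponent r j"
      using u_nonzero by (simp add: power_int_add u_powi)
    then show ?case
      unfolding a by (simp add: fiber_term_def phi_term_def expansion_term_def gi prod img R_def[symmetric] mult_ac)
  qed simp
  finally show ?thesis
    unfolding x_def y_def R_def .
qed

lemma fiber_term_eq_0:
  assumes "r \<in> compat (b i)" "\<bar>r\<bar> > k"
  shows "fiber_term t J i I (k, b) r = 0"
  using nth_occ_compat_eq_0[OF assms] by (simp add: fiber_term_def)

text \<open>Each family for fixed I is summable over (k, b, r) jointly, so r may be summed out
  first. Adding up over I then restores the coefficient of G by \<open>occ_coefficient\<close>,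
  because only those I contribute on which b has the value \<open>b i\<close>.\<close>

lemma has_sum_phi_term_step:
  assumes J: "finite J" "i \<in> J" and t: "in_domain J t"
    and S: "\<And>I. I \<subseteq> J - {i} \<Longrightarrow> (phi_term t (J - {i} - I) has_sum S I) (terms_index (J - {i} - I))"
  shows "(phi_term t J has_sum (\<Sum>I\<in>Pow (J - {i}).
      lerch (card I) (\<Prod>l\<in>insert i I. t l) (\<Prod>l\<in>J - {i} - I. t l) * S I)) (terms_index J)"
proof -
  \<comment> \<open>Beyond |k| + 1 steps the coefficient at k vanishes, so the sum over r is finite;
    this bound also meets the two conditions on N in \<open>occ_coefficient\<close>.\<close>
  let ?W = "\<lambda>k b. compat (b i) \<inter> {- (\<bar>k\<bar> + 1)..\<bar>k\<bar> + 1}"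
  define psi :: "_ \<Rightarrow> int \<times> _ \<Rightarrow> complex" where "psi = (\<lambda>I (k, b). if \<forall>l\<in>I. b l = b i then
      (\<Sum>r\<in>?W k b. fiber_term t J i I (k, b) r) else 0)"
  have psi: "(psi I has_sum lerch (card I) (\<Prod>l\<in>insert i I. t l) (\<Prod>l\<in>J - {i} - I. t l) * S I)
      (terms_index J)" if I: "I \<subseteq> J - {i}" for I
  proof (rule has_sum_SigmaD[OF has_sum_fiber_term[OF J I t S[OF I]]])
    fix p :: "int \<times> ('a \<Rightarrow> int)"
    obtain k b where p: "p = (k, b)"
      by (metis surj_pair)
    show "((\<lambda>r. case (p, r) of (p, r) \<Rightarrow> fiber_term t J i I p r) has_sum psi I p) (fiber i I p)"
    proof (cases "\<forall>l\<in>I. b l = b i")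
      case True
      have "((\<lambda>r. fiber_term t J i I (k, b) r) has_sum psi I (k, b)) (compat (b i))"
      proof (rule has_sum_finite_neutralI)
        show "finite (?W k b)"
          by simp
        show "fiber_term t J i I (k, b) r = 0" if "r \<in> compat (b i) - ?W k b" for r
          using that by (intro fiber_term_eq_0) auto
        show "psi I (k, b) = (\<Sum>r\<in>?W k b. fiber_term t J i I (k, b) r)"
          using True by (simp add: psi_def)
      qed auto
      moreover have "fiber i I (k, b) = compat (b i)"
        using True by (simp add: fiber_def)
      ultimately show ?thesis
        by (simp add: p)
    next
      case False
      then have "fiber i I (k, b) = {}" "psi I (k, b) = 0"
        by (auto simp: fiber_def psi_def)
      then show ?thesis
        by (simp add: p)
    qed
  qed
  have "((\<lambda>p. \<Sum>I\<in>Pow (J - {i}). psi I p) has_sum (\<Sum>I\<in>Pow (J - {i}).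
      lerch (card I) (\<Prod>l\<in>insert i I. t l) (\<Prod>l\<in>J - {i} - I. t l) * S I)) (terms_index J)"
    using psi by (intro has_sum_sum) auto
  moreover have "(\<Sum>I\<in>Pow (J - {i}). psi I p) = phi_term t J p" for p
  proof -
    obtain k b where p: "p = (k, b)"
      by (metis surj_pair)
    let ?I0 = "{l \<in> J - {i}. b l = b i}"
    have "(\<Sum>I\<in>Pow (J - {i}). psi I p) = (\<Sum>I\<in>Pow ?I0. \<Sum>r\<in>?W k b. fiber_term t J i I (k, b) r)"
    proof (rule sum.mono_neutral_cong_right)
      show "finite (Pow (J - {i}))" "Pow ?I0 \<subseteq> Pow (J - {i})"
        using J by auto
      show "\<forall>I\<in>Pow (J - {i}) - Pow ?I0. psi I p = 0"
        by (auto simp: psi_def p)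
      show "psi I p = (\<Sum>r\<in>?W k b. fiber_term t J i I (k, b) r)" if "I \<in> Pow ?I0" for I
        using that by (auto simp: psi_def p)
    qed
    also have "\<dots> = (\<Sum>r\<in>?W k b. \<Sum>I\<in>Pow ?I0. fiber_term t J i I (k, b) r)"
      by (rule sum.swap)
    also have "\<dots> = fls_nth (occ (b ` J)) k * (u powi k * (\<Prod>l\<in>J. t l powi b l))"
    proof -
      have "fls_nth (occ (b ` J)) k = (\<Sum>r\<in>?W k b. \<Sum>I\<in>Pow ?I0. dir_sign (b i) * sign r * of_int r ^ card I *
          fls_nth (occ (shift r (b ` (J - {i} - I)))) (k - 24 * iterate_exponent r (b i)))"
        by (rule occ_coefficient[OF J]) auto
      then show ?thesis
        by (simp only: sum_distrib_right fiber_term_def prod.case mult.assoc)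
    qed
    finally show ?thesis
      by (simp add: phi_term_def p mult.assoc)
  qed
  ultimately show ?thesis
    by simp
qed

lemma has_sum_phi_term_empty: "(phi_term t {} has_sum 1) (terms_index {})"
proof (rule has_sum_finite_neutralI)
  show "1 = (\<Sum>p\<in>{(0, \<lambda>_. undefined)}. phi_term t {} p)"
    by (simp add: phi_term_def)
qed (auto simp: phi_term_def split: if_splits)

end

section \<open>Meromorphic continuation\<close>

type_synonym 'm point = "(complex ^ 'm) \<times> complex"

section \<open>Complex differentiability in several variables and normal convergence\<close>

definition cscale :: "complex \<Rightarrow> 'm::finite point \<Rightarrow> 'm point" where
  "cscale c h = (c *s fst h, c * snd h)"

definition complex_differentiable_at :: "('m::finite point \<Rightarrow> complex) \<Rightarrow> 'm point \<Rightarrow> bool" where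
  "complex_differentiable_at f p \<longleftrightarrow>
     (\<exists>f'. (f has_derivative f') (at p) \<and> (\<forall>c h. f' (cscale c h) = c * f' h))"

lemma multi_holomorphic_on_iff:
  "multi_holomorphic_on f U \<longleftrightarrow> open U \<and> (\<forall>p\<in>U. complex_differentiable_at f p)"
  by (simp add: multi_holomorphic_on_def complex_differentiable_at_def cscale_def)

lemma norm_cscale: "norm (cscale c h) = norm c * norm (h :: 'm::finite point)"
proof -
  have v: "norm (c *s v) = norm c * norm v" for v :: "complex ^ 'm"
    by (simp add: norm_vec_def norm_mult L2_set_right_distrib[symmetric])
  have "norm (cscale c h) = sqrt ((norm c)\<^sup>2 * ((norm (fst h))\<^sup>2 + (norm (snd h))\<^sup>2))"
    by (simp add: cscale_def norm_Pair v norm_mult power_mult_distrib distrib_left)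
  also have "\<dots> = norm c * norm h"
    by (simp add: real_sqrt_mult norm_prod_def)
  finally show ?thesis .
qed

lemma bounded_linear_cscale_left: "bounded_linear (\<lambda>c. cscale c (h :: 'm::finite point))"
proof (rule bounded_linear_intro[where K = "norm h"])
  show "cscale (c + d) h = cscale c h + cscale d h" for c d
    by (simp add: cscale_def vec_eq_iff distrib_right)
  show "cscale (r *\<^sub>R c) h = r *\<^sub>R cscale c h" for r c
    by (simp add: cscale_def vec_eq_iff)
  show "norm (cscale c h) \<le> norm c * norm h" for c
    by (simp add: norm_cscale)
qed

lemma complex_differentiable_atE:
  assumes "complex_differentiable_at f p"
  obtains f' where "(f has_derivative f') (at p)" "\<And>c h. f' (cscale c h) = c * f' h"
  using assms unfolding complex_differentiable_at_def by blast

lemma complex_differentiable_atI: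
  assumes "(f has_derivative f') (at p)" "\<And>c h. f' (cscale c h) = c * f' h"
  shows "complex_differentiable_at f p"
  using assms unfolding complex_differentiable_at_def by blast

lemma complex_differentiable_at_imp_isCont: "complex_differentiable_at f p \<Longrightarrow> isCont f p"
  by (erule complex_differentiable_atE) (rule has_derivative_continuous)

lemma complex_differentiable_at_transform:
  assumes "complex_differentiable_at f p" "open U" "p \<in> U" "\<And>z. z \<in> U \<Longrightarrow> f z = g z"
  shows "complex_differentiable_at g p"
  using assms(1)
proof (rule complex_differentiable_atE)
  fix f' assume f': "(f has_derivative f') (at p)" "\<And>c h. f' (cscale c h) = c * f' h"
  show ?thesis
    by (rule complex_differentiable_atI[OF has_derivative_transform_within_open[OF f'(1) assms(2-4)] f'(2)])
qed

lemma complex_differentiable_at_const [simp]: "complex_differentiable_at (\<lambda>_. c) p"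
  by (rule complex_differentiable_atI[OF has_derivative_const]) simp

lemma complex_differentiable_at_add:
  assumes "complex_differentiable_at f p" "complex_differentiable_at g p"
  shows "complex_differentiable_at (\<lambda>z. f z + g z) p"
proof -
  obtain f' g' where "(f has_derivative f') (at p)" "\<And>c h. f' (cscale c h) = c * f' h"
    "(g has_derivative g') (at p)" "\<And>c h. g' (cscale c h) = c * g' h"
    using assms by (meson complex_differentiable_atE)
  then show ?thesis
    by (intro complex_differentiable_atI[OF has_derivative_add]) (auto simp: algebra_simps)
qed

lemma complex_differentiable_at_mult:
  assumes "complex_differentiable_at f p" "complex_differentiable_at g p"
  shows "complex_differentiable_at (\<lambda>z. f z * g z) p"
proof -
  obtain f' g' where "(f has_derivative f') (at p)" "\<And>c h. f' (cscale c h) = c * f' h"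
    "(g has_derivative g') (at p)" "\<And>c h. g' (cscale c h) = c * g' h"
    using assms by (meson complex_differentiable_atE)
  then show ?thesis
    by (intro complex_differentiable_atI[OF has_derivative_mult]) (auto simp: algebra_simps)
qed

lemma complex_differentiable_at_inverse:
  assumes "complex_differentiable_at f p" "f p \<noteq> 0"
  shows "complex_differentiable_at (\<lambda>z. inverse (f z)) p"
proof -
  obtain f' where "(f has_derivative f') (at p)" "\<And>c h. f' (cscale c h) = c * f' h"
    using assms by (meson complex_differentiable_atE)
  then show ?thesis
    using assms(2) by (intro complex_differentiable_atI[OF Deriv.has_derivative_inverse]) auto
qed

lemma complex_differentiable_at_divide:
  assumes "complex_differentiable_at f p" "complex_differentiable_at g p" "g p \<noteq> 0"
  shows "complex_differentiable_at (\<lambda>z. f z / g z) p"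
  unfolding divide_inverse
  by (intro complex_differentiable_at_mult complex_differentiable_at_inverse assms)

lemma complex_differentiable_at_diff:
  assumes "complex_differentiable_at f p" "complex_differentiable_at g p"
  shows "complex_differentiable_at (\<lambda>z. f z - g z) p"
  using complex_differentiable_at_add[OF assms(1) complex_differentiable_at_mult[OF complex_differentiable_at_const assms(2)], of "-1"]
  by simp

lemma complex_differentiable_at_prod:
  assumes "\<And>i. i \<in> I \<Longrightarrow> complex_differentiable_at (f i) p"
  shows "complex_differentiable_at (\<lambda>z. \<Prod>i\<in>I. f i z) p"
  using assms
  by (induction I rule: infinite_finite_induct) (simp_all add: complex_differentiable_at_mult)

lemma complex_differentiable_at_power:
  assumes "complex_differentiable_at f p"
  shows "complex_differentiable_at (\<lambda>z. f z ^ n) p"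
  by (induction n) (simp_all add: assms complex_differentiable_at_mult)

lemma complex_differentiable_at_powi:
  assumes "complex_differentiable_at f p" "f p \<noteq> 0"
  shows "complex_differentiable_at (\<lambda>z. f z powi n) p"
  unfolding power_int_def
  by (cases "n \<ge> 0")
    (simp_all add: assms complex_differentiable_at_power complex_differentiable_at_inverse)

lemma complex_differentiable_at_nth: "complex_differentiable_at (\<lambda>z. fst z $ l) p"
proof (rule complex_differentiable_atI)
  show "((\<lambda>z. fst z $ l) has_derivative (\<lambda>z. fst z $ l)) (at p)"
    by (intro bounded_linear_imp_has_derivative bounded_linear_compose[OF bounded_linear_vec_nth]
        bounded_linear_fst)
qed (simp add: cscale_def)

lemma complex_differentiable_at_snd: "complex_differentiable_at snd p"
  by (rule complex_differentiable_atI[OF bounded_linear_imp_has_derivative[OF bounded_linear_snd]])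
    (simp add: cscale_def)

text \<open>Cauchy's estimate on the complex line through \<open>x\<close> in direction \<open>h\<close>.\<close>

lemma derivative_bound:
  assumes f: "\<And>z. z \<in> ball p \<rho> \<Longrightarrow> complex_differentiable_at f z"
    and M: "\<And>z. z \<in> ball p \<rho> \<Longrightarrow> norm (f z) \<le> M"
    and x: "x \<in> ball p (\<rho> / 2)"
    and f': "(f has_derivative f') (at x)" "\<And>c h. f' (cscale c h) = c * f' h"
  shows "norm (f' h) \<le> 4 / \<rho> * M * norm h"
proof (cases "h = 0")
  case True
  have "f' (cscale 0 h) = 0"
    by (simp add: f'(2))
  moreover have "cscale 0 h = h"
    using True by (simp add: cscale_def zero_prod_def)
  ultimately show ?thesis
    using True by simp
next
  case False
  have \<rho>: "\<rho> > 0"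
    using x by (metis ball_eq_empty empty_iff half_gt_zero_iff not_le)
  \<comment> \<open>For |zeta| < 2R the displacement along h is shorter than rho/2, so the line
    stays in the ball around p. Cauchy's inequality on radius R then gives the constant
    4/rho.\<close>
  define R where "R = \<rho> / (4 * norm h)"
  have R: "R > 0"
    using \<rho> False by (simp add: R_def)
  define g where "g = (\<lambda>\<zeta>. f (x + cscale \<zeta> h))"
  have inball: "x + cscale \<zeta> h \<in> ball p \<rho>" if "norm \<zeta> < 2 * R" for \<zeta>
  proof -
    have "norm (cscale \<zeta> h) < \<rho> / 2"
      using that False by (simp add: norm_cscale R_def field_simps)
    moreover have "dist p (x + cscale \<zeta> h) \<le> dist p x + norm (cscale \<zeta> h)"
      by (metis dist_triangle dist_norm add_diff_cancel_left' dist_commute)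
    ultimately show ?thesis
      using x by simp
  qed
  have line: "((\<lambda>\<zeta>. x + cscale \<zeta> h) has_derivative (\<lambda>\<zeta>. cscale \<zeta> h)) (at \<zeta>)" for \<zeta>
    using has_derivative_add[OF has_derivative_const
        bounded_linear_imp_has_derivative[OF bounded_linear_cscale_left]] by simp
  have deriv: "(g has_field_derivative F h) (at \<zeta>)"
    if "(f has_derivative F) (at (x + cscale \<zeta> h))" "\<And>c h. F (cscale c h) = c * F h" for F \<zeta>
  proof -
    have "(g has_derivative (\<lambda>d. F (cscale d h))) (at \<zeta>)"
      unfolding g_def using has_derivative_compose[OF line that(1)] .
    moreover have "(\<lambda>d. F (cscale d h)) = (*) (F h)"
      by (simp add: that(2) fun_eq_iff)
    ultimately show ?thesis
      by (simp only: has_field_derivative_def)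
  qed
  have "g field_differentiable at \<zeta>" if "norm \<zeta> < 2 * R" for \<zeta>
    using f[OF inball[OF that]] deriv unfolding field_differentiable_def
    by (meson complex_differentiable_atE)
  then have hol: "g holomorphic_on ball 0 (2 * R)"
    by (auto simp: holomorphic_on_def intro: field_differentiable_at_within)
  have "norm ((deriv ^^ 1) g 0) \<le> fact 1 * M / R ^ 1"
  proof (rule Cauchy_inequality)
    show "g holomorphic_on ball 0 R"
      using hol R by (rule_tac holomorphic_on_subset) auto
    show "continuous_on (cball 0 R) g"
      using hol R by (intro holomorphic_on_imp_continuous_on holomorphic_on_subset[OF hol]) auto
    show "norm (g \<zeta>) \<le> M" if "norm (0 - \<zeta>) = R" for \<zeta>
      unfolding g_def using that R by (intro M inball) auto
  qed (rule R)
  moreover have "deriv g 0 = f' h"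
  proof -
    have "x + cscale 0 h = x"
      by (simp add: cscale_def zero_prod_def[symmetric])
    then show ?thesis
      using deriv[of f' 0] f' by (intro DERIV_imp_deriv) simp
  qed
  ultimately show ?thesis
    by (simp add: R_def field_simps)
qed

text \<open>Weierstrass' theorem: on the half ball the derivative bound majorizes the derivatives by
  a convergent series, so termwise differentiation is allowed and complex homogeneity passes to the
  limit.\<close>

lemma complex_differentiable_at_suminf:
  assumes f: "\<And>n z. z \<in> ball p \<rho> \<Longrightarrow> complex_differentiable_at (f n) z"
    and M: "\<And>n z. z \<in> ball p \<rho> \<Longrightarrow> norm (f n z) \<le> M n" and "summable M"
    and x: "x \<in> ball p (\<rho> / 2)"
  shows "complex_differentiable_at (\<lambda>z. suminf (\<lambda>n. f n z)) x"
proof -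
  let ?S = "ball p (\<rho> / 2)"
  have \<rho>: "\<rho> > 0"
    using x by (metis ball_eq_empty empty_iff half_gt_zero_iff not_le)
  have sub: "z \<in> ball p \<rho>" if "z \<in> ?S" for z
    using that \<rho> by simp
  define F where "F = (\<lambda>n z. SOME F. (f n has_derivative F) (at z) \<and> (\<forall>c h. F (cscale c h) = c * F h))"
  have "(f n has_derivative F n z) (at z) \<and> (\<forall>c h. F n z (cscale c h) = c * F n z h)"
    if "z \<in> ?S" for n z
    unfolding F_def using f[OF sub[OF that], of n] unfolding complex_differentiable_at_def by (rule someI_ex)
  then have F: "\<And>n z. z \<in> ?S \<Longrightarrow> (f n has_derivative F n z) (at z)"
    "\<And>n z c h. z \<in> ?S \<Longrightarrow> F n z (cscale c h) = c * F n z h"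
    by blast+
  have bound: "norm (F n z h) \<le> 4 / \<rho> * M n * norm h" if "z \<in> ?S" for n z h
    using that by (intro derivative_bound[OF f M that F(1) F(2)]) auto
  have sumM: "summable (\<lambda>n. 4 / \<rho> * M n)"
    using \<open>summable M\<close> by (rule summable_mult)
  have sumF: "summable (\<lambda>n. F n z h)" if "z \<in> ?S" for z h
    by (rule summable_comparison_test'[OF summable_mult2[OF sumM, of "norm h"], of 0])
      (use bound[OF that] in simp)
  have sums: "summable (\<lambda>n. f n z)" if "z \<in> ?S" for z
    by (rule summable_comparison_test'[OF \<open>summable M\<close>, of 0]) (use M sub[OF that] in simp)
  have "\<exists>g. \<forall>z\<in>?S. (\<lambda>n. f n z) sums g z \<and> (g has_derivative (\<lambda>h. suminf (\<lambda>n. F n z h))) (at z within ?S)"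
  proof (rule has_derivative_series[of ?S f F])
    fix e :: real assume "e > 0"
    then obtain N where N: "\<And>n. n \<ge> N \<Longrightarrow> norm (suminf (\<lambda>i. 4 / \<rho> * M (i + n))) < e"
      using suminf_exist_split[OF _ sumM] by blast
    show "\<forall>\<^sub>F n in sequentially. \<forall>z\<in>?S. \<forall>h. norm ((\<Sum>i<n. F i z h) - (suminf (\<lambda>i. F i z h))) \<le> e * norm h"
      using eventually_ge_at_top[of N]
    proof eventually_elim
      case (elim n)
      show ?case
      proof (intro ballI allI)
        fix z h assume z: "z \<in> ?S"
        have shift: "summable (\<lambda>i. 4 / \<rho> * M (i + n))"
          using sumM by (subst summable_iff_shift)
        have "(\<Sum>i<n. F i z h) - (suminf (\<lambda>i. F i z h)) = - (suminf (\<lambda>i. F (i + n) z h))"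
          using suminf_split_initial_segment[OF sumF[OF z], of h n] by simp
        then have "norm ((\<Sum>i<n. F i z h) - (suminf (\<lambda>i. F i z h))) = norm (suminf (\<lambda>i. F (i + n) z h))"
          by simp
        also have "\<dots> \<le> (suminf (\<lambda>i. 4 / \<rho> * M (i + n) * norm h))"
          by (rule norm_suminf_le[OF bound[OF z] summable_mult2[OF shift]])
        also have "\<dots> = (suminf (\<lambda>i. 4 / \<rho> * M (i + n))) * norm h"
          by (rule suminf_mult2[OF shift, symmetric])
        also have "\<dots> \<le> e * norm h"
          using N[OF elim] by (intro mult_right_mono) auto
        finally show "norm ((\<Sum>i<n. F i z h) - (suminf (\<lambda>i. F i z h))) \<le> e * norm h" .
      qed
    qed
  next
    show "(f n has_derivative F n z) (at z within ?S)" if "z \<in> ?S" for n z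
      using F(1)[OF that] by (rule has_derivative_at_withinI)
    show "(\<lambda>n. f n x) sums suminf (\<lambda>n. f n x)"
      using sums[OF x] by (rule summable_sums)
  qed (use x in simp_all)
  then obtain g where g: "\<And>z. z \<in> ?S \<Longrightarrow> (\<lambda>n. f n z) sums g z"
    "\<And>z. z \<in> ?S \<Longrightarrow> (g has_derivative (\<lambda>h. suminf (\<lambda>n. F n z h))) (at z within ?S)"
    by blast
  have "(g has_derivative (\<lambda>h. suminf (\<lambda>n. F n x h))) (at x)"
    using g(2)[OF x] at_within_open[OF x open_ball] by simp
  then have "complex_differentiable_at g x"
  proof (rule complex_differentiable_atI)
    show "(suminf (\<lambda>n. F n x (cscale c h))) = c * (suminf (\<lambda>n. F n x h))" for c h
      using suminf_mult[OF sumF[OF x], of c h] F(2)[OF x] by simp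
  qed
  then show ?thesis
    by (rule complex_differentiable_at_transform[OF _ open_ball x]) (use g(1) sums_unique in auto)
qed


definition monomial :: "'m::finite set \<Rightarrow> 'm point \<Rightarrow> complex" where
  "monomial X z = (\<Prod>l\<in>X. fst z $ l)"

lemma complex_differentiable_at_monomial: "complex_differentiable_at (monomial X) p"
  unfolding monomial_def
  by (intro complex_differentiable_at_prod complex_differentiable_at_nth)

section \<open>Local quotients with prescribed polar hypersurfaces\<close>

context nome
begin

definition pole_factor :: "int \<times> 'm::finite set \<Rightarrow> 'm point \<Rightarrow> complex" where
  "pole_factor = (\<lambda>(m, I) z. 1 - q powi m * monomial I z)"

definition denominator :: "(int \<times> 'm::finite set) list \<Rightarrow> 'm point \<Rightarrow> complex" where
  "denominator L z = prod_list (map (\<lambda>f. pole_factor f z) L)"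

lemma complex_differentiable_at_denominator: "complex_differentiable_at (denominator L) p"
  unfolding denominator_def pole_factor_def
  by (induction L)
    (auto intro!: complex_differentiable_at_mult complex_differentiable_at_diff complex_differentiable_at_monomial)

lemma denominator_append: "denominator (L @ L') z = denominator L z * denominator L' z"
  by (simp add: denominator_def)

lemma denominator_eq_0_iff: "denominator L z = 0 \<longleftrightarrow> (\<exists>f\<in>set L. pole_factor f z = 0)"
  by (auto simp: denominator_def prod_list_zero_iff)


definition torus_meromorphic :: "('m::finite point \<Rightarrow> complex) \<Rightarrow> bool" where
  "torus_meromorphic F \<longleftrightarrow> (\<forall>p. (\<forall>l. fst p $ l \<noteq> 0) \<longrightarrow>
     (\<exists>U g L. p \<in> U \<and> multi_holomorphic_on g U \<and> (\<forall>f\<in>set L. snd f \<noteq> {}) \<and>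
        (\<forall>z\<in>U. denominator L z \<noteq> 0 \<longrightarrow> F z = g z / denominator L z)))"

lemma torus_meromorphicD:
  fixes p :: "'m::finite point"
  assumes "torus_meromorphic F" "\<forall>l. fst p $ l \<noteq> 0"
  obtains U g L where "p \<in> U" "multi_holomorphic_on g U" "\<And>f. f \<in> set L \<Longrightarrow> snd f \<noteq> {}"
    "\<And>z. z \<in> U \<Longrightarrow> denominator L z \<noteq> 0 \<Longrightarrow> F z = g z / denominator L z"
proof -
  obtain U g L where "p \<in> U \<and> multi_holomorphic_on g U \<and> (\<forall>f\<in>set L. snd f \<noteq> {}) \<and>
      (\<forall>z\<in>U. denominator L z \<noteq> 0 \<longrightarrow> F z = g z / denominator L z)"
    using assms(1)[unfolded torus_meromorphic_def, THEN spec[of _ p], THEN mp, OF assms(2)]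
    by (elim exE)
  then show ?thesis
    using that[of U g L] by blast
qed

lemma torus_meromorphic_const: "torus_meromorphic (\<lambda>_. c)"
  unfolding torus_meromorphic_def
  by (intro allI impI exI[of _ UNIV] exI[of _ "\<lambda>_. c"] exI[of _ "[]"])
    (auto simp: multi_holomorphic_on_iff denominator_def)

lemma torus_meromorphic_add:
  assumes "torus_meromorphic F" "torus_meromorphic G"
  shows "torus_meromorphic (\<lambda>z. F z + G z)"
  unfolding torus_meromorphic_def
proof (intro allI impI)
  fix p :: "'a point" assume p: "\<forall>l. fst p $ l \<noteq> 0"
  obtain U f L where F: "p \<in> U" "multi_holomorphic_on f U" "\<And>f. f \<in> set L \<Longrightarrow> snd f \<noteq> {}"
    "\<And>z. z \<in> U \<Longrightarrow> denominator L z \<noteq> 0 \<Longrightarrow> F z = f z / denominator L z"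
    using torus_meromorphicD[OF assms(1) p] by blast
  obtain V g L' where G: "p \<in> V" "multi_holomorphic_on g V" "\<And>f. f \<in> set L' \<Longrightarrow> snd f \<noteq> {}"
    "\<And>z. z \<in> V \<Longrightarrow> denominator L' z \<noteq> 0 \<Longrightarrow> G z = g z / denominator L' z"
    using torus_meromorphicD[OF assms(2) p] by blast
  show "\<exists>U g L. p \<in> U \<and> multi_holomorphic_on g U \<and> (\<forall>f\<in>set L. snd f \<noteq> {}) \<and>
        (\<forall>z\<in>U. denominator L z \<noteq> 0 \<longrightarrow> F z + G z = g z / denominator L z)"
  proof (intro exI conjI)
    show "p \<in> U \<inter> V"
      using F G by simp
    show "multi_holomorphic_on (\<lambda>z. f z * denominator L' z + g z * denominator L z) (U \<inter> V)"
      using F(2) G(2) unfolding multi_holomorphic_on_iff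
      by (auto intro!: complex_differentiable_at_add complex_differentiable_at_mult complex_differentiable_at_denominator)
    show "\<forall>f\<in>set (L @ L'). snd f \<noteq> {}"
      using F(3) G(3) by auto
    show "\<forall>z\<in>U \<inter> V. denominator (L @ L') z \<noteq> 0 \<longrightarrow>
        F z + G z = (f z * denominator L' z + g z * denominator L z) / denominator (L @ L') z"
      using F(4) G(4) by (auto simp: denominator_append add_frac_eq)
  qed
qed

lemma torus_meromorphic_mult:
  assumes "torus_meromorphic F" "torus_meromorphic G"
  shows "torus_meromorphic (\<lambda>z. F z * G z)"
  unfolding torus_meromorphic_def
proof (intro allI impI)
  fix p :: "'a point" assume p: "\<forall>l. fst p $ l \<noteq> 0"
  obtain U f L where F: "p \<in> U" "multi_holomorphic_on f U" "\<And>f. f \<in> set L \<Longrightarrow> snd f \<noteq> {}"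
    "\<And>z. z \<in> U \<Longrightarrow> denominator L z \<noteq> 0 \<Longrightarrow> F z = f z / denominator L z"
    using torus_meromorphicD[OF assms(1) p] by blast
  obtain V g L' where G: "p \<in> V" "multi_holomorphic_on g V" "\<And>f. f \<in> set L' \<Longrightarrow> snd f \<noteq> {}"
    "\<And>z. z \<in> V \<Longrightarrow> denominator L' z \<noteq> 0 \<Longrightarrow> G z = g z / denominator L' z"
    using torus_meromorphicD[OF assms(2) p] by blast
  show "\<exists>U g L. p \<in> U \<and> multi_holomorphic_on g U \<and> (\<forall>f\<in>set L. snd f \<noteq> {}) \<and>
        (\<forall>z\<in>U. denominator L z \<noteq> 0 \<longrightarrow> F z * G z = g z / denominator L z)"
  proof (intro exI conjI)
    show "p \<in> U \<inter> V"
      using F G by simp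
    show "multi_holomorphic_on (\<lambda>z. f z * g z) (U \<inter> V)"
      using F(2) G(2) unfolding multi_holomorphic_on_iff
      by (auto intro!: complex_differentiable_at_mult)
    show "\<forall>f\<in>set (L @ L'). snd f \<noteq> {}"
      using F(3) G(3) by auto
    show "\<forall>z\<in>U \<inter> V. denominator (L @ L') z \<noteq> 0 \<longrightarrow> F z * G z = (f z * g z) / denominator (L @ L') z"
      using F(4) G(4) by (auto simp: denominator_append)
  qed
qed

lemma torus_meromorphic_sum:
  assumes "\<And>i. i \<in> I \<Longrightarrow> torus_meromorphic (F i)"
  shows "torus_meromorphic (\<lambda>z. \<Sum>i\<in>I. F i z)"
  using assms
  by (induction I rule: infinite_finite_induct)
    (simp_all add: torus_meromorphic_const torus_meromorphic_add)

lemma norm_q_pos: "0 < norm q"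
  by simp

lemma powi_q_inj:
  assumes "q powi r = q powi r'"
  shows "r = r'"
proof (rule ccontr)
  assume "r \<noteq> r'"
  moreover have "norm q powi r = norm q powi r'"
    using assms by (metis norm_power_int)
  moreover have "norm q powi a < norm q powi b" if "b < a" for a b
    using norm_q that by (intro power_int_strict_decreasing) auto
  ultimately show False
    by (metis less_irrefl linorder_neqE)
qed


text \<open>The powers of q are distinct, so at most one denominator vanishes at p. Of the others,
  finitely many are controlled by continuity; for large |r| the modulus of q^r x is far from 1,
  uniformly near p.\<close>

lemma denominators_bounded_below:
  fixes x y :: "'m::finite point \<Rightarrow> complex"
  assumes cont: "isCont x p" "isCont y p" and nz: "x p \<noteq> 0" "y p \<noteq> 0"
  obtains r0 c D \<rho> where "c > 0" "\<rho> > 0" "D \<ge> 0"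
    "\<And>z r. z \<in> ball p \<rho> \<Longrightarrow> r \<noteq> r0 \<Longrightarrow> c \<le> norm (1 - q powi r * x z)"
    "\<And>z. z \<in> ball p \<rho> \<Longrightarrow> y z \<noteq> 0 \<and> norm (y z) \<le> D \<and> inverse (norm (y z)) \<le> D"
proof -
  obtain r0 where r0: "\<And>r. r \<noteq> r0 \<Longrightarrow> 1 - q powi r * x p \<noteq> 0"
  proof (cases "\<exists>r. 1 - q powi r * x p = 0")
    case True
    then obtain r0 where "1 - q powi r0 * x p = 0"
      by blast
    moreover have "q powi r = q powi r0" if "1 - q powi r * x p = 0" for r
    proof -
      have "q powi r * x p = q powi r0 * x p"
        using that \<open>1 - q powi r0 * x p = 0\<close> by simp
      then show ?thesis
        using nz(1) by simp
    qed
    ultimately show ?thesis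
      using that powi_q_inj by blast
  \<comment> \<open>If no denominator vanishes at p, any integer serves as r0.\<close>
  qed (use that in blast)
  define a where "a = norm (x p)"
  have a: "a > 0"
    using nz by (simp add: a_def)
  have lim: "(\<lambda>n. norm q ^ n) \<longlonglongrightarrow> 0"
    using norm_q by (intro LIMSEQ_realpow_zero) auto
  \<comment> \<open>Near p the modulus of x lies between a/2 and 2a. The bound makes |q^r x| at most
    1/2 for r > N and at least 2 for r < -N, so the distance from 1 is at least 1/2.\<close>
  have "\<forall>\<^sub>F n in sequentially. norm q ^ n < min (1 / (4 * a)) (a / 4)"
    using a by (intro order_tendstoD(2)[OF lim]) auto
  then obtain N where N: "norm q ^ N < min (1 / (4 * a)) (a / 4)"
    by (auto simp: eventually_sequentially)
  define K where "K = {- int N..int N} - {r0}"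
  define c where "c = Min (insert (1/2) ((\<lambda>r. norm (1 - q powi r * x p) / 2) ` K))"
  have c: "c > 0" "c \<le> 1/2" "\<And>r. r \<in> K \<Longrightarrow> c \<le> norm (1 - q powi r * x p) / 2"
  proof -
    have fin: "finite (insert (1/2) ((\<lambda>r. norm (1 - q powi r * x p) / 2) ` K))"
      by (simp add: K_def)
    show "c > 0"
      unfolding c_def using fin r0 by (subst Min_gr_iff) (auto simp: K_def)
    show "c \<le> 1/2" "\<And>r. r \<in> K \<Longrightarrow> c \<le> norm (1 - q powi r * x p) / 2"
      unfolding c_def using fin by (blast intro: Min_le)+
  qed
  have x_tendsto: "(x \<longlongrightarrow> x p) (nhds p)" and y_tendsto: "(y \<longlongrightarrow> y p) (nhds p)"
    using cont by (simp_all add: isCont_def tendsto_at_iff_tendsto_nhds)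
  have "\<forall>\<^sub>F z in nhds p. \<forall>r\<in>K. norm (1 - q powi r * x p) / 2 < norm (1 - q powi r * x z)"
  proof (rule eventually_ball_finite)
    show "finite K"
      by (simp add: K_def)
    show "\<forall>r\<in>K. \<forall>\<^sub>F z in nhds p. norm (1 - q powi r * x p) / 2 < norm (1 - q powi r * x z)"
    proof
      fix r assume "r \<in> K"
      then have "norm (1 - q powi r * x p) / 2 < norm (1 - q powi r * x p)"
        using r0 by (simp add: K_def)
      moreover have "((\<lambda>z. norm (1 - q powi r * x z)) \<longlongrightarrow> norm (1 - q powi r * x p)) (nhds p)"
        by (intro tendsto_intros x_tendsto)
      ultimately show "\<forall>\<^sub>F z in nhds p. norm (1 - q powi r * x p) / 2 < norm (1 - q powi r * x z)"
        by (rule order_tendstoD(1)[rotated])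
    qed
  qed
  moreover have "\<forall>\<^sub>F z in nhds p. norm (x z) < 2 * a"
    by (rule order_tendstoD(2)[OF tendsto_norm[OF x_tendsto]]) (use a in \<open>simp add: a_def\<close>)
  moreover have "\<forall>\<^sub>F z in nhds p. a / 2 < norm (x z)"
    by (rule order_tendstoD(1)[OF tendsto_norm[OF x_tendsto]]) (use a in \<open>simp add: a_def\<close>)
  moreover have "\<forall>\<^sub>F z in nhds p. norm (y z) < 2 * norm (y p)"
    by (rule order_tendstoD(2)[OF tendsto_norm[OF y_tendsto]]) (use nz in simp)
  moreover have "\<forall>\<^sub>F z in nhds p. norm (y p) / 2 < norm (y z)"
    by (rule order_tendstoD(1)[OF tendsto_norm[OF y_tendsto]]) (use nz in simp)
  ultimately have "\<forall>\<^sub>F z in nhds p. (\<forall>r\<in>K. norm (1 - q powi r * x p) / 2 < norm (1 - q powi r * x z)) \<and>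
      norm (x z) < 2 * a \<and> a / 2 < norm (x z) \<and> norm (y z) < 2 * norm (y p) \<and> norm (y p) / 2 < norm (y z)"
    by (intro eventually_conj)
  then obtain \<rho> where \<rho>: "\<rho> > 0" and near: "\<And>z. dist z p < \<rho> \<Longrightarrow>
      (\<forall>r\<in>K. norm (1 - q powi r * x p) / 2 < norm (1 - q powi r * x z)) \<and>
      norm (x z) < 2 * a \<and> a / 2 < norm (x z) \<and> norm (y z) < 2 * norm (y p) \<and> norm (y p) / 2 < norm (y z)"
    unfolding eventually_nhds_metric by blast
  define D where "D = max (2 * norm (y p)) (2 / norm (y p))"
  show ?thesis
  proof (rule that[of c \<rho> D r0])
    show "D \<ge> 0"
      by (simp add: D_def le_max_iff_disj)
    fix z assume "z \<in> ball p \<rho>"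
    then have z: "dist z p < \<rho>"
      by (simp add: dist_commute)
    have y: "norm (y z) < 2 * norm (y p)" "norm (y p) / 2 < norm (y z)"
      using near[OF z] by auto
    have "inverse (norm (y z)) \<le> inverse (norm (y p) / 2)"
      using y nz by (intro le_imp_inverse_le) auto
    also have "inverse (norm (y p) / 2) = 2 / norm (y p)"
      by simp
    also have "\<dots> \<le> D"
      unfolding D_def by (rule max.cobounded2)
    finally have "inverse (norm (y z)) \<le> D" .
    moreover have "2 * norm (y p) \<le> D"
      unfolding D_def by (rule max.cobounded1)
    moreover have "norm (y p) > 0"
      using nz by simp
    then have "y z \<noteq> 0"
      using y by auto
    ultimately show "y z \<noteq> 0 \<and> norm (y z) \<le> D \<and> inverse (norm (y z)) \<le> D"
      using y by linarith
    fix r assume r: "r \<noteq> r0"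
    have xz: "norm (x z) < 2 * a" "a / 2 < norm (x z)"
      using near[OF z] by auto
    have "r \<in> K \<or> r > int N \<or> r < - int N"
      using r by (auto simp: K_def)
    then consider "r \<in> K" | "r > int N" | "r < - int N"
      by blast
    then show "c \<le> norm (1 - q powi r * x z)"
    proof cases
      case 1
      then show ?thesis
        using near[OF z] c(3)[OF 1] by force
    next
      case 2
      have "norm q powi r \<le> norm q powi int N"
        using norm_q 2 by (intro power_int_decreasing) auto
      then have "norm q powi r \<le> 1 / (4 * a)"
        using N by (simp add: less_imp_le)
      then have "norm q powi r * norm (x z) \<le> 1 / (4 * a) * (2 * a)"
        using xz a by (intro mult_mono) auto
      then have "norm (q powi r * x z) \<le> 1 / 2"
        using a by (simp add: norm_mult norm_power_int)
      then show ?thesis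
        using c(2) norm_triangle_ineq2[of 1 "q powi r * x z"] by simp
    next
      case 3
      have "norm q powi (- int N) \<le> norm q powi r"
        using norm_q 3 by (intro power_int_decreasing) auto
      moreover have "4 / a \<le> norm q powi (- int N)"
      proof -
        have "inverse (a / 4) \<le> inverse (norm q ^ N)"
          using N norm_q_pos by (intro le_imp_inverse_le) auto
        then show ?thesis
          by (simp add: power_int_minus)
      qed
      ultimately have "4 / a \<le> norm q powi r"
        by simp
      then have "4 / a * (a / 2) \<le> norm q powi r * norm (x z)"
        using xz a by (intro mult_mono) auto
      then have "norm (q powi r * x z) \<ge> 2"
        using a by (simp add: norm_mult norm_power_int)
      then show ?thesis
        using c(2) norm_triangle_ineq2[of "q powi r * x z" 1] by (simp add: norm_minus_commute)
    qed
  qed (use c \<rho> in auto)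
qed

text \<open>Near p only the term \<open>r0\<close> can be singular, and its denominator is an
  admissible factor because X is nonempty. The remaining terms form a normally convergent series
  with a Gaussian majorant.\<close>

lemma torus_meromorphic_lerch:
  assumes "X \<noteq> {}"
  shows "torus_meromorphic (\<lambda>z. lerch m (monomial X z) (monomial Y z))"
  unfolding torus_meromorphic_def
proof (intro allI impI)
  fix p :: "'a point" assume p: "\<forall>l. fst p $ l \<noteq> 0"
  let ?x = "monomial X" and ?y = "monomial Y"
  have cont: "isCont ?x p" "isCont ?y p"
    by (intro complex_differentiable_at_imp_isCont complex_differentiable_at_monomial)+
  have nz: "?x p \<noteq> 0" "?y p \<noteq> 0"
    using p by (auto simp: monomial_def)
  obtain r0 c D \<rho> where c: "c > 0" and \<rho>: "\<rho> > 0" and D: "D \<ge> 0"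
    and x: "\<And>z r. z \<in> ball p \<rho> \<Longrightarrow> r \<noteq> r0 \<Longrightarrow> c \<le> norm (1 - q powi r * ?x z)"
    and y: "\<And>z. z \<in> ball p \<rho> \<Longrightarrow> ?y z \<noteq> 0 \<and> norm (?y z) \<le> D \<and> inverse (norm (?y z)) \<le> D"
    by (rule denominators_bounded_below[OF cont nz]) (rule that)
  define f where "f = (\<lambda>r z. if r = r0 then 0 else lerch_term m (?x z) (?y z) r)"
  define M where "M = (\<lambda>r. (\<bar>of_int r\<bar> ^ m * norm q powi tri r * D ^ nat \<bar>r\<bar>) / c)"
  have fM: "norm (f r z) \<le> M r" if "z \<in> ball p \<rho>" for r z
  proof (cases "r = r0")
    case True
    then show ?thesis
      using c D by (simp add: f_def M_def)
  next
    case False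
    then show ?thesis
      using norm_lerch_term_le[of "?y z" D c r "?x z" m] y[OF that] x[OF that False] c
      by (simp add: f_def M_def)
  qed
  have "M summable_on UNIV"
    unfolding M_def by (rule summable_lerch_bound[OF D])
  \<comment> \<open>The integers are enumerated because termwise differentiation is stated for
    series over the natural numbers.\<close>
  then have "(\<lambda>n. M (int_decode n)) summable_on UNIV"
    using summable_on_reindex_bij_betw[OF bij_int_decode, of M] by simp
  then have sumM: "summable (\<lambda>n. M (int_decode n))"
    by (rule summable_on_imp_summable)
  have cd: "complex_differentiable_at (f r) z" if "z \<in> ball p \<rho>" for r z
  proof (cases "r = r0")
    case False
    have d: "1 - q powi r * ?x z \<noteq> 0"
      using x[OF that False] c by auto
    have y0: "?y z \<noteq> 0"
      using y[OF that] by blast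
    have "complex_differentiable_at (\<lambda>z. lerch_term m (?x z) (?y z) r) z"
      unfolding lerch_term_def
      by (rule complex_differentiable_at_divide
          [OF complex_differentiable_at_mult
            [OF complex_differentiable_at_const
              complex_differentiable_at_powi[OF complex_differentiable_at_monomial y0]]
            complex_differentiable_at_diff
            [OF complex_differentiable_at_const
              complex_differentiable_at_mult[OF complex_differentiable_at_const complex_differentiable_at_monomial]]
            d])
    then show ?thesis
      using False by (simp add: f_def)
  qed (simp add: f_def)
  define T where "T = (\<lambda>z. suminf (\<lambda>n. f (int_decode n) z))"
  have T: "complex_differentiable_at T z" if z: "z \<in> ball p (\<rho> / 2)" for z
  proof -
    have 1: "complex_differentiable_at (f (int_decode n)) w" if "w \<in> ball p \<rho>" for n w
      using that by (rule cd)
    have 2: "norm (f (int_decode n) w) \<le> M (int_decode n)" if "w \<in> ball p \<rho>" for n w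
      using that by (rule fM)
    show ?thesis
      unfolding T_def
      by (rule complex_differentiable_at_suminf[where p = p and \<rho> = \<rho> and M = "\<lambda>n. M (int_decode n)"])
        (fact 1, fact 2, fact sumM, fact z)
  qed
  have has_sum_f: "((\<lambda>r. f r z) has_sum T z) UNIV" if "z \<in> ball p \<rho>" for z
  proof -
    have summable: "summable (\<lambda>n. norm (f (int_decode n) z))"
      by (rule summable_comparison_test'[OF sumM, of 0]) (use fM[OF that] in simp)
    have "((\<lambda>n. f (int_decode n) z) has_sum T z) UNIV"
      unfolding T_def
      by (rule norm_summable_imp_has_sum[OF summable summable_sums[OF summable_norm_cancel[OF summable]]])
    then show ?thesis
      using has_sum_reindex_bij_betw[OF bij_int_decode, of "\<lambda>r. f r z"] by simp
  qed
  define num where "num = (\<lambda>z. - sign r0 * of_int r0 ^ m * q powi tri r0 * ?y z powi (- r0))"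
  define g where "g = (\<lambda>z. num z + (1 - q powi r0 * ?x z) * T z)"
  have sub: "z \<in> ball p \<rho>" if "z \<in> ball p (\<rho> / 2)" for z
    using that \<rho> by simp
  have hol: "multi_holomorphic_on g (ball p (\<rho> / 2))"
    unfolding multi_holomorphic_on_iff
  proof (intro conjI ballI open_ball)
    fix z assume z: "z \<in> ball p (\<rho> / 2)"
    then have y0: "?y z \<noteq> 0"
      using y[OF sub[OF z]] by blast
    have "complex_differentiable_at num z"
      unfolding num_def
      by (rule complex_differentiable_at_mult[OF complex_differentiable_at_const
            complex_differentiable_at_powi[OF complex_differentiable_at_monomial y0]])
    moreover have "complex_differentiable_at (\<lambda>z. 1 - q powi r0 * ?x z) z"
      by (rule complex_differentiable_at_diff[OF complex_differentiable_at_const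
            complex_differentiable_at_mult[OF complex_differentiable_at_const complex_differentiable_at_monomial]])
    ultimately show "complex_differentiable_at g z"
      unfolding g_def using T[OF z] by (intro complex_differentiable_at_add complex_differentiable_at_mult)
  qed
  have eq: "lerch m (?x z) (?y z) = g z / denominator [(r0, X)] z"
    if z: "z \<in> ball p (\<rho> / 2)" and nonzero: "denominator [(r0, X)] z \<noteq> 0" for z
  proof -
    have den: "denominator [(r0, X)] z = 1 - q powi r0 * ?x z"
      by (simp add: denominator_def pole_factor_def)
    have d: "1 - q powi r0 * ?x z \<noteq> 0"
      using nonzero unfolding den .
    have first: "((\<lambda>r. if r = r0 then lerch_term m (?x z) (?y z) r0 else 0) has_sum lerch_term m (?x z) (?y z) r0) UNIV"
      by (rule has_sum_finite_neutralI[of "{r0}"]) auto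
    have split: "(\<lambda>r. (if r = r0 then lerch_term m (?x z) (?y z) r0 else 0) + f r z) =
        lerch_term m (?x z) (?y z)"
      by (simp add: f_def fun_eq_iff)
    have "(lerch_term m (?x z) (?y z) has_sum lerch_term m (?x z) (?y z) r0 + T z) UNIV"
      using has_sum_add[OF first has_sum_f[OF sub[OF z]]] unfolding split .
    then have "lerch m (?x z) (?y z) = lerch_term m (?x z) (?y z) r0 + T z"
      unfolding lerch_def by (rule infsumI)
    also have "\<dots> = num z / (1 - q powi r0 * ?x z) + T z"
      by (simp only: lerch_term_def num_def)
    also have "\<dots> = g z / (1 - q powi r0 * ?x z)"
      unfolding g_def by (simp only: add_divide_distrib nonzero_mult_div_cancel_left[OF d])
    finally show ?thesis
      unfolding den .
  qed
  show "\<exists>U g L. p \<in> U \<and> multi_holomorphic_on g U \<and> (\<forall>f\<in>set L. snd f \<noteq> {}) \<and>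
        (\<forall>z\<in>U. denominator L z \<noteq> 0 \<longrightarrow> lerch m (?x z) (?y z) = g z / denominator L z)"
  proof (rule exI[of _ "ball p (\<rho> / 2)"], rule exI[of _ g], rule exI[of _ "[(r0, X)]"], intro conjI ballI impI)
    show "p \<in> ball p (\<rho> / 2)"
      using \<rho> by simp
    show "snd f \<noteq> {}" if "f \<in> set [(r0, X)]" for f
      using assms that by simp
  qed (fact hol, fact eq)
qed


text \<open>Strong induction on J: removing i together with a subset I leaves a proper subset, whose
  continuation is multiplied by an Appell-Lerch sum. Both factors make sense on the whole torus,
  unlike the series.\<close>

lemma exists_torus_meromorphic_sum:
  fixes J :: "'m::finite set"
  shows "\<exists>F. torus_meromorphic F \<and> (\<forall>z. in_domain J (($) (fst z)) \<longrightarrow>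
     (phi_term (($) (fst z)) J has_sum F z) (terms_index J))"
proof (induction J rule: finite_psubset_induct[OF finite])
  case (1 J)
  show ?case
  proof (cases "J = {}")
    case True
    have "torus_meromorphic (\<lambda>_ :: 'm point. 1)"
      by (rule torus_meromorphic_const)
    moreover have "(phi_term (($) (fst z)) J has_sum 1) (terms_index J)" for z :: "'m point"
      unfolding True by (rule has_sum_phi_term_empty)
    ultimately show ?thesis
      by (intro exI[of _ "\<lambda>_. 1"]) blast
  next
    case False
    then obtain i where i: "i \<in> J"
      by blast
    \<comment> \<open>One continuation is fixed for each proper subset, independently of z.\<close>
    define H :: "'m set \<Rightarrow> 'm point \<Rightarrow> complex" where "H = (\<lambda>R. SOME F. torus_meromorphic F \<and> (\<forall>z. in_domain R (($) (fst z)) \<longrightarrow>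
      (phi_term (($) (fst z)) R has_sum F z) (terms_index R)))"
    have H: "torus_meromorphic (H (J - {i} - I)) \<and> (\<forall>z. in_domain (J - {i} - I) (($) (fst z)) \<longrightarrow>
      (phi_term (($) (fst z)) (J - {i} - I) has_sum H (J - {i} - I) z) (terms_index (J - {i} - I)))" for I
      unfolding H_def using i by (intro someI_ex[OF 1(2)]) blast
    define F :: "'m point \<Rightarrow> complex" where "F = (\<lambda>z. \<Sum>I\<in>Pow (J - {i}). lerch (card I) (monomial (insert i I) z)
      (monomial (J - {i} - I) z) * H (J - {i} - I) z)"
    have "torus_meromorphic F"
      unfolding F_def using H
      by (intro torus_meromorphic_sum torus_meromorphic_mult torus_meromorphic_lerch) auto
    moreover have "(phi_term (($) (fst z)) J has_sum F z) (terms_index J)"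
      if z: "in_domain J (($) (fst z))" for z
      unfolding F_def monomial_def
    proof (rule has_sum_phi_term_step[OF finite i z])
      fix I assume I: "I \<subseteq> J - {i}"
      have "in_domain (J - insert i I) (($) (fst z))"
        using in_domain_split(3)[OF z finite, of "insert i I"] I i by blast
      moreover have "J - insert i I = J - {i} - I"
        by blast
      ultimately have "in_domain (J - {i} - I) (($) (fst z))"
        by simp
      then show "(phi_term (($) (fst z)) (J - {i} - I) has_sum H (J - {i} - I) z) (terms_index (J - {i} - I))"
        using H[of I] by blast
    qed
    ultimately show ?thesis
      by blast
  qed
qed

text \<open>Through each point of the cover runs a curve that scales all coordinates of t by e^(2
  theta) and s by the matching power, so it stays on the cover. A factor with nonempty I takes each
  value at most once along the curve as far as the scaled monomial is concerned, so finitely many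
  factors vanish at only finitely many theta.\<close>

lemma pole_factor_nonzero_on_cover:
  fixes V :: "'m::finite point set"
  assumes V: "open V" "z0 \<in> V" "z0 \<in> double_cover" and L: "\<forall>f\<in>set L. snd f \<noteq> {}"
  shows "\<exists>z\<in>V \<inter> double_cover. denominator L z \<noteq> 0"
proof -
  obtain t s where z0: "z0 = (t, s)"
    by (metis surj_pair)
  have t: "t $ l \<noteq> 0" for l
    using V by (simp add: z0 double_cover_def)
  have s: "s\<^sup>2 = (\<Prod>l\<in>UNIV. t $ l)"
    using V by (simp add: z0 double_cover_def)
  define \<gamma> :: "real \<Rightarrow> 'm point" where
    "\<gamma> = (\<lambda>\<theta>. (exp (of_real (2 * \<theta>)) *s t, exp (of_real (real CARD('m) * \<theta>)) * s))"
  have cover: "\<gamma> \<theta> \<in> double_cover" for \<theta>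
  proof -
    have "(exp (of_real (real CARD('m) * \<theta>)) * s)\<^sup>2 = (\<Prod>l\<in>UNIV. exp (of_real (2 * \<theta>)) * t $ l)"
      by (simp add: power_mult_distrib s prod.distrib exp_of_nat_mult[symmetric] mult_ac)
    then show ?thesis
      by (simp add: \<gamma>_def double_cover_def t)
  qed
  have "continuous_on UNIV \<gamma>"
    unfolding \<gamma>_def vector_scalar_mult_def
    by (intro continuous_on_Pair continuous_on_vec_lambda continuous_intros)
  then have "(\<gamma> \<longlongrightarrow> \<gamma> 0) (nhds 0)"
    by (simp add: continuous_on_eq_continuous_at isCont_def tendsto_at_iff_tendsto_nhds)
  moreover have "\<gamma> 0 = z0"
    by (simp add: \<gamma>_def z0)
  ultimately have "(\<gamma> \<longlongrightarrow> z0) (nhds 0)"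
    by simp
  then have "\<forall>\<^sub>F \<theta> in nhds 0. \<gamma> \<theta> \<in> V"
    using V(1,2) by (rule topological_tendstoD)
  then obtain e where e: "e > 0" "\<And>\<theta>. \<bar>\<theta>\<bar> < e \<Longrightarrow> \<gamma> \<theta> \<in> V"
    unfolding eventually_nhds_metric by (auto simp: dist_real_def)
  have fin: "finite {\<theta>. pole_factor f (\<gamma> \<theta>) = 0}" if f: "f \<in> set L" for f
  proof -
    obtain m I where mI: "f = (m, I)"
      by (metis surj_pair)
    have card: "card I > 0"
      using L f mI by (auto simp: card_gt_0_iff)
    have mon: "monomial I (\<gamma> \<theta>) = of_real (exp (2 * real (card I) * \<theta>)) * monomial I z0" for \<theta>
    proof -
      have "exp (of_real (2 * \<theta>)) ^ card I = (of_real (exp (2 * real (card I) * \<theta>)) :: complex)"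
        by (simp add: exp_of_nat_mult[symmetric] exp_of_real[symmetric] mult_ac)
      then show ?thesis
        by (simp add: monomial_def \<gamma>_def z0 prod.distrib)
    qed
    have "\<theta> = \<theta>'" if "pole_factor f (\<gamma> \<theta>) = 0" "pole_factor f (\<gamma> \<theta>') = 0" for \<theta> \<theta>'
    proof -
      have nz: "q powi m * monomial I z0 \<noteq> 0"
        using t by (simp add: monomial_def z0)
      have "of_real (exp (2 * real (card I) * \<theta>)) * (q powi m * monomial I z0) =
          of_real (exp (2 * real (card I) * \<theta>')) * (q powi m * monomial I z0)"
        using that by (simp add: mI pole_factor_def mon mult_ac)
      then have "(of_real (exp (2 * real (card I) * \<theta>)) :: complex) = of_real (exp (2 * real (card I) * \<theta>'))"
        using nz unfolding mult_cancel_right by blast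
      then have "exp (2 * real (card I) * \<theta>) = exp (2 * real (card I) * \<theta>')"
        by (simp only: of_real_eq_iff)
      then show ?thesis
        using card by auto
    qed
    then have "\<exists>\<theta>. {\<theta>. pole_factor f (\<gamma> \<theta>) = 0} \<subseteq> {\<theta>}"
      by blast
    then show ?thesis
      by (metis finite.emptyI finite.insertI finite_subset)
  qed
  have "infinite {0<..<e}"
    using e(1) by (rule infinite_Ioo)
  moreover have "finite (\<Union>f\<in>set L. {\<theta>. pole_factor f (\<gamma> \<theta>) = 0})"
    using fin by simp
  ultimately obtain \<theta> where \<theta>: "\<theta> \<in> {0<..<e}" "\<theta> \<notin> (\<Union>f\<in>set L. {\<theta>. pole_factor f (\<gamma> \<theta>) = 0})"
    by (meson finite_subset subsetI)
  then have "denominator L (\<gamma> \<theta>) \<noteq> 0" "\<gamma> \<theta> \<in> V"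
    using e(2)[of \<theta>] by (auto simp: denominator_eq_0_iff)
  then show ?thesis
    using cover by blast
qed

text \<open>The factor \<open>snd z\<close> is the root s that carries the half-integral exponents.
  Where no factor of the local denominator vanishes the quotient is holomorphic, so every pole lies
  on the zero set of some factor with nonempty index set.\<close>

lemma torus_meromorphic_cover:
  fixes F :: "'m::finite point \<Rightarrow> complex"
  assumes F: "torus_meromorphic F"
  shows "meromorphic_on_cover (\<lambda>z. snd z * F z)"
    and "cover_poles (\<lambda>z. snd z * F z) \<subseteq>
      {(t, s). \<exists>(m::int) J. J \<noteq> {} \<and> q powi m * (\<Prod>j\<in>J. t $ j) = 1}"
proof -
  have local: "\<exists>U g L. p \<in> U \<and> multi_holomorphic_on g U \<and> (\<forall>f\<in>set L. snd f \<noteq> {}) \<and>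
      (\<forall>z\<in>U. denominator L z \<noteq> 0 \<longrightarrow> snd z * F z = g z / denominator L z)" if "p \<in> double_cover" for p
  proof -
    have "\<forall>l. fst p $ l \<noteq> 0"
      using that by (auto simp: double_cover_def)
    then obtain U g L where *: "p \<in> U" "multi_holomorphic_on g U" "\<And>f. f \<in> set L \<Longrightarrow> snd f \<noteq> {}"
      "\<And>z. z \<in> U \<Longrightarrow> denominator L z \<noteq> 0 \<Longrightarrow> F z = g z / denominator L z"
      by (rule torus_meromorphicD[OF F]) (rule that)
    have "multi_holomorphic_on (\<lambda>z. snd z * g z) U"
      using *(2) unfolding multi_holomorphic_on_iff
      by (simp add: complex_differentiable_at_mult complex_differentiable_at_snd)
    moreover have "\<forall>z\<in>U. denominator L z \<noteq> 0 \<longrightarrow> snd z * F z = snd z * g z / denominator L z"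
      using *(4) by simp
    ultimately show ?thesis
      using *(1,3) by (intro exI[of _ U] exI[of _ "\<lambda>z. snd z * g z"] exI[of _ L]) simp
  qed
  show "meromorphic_on_cover (\<lambda>z. snd z * F z)"
    unfolding meromorphic_on_cover_def
  proof
    fix p :: "'m point" assume p: "p \<in> double_cover"
    obtain U g L where *: "p \<in> U" "multi_holomorphic_on g U" "\<forall>f\<in>set L. snd f \<noteq> {}"
      "\<forall>z\<in>U. denominator L z \<noteq> 0 \<longrightarrow> snd z * F z = g z / denominator L z"
      using local[OF p] by blast
    have "multi_holomorphic_on (denominator L) U"
      using *(2) by (simp add: multi_holomorphic_on_iff complex_differentiable_at_denominator)
    moreover have "\<exists>z\<in>V \<inter> double_cover. denominator L z \<noteq> 0"
      if "open V" "V \<inter> double_cover \<noteq> {}" for V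
      using pole_factor_nonzero_on_cover[OF that(1) _ _ *(3)] that(2) by blast
    ultimately show "\<exists>U g h. p \<in> U \<and> multi_holomorphic_on g U \<and> multi_holomorphic_on h U \<and>
        (\<forall>V. open V \<and> V \<subseteq> U \<and> V \<inter> double_cover \<noteq> {} \<longrightarrow> (\<exists>z\<in>V \<inter> double_cover. h z \<noteq> 0)) \<and>
        (\<forall>z\<in>U \<inter> double_cover. h z \<noteq> 0 \<longrightarrow> snd z * F z = g z / h z)"
      using *(1,2,4) by (intro exI[of _ U] exI[of _ g] exI[of _ "denominator L"]) simp
  qed
  show "cover_poles (\<lambda>z. snd z * F z) \<subseteq> {(t, s). \<exists>(m::int) J. J \<noteq> {} \<and> q powi m * (\<Prod>j\<in>J. t $ j) = 1}"
  proof
    fix p :: "'m point" assume "p \<in> cover_poles (\<lambda>z. snd z * F z)"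
    then have p: "p \<in> double_cover" and not_hol: "\<not> holomorphic_at_cover (\<lambda>z. snd z * F z) p"
      by (auto simp: cover_poles_def)
    obtain U g L where *: "p \<in> U" "multi_holomorphic_on g U" "\<forall>f\<in>set L. snd f \<noteq> {}"
      "\<forall>z\<in>U. denominator L z \<noteq> 0 \<longrightarrow> snd z * F z = g z / denominator L z"
      using local[OF p] by blast
    have "denominator L p = 0"
    proof (rule ccontr)
      assume nz: "denominator L p \<noteq> 0"
      define W where "W = U \<inter> denominator L -` (- {0})"
      have "open U"
        using *(2) by (simp add: multi_holomorphic_on_iff)
      moreover have "continuous_on UNIV (denominator L)"
        by (intro continuous_at_imp_continuous_on ballI complex_differentiable_at_imp_isCont
            complex_differentiable_at_denominator)
      ultimately have "open W"
        unfolding W_def by (intro open_Int open_vimage) auto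
      moreover have "complex_differentiable_at (\<lambda>z. g z / denominator L z) z" if "z \<in> W" for z
        using that *(2) by (intro complex_differentiable_at_divide complex_differentiable_at_denominator)
          (auto simp: W_def multi_holomorphic_on_iff)
      ultimately have "multi_holomorphic_on (\<lambda>z. g z / denominator L z) W"
        by (simp add: multi_holomorphic_on_iff)
      moreover have "p \<in> W"
        using *(1) nz by (simp add: W_def)
      moreover have "\<forall>z\<in>W \<inter> double_cover. snd z * F z = g z / denominator L z"
        using *(4) by (simp add: W_def)
      ultimately show False
        using not_hol unfolding holomorphic_at_cover_def by blast
    qed
    then obtain m I where "(m, I) \<in> set L" "pole_factor (m, I) p = 0"
      by (auto simp: denominator_eq_0_iff)
    then have "I \<noteq> {}" "q powi m * (\<Prod>j\<in>I. fst p $ j) = 1"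
      using *(3) by (auto simp: pole_factor_def monomial_def)
    then show "p \<in> {(t, s). \<exists>(m::int) J. J \<noteq> {} \<and> q powi m * (\<Prod>j\<in>J. t $ j) = 1}"
      by (cases p) auto
  qed
qed

end

section \<open>Comparison of the terms of G with \<open>phi_term\<close>\<close>

context charged_fermions
begin

text \<open>A change of indices: a list of half-integers corresponds to the integer function of its
  sites, through the enumeration i of the coordinates. List positions start at 0 and the enumeration
  at 1, hence the shifts by one.\<close>

lemma has_sum_G_term:
  fixes i :: "nat \<Rightarrow> 'm::finite" and t :: "complex ^ 'm"
  assumes i: "bij_betw i {1..n} UNIV" and F: "(nome.phi_term u (($) t) UNIV has_sum F) (UNIV \<times> UNIV)"
    and nome: "nome q u"
  shows "(G_term u (map (\<lambda>j. t $ i j) [1..<n+1]) s has_sum s * F) (G_index n)"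
proof -
  interpret nome q u
    by (rule nome)
  let ?ts = "map (\<lambda>j. t $ i j) [1..<n+1]"
  let ?b = "\<lambda>c :: 'm \<Rightarrow> int. map (\<lambda>j. site (c (i j))) [1..<n+1]"
  let ?c = "\<lambda>(b :: rat list) l. \<lfloor>b ! (inv_into {1..n} i l - 1)\<rfloor>"
  have nth: "?b c ! j = site (c (i (Suc j)))" "?ts ! j = t $ i (Suc j)" if "j < n" for c j
    using that by (simp_all add: nth_append del: upt_Suc)
  have inv: "inv_into {1..n} i (i j) = j" if "j \<in> {1..n}" for j
    using i that by (intro inv_into_f_f) (auto simp: bij_betw_def)
  have inv': "inv_into {1..n} i l \<in> {1..n}" "i (inv_into {1..n} i l) = l" for l
  proof -
    have "l \<in> i ` {1..n}"
      using i by (simp add: bij_betw_def)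
    then show "inv_into {1..n} i l \<in> {1..n}" "i (inv_into {1..n} i l) = l"
      by (rule inv_into_into, rule f_inv_into_f)
  qed
  have "((\<lambda>p. s * phi_term (($) t) UNIV p) has_sum s * F) (UNIV \<times> UNIV)"
    using F by (rule has_sum_cmult_right)
  also have "?this \<longleftrightarrow> (G_term u ?ts s has_sum s * F) (G_index n)"
  proof (rule has_sum_reindex_bij_witness[where j = "\<lambda>(k, c). (k, ?b c)" and i = "\<lambda>(k, b). (k, ?c b)"])
    fix p :: "int \<times> ('m \<Rightarrow> int)"
    obtain k c where p: "p = (k, c)"
      by (metis surj_pair)
    have "?c (?b c) l = c l" for l
    proof -
      have "inv_into {1..n} i l - 1 < n" "Suc (inv_into {1..n} i l - 1) = inv_into {1..n} i l"
        using inv'(1)[of l] by auto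
      then show ?thesis
        using nth(1)[of "inv_into {1..n} i l - 1" c] inv'(2)[of l] by simp
    qed
    then show "(case (case p of (k, c) \<Rightarrow> (k, ?b c)) of (k, b) \<Rightarrow> (k, ?c b)) = p"
      by (simp add: p fun_eq_iff)
    have half: "set (?b c) \<subseteq> half_ints"
      by auto
    then show "(case p of (k, c) \<Rightarrow> (k, ?b c)) \<in> G_index n"
      by (simp add: p G_index_def)
    have "floor ` set (?b c) = c ` i ` {1..n}"
    proof -
      have "set [1..<n+1] = {1..n}"
        by auto
      then show ?thesis
        by (simp only: set_map image_image floor_site)
    qed
    also have "\<dots> = c ` UNIV"
      using i by (simp add: bij_betw_def)
    finally have occ: "G_coeff (?b c) = occ (c ` UNIV)"
      using G_coeff_eq_occ[OF half] by simp
    have "(\<Prod>j<length ?ts. (?ts ! j) powi \<lfloor>?b c ! j\<rfloor>) = (\<Prod>j<n. t $ i (Suc j) powi c (i (Suc j)))"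
      using nth by (intro prod.cong) auto
    also have "\<dots> = (\<Prod>j\<in>{1..n}. t $ i j powi c (i j))"
      by (rule prod.reindex_bij_witness[of _ "\<lambda>j. j - 1" Suc]) auto
    also have "\<dots> = (\<Prod>l\<in>UNIV. t $ l powi c l)"
      using prod.reindex_bij_betw[OF i, of "\<lambda>l. t $ l powi c l"] .
    finally have eq: "(\<Prod>j<length ?ts. (?ts ! j) powi \<lfloor>?b c ! j\<rfloor>) = (\<Prod>l\<in>UNIV. t $ l powi c l)" .
    show "G_term u ?ts s (case p of (k, c) \<Rightarrow> (k, ?b c)) = s * phi_term (($) t) UNIV p"
      by (simp only: p G_term_def phi_term_def prod.case occ eq mult_ac)
  next
    fix p :: "int \<times> rat list"
    assume p': "p \<in> G_index n"
    obtain k b where p: "p = (k, b)"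
      by (metis surj_pair)
    have b: "length b = n" "set b \<subseteq> half_ints"
      using p' by (auto simp: p G_index_def)
    have "?b (?c b) = b"
    proof (rule nth_equalityI)
      fix j assume "j < length (?b (?c b))"
      then have j: "j < n"
        by (simp del: upt_Suc)
      then have "b ! j \<in> half_ints"
        using b by (auto simp: subset_iff)
      moreover have "inv_into {1..n} i (i (Suc j)) = Suc j"
        using j by (intro inv) auto
      moreover have "?b (?c b) ! j = site (?c b (i (Suc j)))"
        by (rule nth(1)[OF j, of "?c b"])
      ultimately show "?b (?c b) ! j = b ! j"
        by (simp only: diff_Suc_1 site_floor)
    qed (simp add: b del: upt_Suc)
    then show "(case (case p of (k, b) \<Rightarrow> (k, ?c b)) of (k, c) \<Rightarrow> (k, ?b c)) = p"
      by (simp add: p)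
  qed auto
  finally show ?thesis .
qed

end

theorem theorem3p2:
  fixes scale :: "complex \<Rightarrow> 'v::ab_group_add \<Rightarrow> 'v"
    and psi psis :: "rat \<Rightarrow> 'v \<Rightarrow> 'v" and vac :: 'v
    and n :: nat
    and G :: "qt_monomial list \<Rightarrow> fseries"
    and rest :: "nat set \<Rightarrow> qt_monomial list"
    and subsets :: "nat \<Rightarrow> nat set set"
  assumes fock: "charged_fermions scale psi psis vac"
    and n: "n \<ge> 1"
    and G: "G = charged_fermions.G_series scale psi psis vac"
    and rest: "rest = (\<lambda>I. map (\<lambda>j. mon 0 {j}) (filter (\<lambda>j. j \<notin> I) [2..<n+1]))"
    and subsets: "subsets = (\<lambda>s. {I. I \<subseteq> {2..n} \<and> card I = s})"
  shows
    "(\<forall>a. G (mon 0 {1} # rest {}) a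
          + (Poly_Mapping.lookup (lpoly_mon (mon (-1/2) {1..n})) \<odot> G (mon (-1) {1} # rest {})) a
        = (delta_half (mon 0 {1}) \<odot> G (rest {})) a
          + (\<Sum>s\<in>{1..n-1}. \<Sum>I\<in>subsets s.
               - G (mon 0 (insert 1 I) # rest I) a
               + (delta_half (mon 0 (insert 1 I)) \<odot> G (rest I)) a))
   \<and> (\<forall>a. (Poly_Mapping.lookup
             (\<Prod>s\<in>{0..n-1}. \<Prod>I\<in>subsets s. 1 - lpoly_mon (mon 1 (insert 1 I)))
           \<odot> (\<lambda>a'. G (mon 1 {1} # rest {}) a'
                + (Poly_Mapping.lookup (lpoly_mon (mon (1/2) {1..n}))
                   \<odot> (\<lambda>a''. \<Sum>s\<in>{0..n-1}. \<Sum>I\<in>subsets s.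
                        (-1) ^ s * G (mon 0 (insert 1 I) # rest I) a'')) a')) a
        = 0)
   \<and> (\<forall>(i :: nat \<Rightarrow> 'm::finite) \<tau>. bij_betw i {1..n} UNIV \<and> Im \<tau> > 0 \<longrightarrow>
        (let q = exp (2 * of_real pi * \<i> * \<tau>);
             u = exp (2 * of_real pi * \<i> * \<tau> / 24);
             D = {(t :: complex ^ 'm, s :: complex). (t, s) \<in> double_cover \<and>
                    (\<forall>j. norm (t $ j) > 1) \<and> norm (\<Prod>j\<in>UNIV. t $ j) < 1 / norm q};
             summands = (\<lambda>(t, s). charged_fermions.G_term scale psi psis vac u
                            (map (\<lambda>j. t $ i j) [1..<n+1]) s);
             N = charged_fermions.G_index n
         in (\<forall>p\<in>D. summands p summable_on N) \<and>
            (\<exists>F. meromorphic_on_cover F \<and>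
                 cover_poles F \<subseteq> {(t, s). \<exists>(m::int) J. J \<noteq> {} \<and> q powi m * (\<Prod>j\<in>J. t $ j) = 1} \<and>
                 (\<forall>p\<in>D. F p = infsum (summands p) N))))"
proof (intro conjI allI impI)
  interpret charged_fermions scale psi psis vac
    by (rule fock)
  have G': "G = fsubst G_coeff"
    by (simp add: G G_series_def)
  interpret coefficient_data G_coeff n rest
    by unfold_locales (fact G_coeff_eq_occ, fact G_coeff_eq_0, fact n, fact rest)
  have card: "card {2..n} = n - 1"
    by simp
  have sum0: "(\<Sum>s\<in>{0..n-1}. \<Sum>I\<in>subsets s. f I) = (\<Sum>I\<in>Pow {2..n}. f I)"
    and sum1: "(\<Sum>s\<in>{1..n-1}. \<Sum>I\<in>subsets s. f I) = (\<Sum>I\<in>Pow {2..n} - {{}}. f I)"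
    for f :: "nat set \<Rightarrow> complex fls"
    using sum_by_card[of "{2..n}" f] unfolding subsets card by simp_all
  show "G (mon 0 {1} # rest {}) a
          + (Poly_Mapping.lookup (lpoly_mon (mon (-1/2) {1..n})) \<odot> G (mon (-1) {1} # rest {})) a
        = (delta_half (mon 0 {1}) \<odot> G (rest {})) a
          + (\<Sum>s\<in>{1..n-1}. \<Sum>I\<in>subsets s.
               - G (mon 0 (insert 1 I) # rest I) a
               + (delta_half (mon 0 (insert 1 I)) \<odot> G (rest I)) a)" for a
    unfolding sum1 unfolding G' by (rule formula_a)
  have alternating: "(\<Sum>s\<in>{0..n-1}. \<Sum>I\<in>subsets s. (-1) ^ s * G (mon 0 (insert 1 I) # rest I) a) =
      (\<Sum>I\<in>Pow {2..n}. (-1) ^ card I * G (mon 0 (insert 1 I) # rest I) a)" for a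
  proof -
    have "(\<Sum>s\<in>{0..n-1}. \<Sum>I\<in>subsets s. (-1) ^ s * G (mon 0 (insert 1 I) # rest I) a) =
        (\<Sum>s\<in>{0..n-1}. \<Sum>I\<in>subsets s. (-1) ^ card I * G (mon 0 (insert 1 I) # rest I) a)"
      by (intro sum.cong refl) (simp add: subsets)
    then show ?thesis
      by (simp only: sum0)
  qed
  \<comment> \<open>The empty subset contributes the factor 1 - q t_1, which annihilates the
    bracket. It is split off on the right to fit the shape of \<open>formula_b\<close>.\<close>
  have "(\<Prod>s\<in>{0..n-1}. \<Prod>I\<in>subsets s. 1 - lpoly_mon (mon 1 (insert 1 I))) =
      (\<Prod>s\<in>{0..n-1} - {0}. \<Prod>I\<in>subsets s. 1 - lpoly_mon (mon 1 (insert 1 I))) *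
      (1 - lpoly_mon (mon 1 {1}))"
  proof -
    have "subsets 0 = {{}}"
      unfolding subsets using finite_subset[of _ "{2..n}"] by (auto simp: card_eq_0_iff)
    then show ?thesis
      by (subst prod.remove[of _ 0]) (simp_all add: mult.commute)
  qed
  then show "(Poly_Mapping.lookup
             (\<Prod>s\<in>{0..n-1}. \<Prod>I\<in>subsets s. 1 - lpoly_mon (mon 1 (insert 1 I)))
           \<odot> (\<lambda>a'. G (mon 1 {1} # rest {}) a'
                + (Poly_Mapping.lookup (lpoly_mon (mon (1/2) {1..n}))
                   \<odot> (\<lambda>a''. \<Sum>s\<in>{0..n-1}. \<Sum>I\<in>subsets s.
                        (-1) ^ s * G (mon 0 (insert 1 I) # rest I) a'')) a')) a
        = 0" for a
    unfolding alternating unfolding G' inner_b by (simp only: formula_b[OF refl])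
next
  interpret charged_fermions scale psi psis vac
    by (rule fock)
  fix i :: "nat \<Rightarrow> 'm" and \<tau> :: complex
  assume "bij_betw i {1..n} UNIV \<and> Im \<tau> > 0"
  then have i: "bij_betw i {1..n} UNIV" and \<tau>: "Im \<tau> > 0"
    by auto
  define q where "q = exp (2 * of_real pi * \<i> * \<tau>)"
  define u where "u = exp (2 * of_real pi * \<i> * \<tau> / 24)"
  have nome: "nome q u"
  proof
    show "norm q < 1"
      using \<tau> by (simp add: q_def)
    show "u ^ 24 = q"
      by (simp add: u_def q_def exp_of_nat_mult[symmetric] mult_ac)
    show "u \<noteq> 0"
      by (simp add: u_def)
  qed
  interpret nome q u
    by (rule nome)
  obtain F where F: "torus_meromorphic F"
    "\<And>z :: 'm point. in_domain UNIV (($) (fst z)) \<Longrightarrow>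
      (phi_term (($) (fst z)) UNIV has_sum F z) (terms_index UNIV)"
    using exists_torus_meromorphic_sum[of "UNIV :: 'm set"] by blast
  define D where "D = {(t :: complex ^ 'm, s :: complex). (t, s) \<in> double_cover \<and>
                    (\<forall>j. norm (t $ j) > 1) \<and> norm (\<Prod>j\<in>UNIV. t $ j) < 1 / norm q}"
  define summands where "summands = (\<lambda>(t :: complex ^ 'm, s). G_term u (map (\<lambda>j. t $ i j) [1..<n+1]) s)"
  have sum: "(summands p has_sum snd p * F p) (G_index n)" if "p \<in> D" for p
  proof -
    obtain t s where p: "p = (t, s)"
      by (metis surj_pair)
    have "norm (\<Prod>j\<in>UNIV. t $ j) * norm q < 1"
      using that q_nonzero by (simp add: p D_def field_simps)
    then have "in_domain UNIV (($) (fst p))"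
      using that by (simp add: p D_def in_domain_def)
    then have "(phi_term (($) t) UNIV has_sum F p) (UNIV \<times> UNIV)"
      using F(2)[of p] by (simp add: p)
    then show ?thesis
      using has_sum_G_term[OF i _ nome, of t "F p" s] by (simp add: p summands_def)
  qed
  have "(\<forall>p\<in>D. summands p summable_on G_index n) \<and>
            (\<exists>F. meromorphic_on_cover F \<and>
                 cover_poles F \<subseteq> {(t, s). \<exists>(m::int) J. J \<noteq> {} \<and> q powi m * (\<Prod>j\<in>J. t $ j) = 1} \<and>
                 (\<forall>p\<in>D. F p = infsum (summands p) (G_index n)))"
  proof (intro conjI ballI exI[of _ "\<lambda>z. snd z * F z"])
    show "summands p summable_on G_index n" if "p \<in> D" for p
      using sum[OF that] by (rule has_sum_imp_summable)
    show "snd p * F p = infsum (summands p) (G_index n)" if "p \<in> D" for p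
      using infsumI[OF sum[OF that]] by simp
  qed (rule torus_meromorphic_cover[OF F(1)])+
  then show "let q = exp (2 * of_real pi * \<i> * \<tau>);
             u = exp (2 * of_real pi * \<i> * \<tau> / 24);
             D = {(t :: complex ^ 'm, s :: complex). (t, s) \<in> double_cover \<and>
                    (\<forall>j. norm (t $ j) > 1) \<and> norm (\<Prod>j\<in>UNIV. t $ j) < 1 / norm q};
             summands = (\<lambda>(t, s). charged_fermions.G_term scale psi psis vac u
                            (map (\<lambda>j. t $ i j) [1..<n+1]) s);
             N = charged_fermions.G_index n
         in (\<forall>p\<in>D. summands p summable_on N) \<and>
            (\<exists>F. meromorphic_on_cover F \<and>
                 cover_poles F \<subseteq> {(t, s). \<exists>(m::int) J. J \<noteq> {} \<and> q powi m * (\<Prod>j\<in>J. t $ j) = 1} \<and>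
                 (\<forall>p\<in>D. F p = infsum (summands p) N))"
    unfolding D_def summands_def q_def u_def Let_def .
qed

end
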